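(* Every function $f\in\mathcal R^0_{[1]}(\mathbb R^2)$ that is non-negative on $\mathbb R^2$ can be written as $f=\sum_{i=1}^r f_i^2$ with $f_i\in\mathcal R^0_{[1]}(\mathbb R^2)$. Moreover, if $f=p/q$ on $\mathrm{dom}(f)$ where $p,q\in\mathbb R[x,y]$ are sums of squares of polynomials and $q$ is locally positive definite at every point of $\mathbb R^2$, then the $f_i$ can be chosen of the form $f_i=r_i/D$ with $r_i\in\mathbb R[x,y]$ and common denominator $D=q\cdot\prod_{a\in\mathcal Z_f(q)}q_a$, where $\mathcal Z_f(q)=\{a\in\mathbb R^2: q(a)=0,\ f(a)\neq0\}$ and $q_a$ is the homogeneous component of lowest degree of $q$ at $a$ (viewed as a polynomial in $(x-a_1,y-a_2)$).
   Context: For $k\in\mathbb N\cup\{\infty\}$, $\mathcal R^k(\mathbb R^2)$ denotes the ring of functions $f:\mathbb R^2\to\mathbb R$ of class $C^k$ that coincide with $p/q$ ($p,q$ polynomials, $q$ nonvanishing there) on some nonempty Zariski open set; $\mathrm{dom}(f)$ is the largest Zariski open set on which the associated rational function is regular. For $l\in\mathbb N$: consider compositions $\pi:M\to\mathbb R^2$ of successive blowings-up $M_i\to M_{i-1}$ ($M_0=\mathbb R^2$), each centred at points. An infinitely near point of order $j$ is a sequence $a_0\in M_0,\dots,a_j\in M_j$ where $M_i$ is the blowing-up of $M_{i-1}$ at $a_{i-1}$ and $a_i$ maps to $a_{i-1}$; the number of stages of $\pi$ is the maximal order of infinitely near points in $M$. $\mathcal R^k_{[l]}(\mathbb R^2)$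 is the set of $f\in\mathcal R^k(\mathbb R^2)$ for which there is such a $\pi$ with at most $l$ stages such that $f\circ\pi$ is regular on $M$. A polynomial $p\in\mathbb R[x,y]$ is locally positive definite at $a=(a_1,a_2)$ if, writing $p=\sum_{i\ge m}p_i$ with $p_i$ homogeneous of degree $i$ in the variables $(x-a_1,y-a_2)$ and $p_m\neq 0$, the lowest component $p_m$ is positive at every point of $\mathbb R^2$ other than $a$ (when $p(a)\ne 0$ this means $p(a)>0$). *)

theory Defs
  imports "HOL-Analysis.Analysis" "HOL-Computational_Algebra.Polynomial"
begin

text \<open>Bivariate real polynomials are represented as \<open>real poly poly\<close>:
  the outer variable is y, the coefficients are polynomials in x.\<close>

type_synonym bipoly = "real poly poly"

definition evalp :: "bipoly \<Rightarrow> real \<times> real \<Rightarrow> real" where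
  "evalp P z = poly (poly P [:snd z:]) (fst z)"

definition hcoef :: "bipoly \<Rightarrow> nat \<Rightarrow> nat \<Rightarrow> real" where
  "hcoef P i j = coeff (coeff P j) i"

definition shift2 :: "real \<times> real \<Rightarrow> bipoly \<Rightarrow> bipoly" where
  "shift2 a P = map_poly (\<lambda>c. pcompose c [:fst a, 1:]) (pcompose P [:[:snd a:], 1:])"

definition low_deg :: "real \<times> real \<Rightarrow> bipoly \<Rightarrow> nat" where
  "low_deg a P = (LEAST m. \<exists>i\<le>m. hcoef (shift2 a P) i (m - i) \<noteq> 0)"

definition low_comp :: "real \<times> real \<Rightarrow> bipoly \<Rightarrow> real \<times> real \<Rightarrow> real" where
  "low_comp a P z = (\<Sum>i\<le>low_deg a P.
      hcoef (shift2 a P) i (low_deg a P - i) * (fst z - fst a) ^ i * (snd z - snd a) ^ (low_deg a P - i))"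

definition loc_pos_def :: "real \<times> real \<Rightarrow> bipoly \<Rightarrow> bool" where
  "loc_pos_def a P \<longleftrightarrow> P \<noteq> 0 \<and> (\<forall>z. z \<noteq> a \<longrightarrow> low_comp a P z > 0)"

definition is_sos :: "bipoly \<Rightarrow> bool" where
  "is_sos P \<longleftrightarrow> (\<exists>Ps :: bipoly list. P = (\<Sum>Q\<leftarrow>Ps. Q ^ 2))"

text \<open>Regulous functions of class C^0: continuous and equal to a quotient of
  polynomials on a nonempty Zariski open set {h \<noteq> 0}, h a nonzero polynomial.\<close>
definition regulous0 :: "(real \<times> real \<Rightarrow> real) \<Rightarrow> bool" where
  "regulous0 f \<longleftrightarrow> continuous_on UNIV f \<and>
     (\<exists>P Q H :: bipoly. H \<noteq> 0 \<and>
        (\<forall>z. evalp H z \<noteq> 0 \<longrightarrow> evalp Q z \<noteq> 0 \<and> f z = evalp P z / evalp Q z))"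

text \<open>dom(f): points where the rational function associated to f admits a
  representation P'/Q' with Q' nonvanishing at the point.\<close>
definition rdom :: "(real \<times> real \<Rightarrow> real) \<Rightarrow> (real \<times> real) set" where
  "rdom f = {x. \<exists>P Q H :: bipoly. evalp Q x \<noteq> 0 \<and> H \<noteq> 0 \<and>
        (\<forall>z. evalp H z \<noteq> 0 \<longrightarrow> evalp Q z \<noteq> 0 \<and> f z = evalp P z / evalp Q z)}"

definition reg_at :: "(real \<times> real \<Rightarrow> real) \<Rightarrow> real \<times> real \<Rightarrow> bool" where
  "reg_at g z \<longleftrightarrow> (\<exists>P Q :: bipoly. \<exists>e>0. \<forall>w\<in>ball z e.
       evalp Q w \<noteq> 0 \<and> g w = evalp P w / evalp Q w)"

text \<open>The two standard affine charts of the blowing-up of R^2 at a.\<close>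
definition chart1 :: "real \<times> real \<Rightarrow> real \<times> real \<Rightarrow> real \<times> real" where
  "chart1 a w = (fst a + fst w, snd a + fst w * snd w)"

definition chart2 :: "real \<times> real \<Rightarrow> real \<times> real \<Rightarrow> real \<times> real" where
  "chart2 a w = (fst a + fst w * snd w, snd a + snd w)"

text \<open>f \<circ> \<pi> is regular on M, where \<pi> : M \<rightarrow> R^2 is the blowing-up of the finite
  set of points C (a one-stage sequence of point blowings-up).\<close>
definition blowup_regular :: "(real \<times> real) set \<Rightarrow> (real \<times> real \<Rightarrow> real) \<Rightarrow> bool" where
  "blowup_regular C f \<longleftrightarrow>
     (\<forall>z. z \<notin> C \<longrightarrow> reg_at f z) \<and>
     (\<forall>a\<in>C. \<forall>t. reg_at (f \<circ> chart1 a) (0, t) \<and> reg_at (f \<circ> chart2 a) (t, 0))"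

definition regulous0_1 :: "(real \<times> real \<Rightarrow> real) \<Rightarrow> bool" where
  "regulous0_1 f \<longleftrightarrow> regulous0 f \<and> (\<exists>C. finite C \<and> blowup_regular C f)"

end

theory Submission
  imports Defs "HOL-Complex_Analysis.Complex_Analysis"
    "HOL-Computational_Algebra.Polynomial_Factorial"
    "HOL-Computational_Algebra.Fundamental_Theorem_Algebra"
    "HOL-Computational_Algebra.Field_as_Ring"
begin

text \<open>
  Hilbert's 17th problem in two variables is solved with a denominator \<open>s(x)\<close>. Gluing certificates
  algebraically over \<open>g \<ge> 0\<close> and \<open>g \<le> 0\<close> reduces this to short intervals of \<open>x\<close>, and monic polynomials in \<open>y\<close>
  with simple roots suffice. Near a point \<open>x\<^sub>0\<close> half of the complex roots can be chosen so that the product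
  \<open>G\<close> of their linear factors has coefficients holomorphic in \<open>x\<close> and \<open>h = G G\<^sup>*\<close> on both sides of \<open>x\<^sub>0\<close>; a
  truncation of \<open>G\<close> gives the certificate. A denominator \<open>s(x)\<close> and one \<open>t(y)\<close>, with equal root
  multiplicities, add up to a locally positive definite multiplier.

  If \<open>f = P / Q\<close> is in lowest terms and becomes regular after one blowing-up, then the lowest component of \<open>Q\<close>
  at each point has no real zero besides the origin, which makes \<open>Q\<^sup>2\<close> locally positive definite.
  For \<open>f = p / q\<close> with sums of squares \<open>p\<close>, \<open>q\<close> the summands of \<open>p q / q\<^sup>2\<close> need not be continuous where \<open>q\<close>
  vanishes and \<open>f\<close> does not; multiplying by \<open>q\<^sub>a\<^sup>2\<close> and Lagrange's identity repair this at one point \<open>a\<close>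
  at a time. A quotient with locally positive definite denominator that has limits at the zeros
  is regular after blowing up these zeros.
\<close>


section \<open>Bivariate polynomials\<close>

text \<open>A locally positive definite denominator has isolated zeros, whereas a multiplier
  \<open>M^2\<close> with \<open>M^2 h\<close> a sum of squares may vanish along curves. A
  denominator in x vanishes on vertical lines, one in y on horizontal lines, so their sum vanishes
  on a finite grid only. Equal multiplicities matter since x^(2k) + y^(2l) with k \<noteq> l has a
  lowest component that vanishes along an axis. Near a parameter where the discriminant of
  \<open>h\<close> vanishes, the roots in y may be permuted when x runs around it in the complex
  plane, so a choice of half of them made on one side need not fit the other side. Real roots would
  exclude any choice compatible with conjugation, hence the passage to a strictly positive
  perturbation. Lowest components are what a blowing-up sees: in a chart, numerator and denominator
  share a power of the exceptional coordinate u, and the rest of the denominator restricts to its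
  lowest component on u = 0. A limit l at the centre makes the lowest component of the numerator l
  times that of the denominator, so the quotient has the constant value l there.\<close>

lemma evalp_0 [simp]: "evalp 0 z = 0"
  and evalp_1 [simp]: "evalp 1 z = 1"
  and evalp_add [simp]: "evalp (P + Q) z = evalp P z + evalp Q z"
  and evalp_diff [simp]: "evalp (P - Q) z = evalp P z - evalp Q z"
  and evalp_uminus [simp]: "evalp (- P) z = - evalp P z"
  and evalp_mult [simp]: "evalp (P * Q) z = evalp P z * evalp Q z"
  and evalp_power [simp]: "evalp (P ^ n) z = evalp P z ^ n"
  and evalp_const_poly [simp]: "evalp [:c:] z = poly c (fst z)"
  and evalp_smult [simp]: "evalp (smult c P) z = poly c (fst z) * evalp P z"
  and evalp_pCons [simp]: "evalp (pCons c P) z = poly c (fst z) + snd z * evalp P z"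
  by (simp_all add: evalp_def)

lemma evalp_sum [simp]: "evalp (sum f A) z = (\<Sum>i\<in>A. evalp (f i) z)"
  by (induction A rule: infinite_finite_induct) simp_all

lemma evalp_prod [simp]: "evalp (prod f A) z = (\<Prod>i\<in>A. evalp (f i) z)"
  by (induction A rule: infinite_finite_induct) simp_all

lemma evalp_sum_list [simp]: "evalp (sum_list Ps) z = (\<Sum>P\<leftarrow>Ps. evalp P z)"
  by (induction Ps) simp_all

abbreviation bcst :: "real \<Rightarrow> bipoly" where "bcst c \<equiv> [:[:c:]:]"
abbreviation bX :: bipoly where "bX \<equiv> [:[:0, 1:]:]"
abbreviation bY :: bipoly where "bY \<equiv> [:0, 1:]"

lemma evalp_sum_coeff:
  assumes "degree P \<le> n"
  shows "evalp P (x, y) = (\<Sum>j\<le>n. poly (coeff P j) x * y ^ j)"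
proof -
  have "evalp P (x, y) = poly (\<Sum>j\<le>degree P. coeff P j * [:y:] ^ j) x"
    by (simp add: evalp_def poly_altdef)
  also have "\<dots> = (\<Sum>j\<le>degree P. poly (coeff P j) x * y ^ j)"
    by (simp add: poly_sum)
  also have "\<dots> = (\<Sum>j\<le>n. poly (coeff P j) x * y ^ j)"
    by (rule sum.mono_neutral_left) (use assms in \<open>auto simp: coeff_eq_0\<close>)
  finally show ?thesis .
qed

lemma evalp_map_poly: "evalp P (x, y) = poly (map_poly (\<lambda>c. poly c x) P) y"
  by (induction P) (auto simp: map_poly_pCons)

lemma continuous_on_evalp [continuous_intros]:
  "continuous_on S f \<Longrightarrow> continuous_on S (\<lambda>z. evalp P (f z))"
  by (induction P) (auto intro!: continuous_intros)

lemma isCont_evalp [continuous_intros]: "isCont (evalp P) z"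
  using continuous_on_evalp[OF continuous_on_id, of UNIV P]
  by (metis UNIV_I continuous_on_eq_continuous_at open_UNIV)

lemma evalp_eq_0_box:
  assumes "\<And>x y. a < x \<Longrightarrow> x < b \<Longrightarrow> c < y \<Longrightarrow> y < d \<Longrightarrow> evalp P (x, y) = 0" "a < b" "c < d"
  shows "P = 0"
proof -
  have "poly (coeff P j) x = 0" if x: "a < x" "x < b" for x j
  proof -
    let ?q = "map_poly (\<lambda>c. poly c x) P"
    have "infinite {c<..<d}" using assms(3) by simp
    moreover have "{c<..<d} \<subseteq> {y. poly ?q y = 0}"
      using assms(1)[OF x] by (auto simp: evalp_map_poly)
    ultimately have "infinite {y. poly ?q y = 0}" using finite_subset by blast
    then have "?q = 0" using poly_roots_finite by blast
    then show ?thesis by (metis coeff_0 coeff_map_poly poly_0)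
  qed
  then have "{a<..<b} \<subseteq> {x. poly (coeff P j) x = 0}" for j by auto
  moreover have "infinite {a<..<b}" using assms(2) by simp
  ultimately have "infinite {x. poly (coeff P j) x = 0}" for j using finite_subset by blast
  then have "coeff P j = 0" for j using poly_roots_finite by blast
  then show ?thesis by (simp add: poly_eqI)
qed

lemma evalp_eq_0_open:
  assumes "open S" "S \<noteq> {}" "\<And>z. z \<in> S \<Longrightarrow> evalp P z = 0"
  shows "P = 0"
proof -
  obtain x0 y0 where "(x0, y0) \<in> S" using assms(2) by (metis ex_in_conv surj_pair)
  then obtain A B where AB: "open A" "open B" "x0 \<in> A" "y0 \<in> B" "A \<times> B \<subseteq> S"
    using assms(1) by (metis mem_Sigma_iff open_prod_elim)
  obtain d where d: "d > 0" "ball x0 d \<subseteq> A" using AB open_contains_ball by blast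
  obtain e where e: "e > 0" "ball y0 e \<subseteq> B" using AB open_contains_ball by blast
  show ?thesis
  proof (rule evalp_eq_0_box)
    fix x y assume "x0 - d < x" "x < x0 + d" "y0 - e < y" "y < y0 + e"
    then have "x \<in> ball x0 d" "y \<in> ball y0 e" by (auto simp: dist_real_def)
    then show "evalp P (x, y) = 0" using d e AB assms(3) by blast
  qed (use d e in auto)
qed

lemma evalp_eqI: "(\<And>z. evalp P z = evalp Q z) \<Longrightarrow> P = Q"
  using evalp_eq_0_open[of UNIV "P - Q"] by simp

lemma evalp_eq_0_iff: "(\<forall>z. evalp P z = 0) \<longleftrightarrow> P = 0"
  using evalp_eqI[of P 0] by auto

lemma evalp_eqI_nonzero:
  assumes "H \<noteq> 0" "\<And>z. evalp H z \<noteq> 0 \<Longrightarrow> evalp P z = evalp Q z"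
  shows "P = Q"
proof -
  have "evalp (H * (P - Q)) z = 0" for z using assms(2)[of z] by auto
  then have "H * (P - Q) = 0" using evalp_eq_0_iff by blast
  then show ?thesis using assms(1) by simp
qed

lemma evalp_nonzero_dense:
  assumes "H \<noteq> 0"
  shows "z \<in> closure {w. evalp H w \<noteq> 0}"
proof (rule ccontr)
  let ?S = "- closure {w. evalp H w \<noteq> 0}"
  assume "\<not> ?thesis"
  then have ne: "?S \<noteq> {}" by blast
  have "open ?S" by (simp add: open_closed)
  moreover note ne
  moreover have "evalp H w = 0" if "w \<in> ?S" for w
  proof (rule ccontr)
    assume "evalp H w \<noteq> 0"
    then have "w \<in> closure {w. evalp H w \<noteq> 0}" by (intro subsetD[OF closure_subset]) simp
    with that show False by blast
  qed
  ultimately have "H = 0" by (rule evalp_eq_0_open)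
  with assms show False ..
qed

text \<open>The passage from a Zariski open set, where a function is known as a quotient, to the
  whole plane.\<close>

lemma continuous_eq_dense:
  fixes f g :: "real \<times> real \<Rightarrow> real"
  assumes "H \<noteq> 0" "continuous_on UNIV f" "continuous_on UNIV g" "\<And>z. evalp H z \<noteq> 0 \<Longrightarrow> f z = g z"
  shows "f z = g z"
proof -
  have "closed {z. f z = g z}" using assms by (intro closed_Collect_eq) auto
  then have "closure {z. evalp H z \<noteq> 0} \<subseteq> {z. f z = g z}"
    using assms(4) by (intro closure_minimal) auto
  from subsetD[OF this evalp_nonzero_dense[OF assms(1)]] show ?thesis by simp
qed

lemma continuous_ge_dense:
  fixes f :: "real \<times> real \<Rightarrow> real"
  assumes "H \<noteq> 0" "continuous_on UNIV f" "\<And>z. evalp H z \<noteq> 0 \<Longrightarrow> f z \<ge> 0"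
  shows "f z \<ge> 0"
proof -
  have "closed {z. f z \<ge> 0}" using assms by (intro closed_Collect_le) auto
  then have "closure {z. evalp H z \<noteq> 0} \<subseteq> {z. f z \<ge> 0}"
    using assms(3) by (intro closure_minimal) auto
  from subsetD[OF this evalp_nonzero_dense[OF assms(1)]] show ?thesis by simp
qed

section \<open>Substitution for both variables and exchange of the variables\<close>

text \<open>Serves to swap the variables, to rescale y by a leading coefficient and to pull back
  along the charts of a blowing-up.\<close>

definition bsubst :: "bipoly \<Rightarrow> bipoly \<Rightarrow> bipoly \<Rightarrow> bipoly" where
  "bsubst P S T = (\<Sum>j\<le>degree P. (\<Sum>i\<le>degree (coeff P j). bcst (hcoef P i j) * S ^ i) * T ^ j)"

lemma evalp_bsubst [simp]: "evalp (bsubst P S T) z = evalp P (evalp S z, evalp T z)"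
  by (simp add: bsubst_def evalp_sum_coeff[OF order_refl] poly_altdef hcoef_def)

definition bswap :: "bipoly \<Rightarrow> bipoly" where "bswap P = bsubst P bY bX"

lemma evalp_bswap [simp]: "evalp (bswap P) (x, y) = evalp P (y, x)"
  by (simp add: bswap_def)

lemma bswap_bswap [simp]: "bswap (bswap P) = P"
  by (rule evalp_eqI) (metis evalp_bswap surj_pair)

lemma bswap_eq_0_iff [simp]: "bswap P = 0 \<longleftrightarrow> P = 0"
proof -
  have "bswap 0 = 0" by (simp add: bswap_def bsubst_def hcoef_def)
  then show ?thesis by (metis bswap_bswap)
qed

section \<open>Bezout identities with a right-hand side in R[x], and common prime factors\<close>

lemma exists_prime_factor_degree:
  fixes G :: bipoly
  assumes "degree G > 0"
  shows "\<exists>\<pi>. prime_elem \<pi> \<and> degree \<pi> > 0 \<and> \<pi> dvd G"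
proof (rule ccontr)
  assume contra: "\<not> ?thesis"
  have G0: "G \<noteq> 0" using assms by auto
  have "degree p = 0" if "p \<in># prime_factorization G" for p
    using that contra by (metis in_prime_factors_imp_dvd in_prime_factors_imp_prime neq0_conv prime_imp_prime_elem)
  then have "degree (prod_mset M) = 0" if "set_mset M \<subseteq> set_mset (prime_factorization G)" for M
    using that
  proof (induction M)
    case (add p M)
    then have "degree p = 0" "degree (prod_mset M) = 0" by simp_all
    then show ?case using degree_mult_le[of p "prod_mset M"] by simp
  qed simp
  then have "degree (prod_mset (prime_factorization G)) = 0" by simp
  moreover have "G dvd prod_mset (prime_factorization G)" "prod_mset (prime_factorization G) dvd G"
    using prod_mset_prime_factorization_weak[OF G0] associated_iff_dvd by blast+
  moreover from this have "prod_mset (prime_factorization G) \<noteq> 0" using G0 by auto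
  ultimately have "degree G \<le> 0" using dvd_imp_degree_le by metis
  then show False using assms by simp
qed

text \<open>Among the nonzero combinations of \<open>P\<close> and \<open>Q\<close> take one,
  \<open>G\<close>, of least degree in y. If this degree is 0, \<open>G\<close> is the wanted
  polynomial in x. Otherwise pseudo-division by \<open>G\<close> leaves no remainder, so
  \<open>G\<close> divides \<open>P\<close> and \<open>Q\<close> up to factors in x, and a prime
  factor of \<open>G\<close> of positive degree cannot divide such factors.\<close>

lemma bezout_or_common_prime:
  fixes P Q :: bipoly
  assumes "P \<noteq> 0"
  shows "(\<exists>A B d. d \<noteq> 0 \<and> A * P + B * Q = [:d:]) \<or>
         (\<exists>\<pi>. prime_elem \<pi> \<and> degree \<pi> > 0 \<and> \<pi> dvd P \<and> \<pi> dvd Q)"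
proof -
  define I where "I = {G. G \<noteq> 0 \<and> (\<exists>A B. G = A * P + B * Q)}"
  have "P = 1 * P + 0 * Q" by simp
  then have "P \<in> I" using assms unfolding I_def by blast
  then obtain G where G: "G \<in> I" and Gmin: "\<And>G'. G' \<in> I \<Longrightarrow> degree G \<le> degree G'"
    using arg_min_nat_lemma[of "\<lambda>G. G \<in> I" P degree] by blast
  obtain A B where AB: "G = A * P + B * Q" and G0: "G \<noteq> 0" using G by (auto simp: I_def)
  show ?thesis
  proof (cases "degree G = 0")
    case True
    then obtain d where "G = [:d:]" by (meson degree_eq_zeroE)
    then show ?thesis using AB G0 by (metis pCons_eq_0_iff)
  next
    case False
    have div: "\<exists>c. c \<noteq> 0 \<and> G dvd smult c R" if R: "\<exists>A B. R = A * P + B * Q" for R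
    proof -
      obtain q r where qr: "pseudo_divmod R G = (q, r)" by fastforce
      define c where "c = coeff G (degree G) ^ (Suc (degree R) - degree G)"
      have eq: "smult c R = G * q + r" and r: "r = 0 \<or> degree r < degree G"
        using pseudo_divmod[OF G0 qr] by (auto simp: c_def)
      have c0: "c \<noteq> 0" using G0 by (simp add: c_def)
      obtain A' B' where R': "R = A' * P + B' * Q" using R by blast
      have "r = smult c R - G * q" using eq by simp
      also have "\<dots> = (smult c A' - A * q) * P + (smult c B' - B * q) * Q"
        unfolding R' AB by (simp add: algebra_simps smult_add_right)
      finally have "r = 0 \<or> r \<in> I" unfolding I_def by blast
      then have "r = 0" using r Gmin by fastforce
      then show ?thesis using eq c0 by (metis add.right_neutral dvd_triv_left)
    qed
    obtain \<pi> where \<pi>: "prime_elem \<pi>" "degree \<pi> > 0" "\<pi> dvd G"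
      using exists_prime_factor_degree[of G] False by auto
    have "\<pi> dvd R" if R: "\<exists>A B. R = A * P + B * Q" for R
    proof -
      obtain c where c: "c \<noteq> 0" "G dvd smult c R" using div[OF R] by blast
      then have "\<pi> dvd [:c:] * R" using \<pi>(3) dvd_trans by auto
      moreover have "\<not> \<pi> dvd [:c:]"
        using c(1) \<pi>(2) dvd_imp_degree_le[of \<pi> "[:c:]"] by auto
      ultimately show ?thesis using \<pi>(1) prime_elem_dvd_mult_iff by blast
    qed
    moreover have "\<exists>A B. P = A * P + B * Q" by (rule exI[of _ 1], rule exI[of _ 0]) simp
    moreover have "\<exists>A B. Q = A * P + B * Q" by (rule exI[of _ 0], rule exI[of _ 1]) simp
    ultimately show ?thesis using \<pi> by blast
  qed
qed

section \<open>Nonnegative univariate polynomials\<close>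

text \<open>After division by the linear factor the cofactor is nonnegative to the right of
  \<open>r\<close> and nonpositive to the left, so it vanishes at \<open>r\<close> too.\<close>

lemma real_poly_nonneg_even_root:
  fixes p :: "real poly"
  assumes "\<And>x. poly p x \<ge> 0" "poly p r = 0"
  shows "\<exists>q. p = [:- r, 1:] ^ 2 * q \<and> (\<forall>x. poly q x \<ge> 0)"
proof -
  obtain q where q: "p = [:- r, 1:] * q" using assms(2) poly_eq_0_iff_dvd by (metis dvdE)
  have "isCont (poly q) r" by simp
  have pos: "poly q x \<ge> 0" if "x > r" for x
    using assms(1)[of x] that unfolding q poly_mult by (simp del: mult_pCons_left add: zero_le_mult_iff)
  have neg: "poly q x \<le> 0" if "x < r" for x
    using assms(1)[of x] that unfolding q poly_mult by (simp del: mult_pCons_left add: zero_le_mult_iff)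
  have lim: "(poly q \<longlongrightarrow> poly q r) (at r within S)" for S
    using \<open>isCont (poly q) r\<close> unfolding isCont_def
    by (rule tendsto_mono[OF at_le[OF subset_UNIV]])
  have "poly q r \<ge> 0"
    by (rule tendsto_lowerbound[OF lim[of "{r<..}"]]) (auto simp: eventually_at_filter pos)
  moreover have "poly q r \<le> 0"
    by (rule tendsto_upperbound[OF lim[of "{..<r}"]]) (auto simp: eventually_at_filter neg)
  ultimately have "poly q r = 0" by simp
  then obtain q2 where q2: "q = [:- r, 1:] * q2" using poly_eq_0_iff_dvd by (metis dvdE)
  have p: "p = [:- r, 1:] ^ 2 * q2" by (simp only: q q2 power2_eq_square mult.assoc)
  have ge: "poly q2 x \<ge> 0" if "x \<noteq> r" for x
    using assms(1)[of x] that unfolding p poly_mult poly_power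
    by (simp add: zero_le_mult_iff not_le[symmetric])
  have "(poly q2 \<longlongrightarrow> poly q2 r) (at r)" using isCont_def poly_isCont by blast
  then have "poly q2 r \<ge> 0"
    by (rule tendsto_lowerbound) (auto simp: eventually_at_filter ge)
  then show ?thesis using p ge by metis
qed

lemma two_squares_mult:
  fixes a b c d :: "'a :: comm_ring_1"
  shows "(a\<^sup>2 + b\<^sup>2) * (c\<^sup>2 + d\<^sup>2) = (a * c - b * d)\<^sup>2 + (a * d + b * c)\<^sup>2"
  by (simp add: power2_eq_square algebra_simps)

abbreviation of_real_poly :: "real poly \<Rightarrow> complex poly" where
  "of_real_poly \<equiv> map_poly complex_of_real"

lemma of_real_poly_add [simp]: "of_real_poly (p + q) = of_real_poly p + of_real_poly q"
  by (rule poly_eqI) (simp add: coeff_map_poly)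

lemma of_real_poly_mult [simp]: "of_real_poly (p * q) = of_real_poly p * of_real_poly q"
  by (induction p) (auto simp: map_poly_pCons smult_conv_map_poly map_poly_map_poly o_def
      intro!: map_poly_cong)

lemma poly_of_real_poly [simp]: "poly (of_real_poly p) (of_real x) = of_real (poly p x)"
  by (induction p) (auto simp: map_poly_pCons)

text \<open>The remainder modulo the real quadratic polynomial of \<open>z\<close> is linear with
  real coefficients and has a nonreal root, so it is 0.\<close>

lemma real_poly_nonreal_factor:
  fixes p :: "real poly"
  assumes "poly (of_real_poly p) z = 0" "Im z \<noteq> 0"
  shows "[:(cmod z)\<^sup>2, - 2 * Re z, 1:] dvd p"
proof -
  let ?m = "[:(cmod z)\<^sup>2, - 2 * Re z, 1:]"
  have mz: "poly (of_real_poly ?m) z = 0"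
    by (simp only: complex_eq_iff cmod_power2) (simp add: map_poly_pCons power2_eq_square algebra_simps)
  define r where "r = p mod ?m"
  have pr: "p = ?m * (p div ?m) + r" by (simp only: r_def mult_div_mod_eq)
  have "of_real_poly p
      = of_real_poly ?m * of_real_poly (p div ?m) + of_real_poly r"
    by (subst pr) (simp only: of_real_poly_add of_real_poly_mult)
  then have rz: "poly (of_real_poly r) z = 0"
    using assms(1) mz by simp
  have "degree r < 2" using degree_mod_less'[of ?m p] by (cases "r = 0") (auto simp: r_def)
  then have "r = [:coeff r 0, coeff r 1:]"
    by (intro poly_eqI) (auto simp: coeff_pCons coeff_eq_0 split: nat.splits)
  moreover have "poly (of_real_poly [:a, b:]) z = complex_of_real a + z * complex_of_real b" for a b
    by (simp add: map_poly_pCons)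
  ultimately have "complex_of_real (coeff r 0) + z * complex_of_real (coeff r 1) = 0"
    using rz by metis
  then have "coeff r 1 = 0" "coeff r 0 = 0" using assms(2) by (auto simp: complex_eq_iff)
  then have "r = 0" using \<open>r = [:coeff r 0, coeff r 1:]\<close> by simp
  then show ?thesis using pr by (metis add.right_neutral dvd_triv_left)
qed

text \<open>Real roots split off as squares; a nonreal root \<open>z\<close> splits off the factor
  (x - Re z)^2 + (Im z)^2, and products of sums of two squares are again such sums.\<close>

lemma real_poly_nonneg_two_squares:
  fixes p :: "real poly"
  assumes "\<And>x. poly p x \<ge> 0"
  shows "\<exists>u v. p = u\<^sup>2 + v\<^sup>2"
  using assms
proof (induction "degree p" arbitrary: p rule: less_induct)
  case (less p)
  consider "degree p = 0" | r where "poly p r = 0" "degree p > 0"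
    | "degree p > 0" "\<And>x. poly p x \<noteq> 0" by blast
  then show ?case
  proof cases
    case 1
    then obtain c where c: "p = [:c:]" by (meson degree_eq_zeroE)
    then have "c \<ge> 0" using less.prems[of 0] by simp
    then have "p = [:sqrt c:]\<^sup>2 + 0\<^sup>2" by (simp add: c power2_eq_square)
    then show ?thesis by blast
  next
    case (2 r)
    then obtain q where q: "p = [:- r, 1:] ^ 2 * q" "\<And>x. poly q x \<ge> 0"
      using real_poly_nonneg_even_root less.prems by metis
    then have "q \<noteq> 0" using 2 by auto
    then have "degree q < degree p" by (simp add: q degree_mult_eq degree_power_eq)
    then obtain u v where "q = u\<^sup>2 + v\<^sup>2" using less.hyps q(2) by blast
    then have "p = ([:- r, 1:] * u)\<^sup>2 + ([:- r, 1:] * v)\<^sup>2"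
      by (simp only: q power_mult_distrib distrib_left)
    then show ?thesis by blast
  next
    case 3
    let ?P = "of_real_poly p"
    have "degree ?P = degree p" by (simp add: degree_map_poly)
    then have "\<not> constant (poly ?P)" using 3 by (simp add: constant_degree)
    from Fundamental_Theorem_Algebra.fundamental_theorem_of_algebra[OF this] obtain z where z: "poly ?P z = 0" ..
    have im: "Im z \<noteq> 0"
    proof
      assume "Im z = 0"
      then obtain x where "z = complex_of_real x" by (metis complex_is_Real_iff Reals_cases)
      then show False using z 3(2)[of x] by simp
    qed
    let ?m = "[:(cmod z)\<^sup>2, - 2 * Re z, 1:]"
    obtain q where q: "p = ?m * q" using real_poly_nonreal_factor[OF z im] by (metis dvdE)
    have m: "?m = [:- Re z, 1:]\<^sup>2 + [:Im z:]\<^sup>2"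
      by (simp only: cmod_power2) (simp add: power2_eq_square algebra_simps)
    have "poly ?m x > 0" for x
      unfolding m using im by (simp add: sum_power2_gt_zero_iff)
    then have "poly q x \<ge> 0" for x
      using less.prems[of x] unfolding q poly_mult by (metis less_le_not_le zero_le_mult_iff linorder_not_le)
    moreover have "degree q < degree p"
      using 3(1) by (subst q, subst degree_mult_eq) (auto simp: q)
    ultimately obtain u v where "q = u\<^sup>2 + v\<^sup>2" using less.hyps by blast
    then show ?thesis using q m two_squares_mult by metis
  qed
qed

text \<open>The factor \<open>\<kappa>\<close> without real roots has constant sign, so all sign
  changes and all real multiplicities are carried by the explicit list.\<close>

lemma real_poly_linear_split:
  fixes p :: "real poly"
  assumes "p \<noteq> 0"
  shows "\<exists>rs \<kappa>. p = (\<Prod>r\<leftarrow>rs. [:- r, 1:]) * \<kappa> \<and> (\<forall>x. poly \<kappa> x \<noteq> 0)"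
  using assms
proof (induction "degree p" arbitrary: p rule: less_induct)
  case (less p)
  show ?case
  proof (cases "\<exists>r. poly p r = 0")
    case True
    then obtain r q where q: "p = [:- r, 1:] * q" using poly_eq_0_iff_dvd by (metis dvdE)
    then have "q \<noteq> 0" using less.prems by auto
    then have "degree q < degree p" unfolding q by (subst degree_mult_eq) auto
    then obtain rs \<kappa> where "q = (\<Prod>r\<leftarrow>rs. [:- r, 1:]) * \<kappa>" "\<forall>x. poly \<kappa> x \<noteq> 0"
      using less.hyps \<open>q \<noteq> 0\<close> by blast
    then show ?thesis using q by (intro exI[of _ "r # rs"] exI[of _ \<kappa>]) (simp add: algebra_simps)
  next
    case False
    then show ?thesis by (intro exI[of _ "[]"] exI[of _ p]) simp
  qed
qed

lemma real_poly_no_root_sign: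
  fixes p :: "real poly"
  assumes "\<And>x. poly p x \<noteq> 0"
  shows "(\<forall>x. poly p x > 0) \<or> (\<forall>x. poly p x < 0)"
proof (rule ccontr)
  assume "\<not> ?thesis"
  then obtain x y where xy: "poly p x < 0" "poly p y > 0"
    using assms by (meson linorder_neqE_linordered_idom)
  then consider "x < y" | "y < x" by fastforce
  then show False
    by cases (use xy poly_IVT_pos[of x y p] poly_IVT_neg[of y x p] assms in blast)+
qed

section \<open>Preorderings\<close>

inductive_set preordering :: "bipoly set \<Rightarrow> bipoly set" for G where
  square: "P\<^sup>2 \<in> preordering G"
| gen: "g \<in> G \<Longrightarrow> g \<in> preordering G"
| add: "P \<in> preordering G \<Longrightarrow> Q \<in> preordering G \<Longrightarrow> P + Q \<in> preordering G"
| mult: "P \<in> preordering G \<Longrightarrow> Q \<in> preordering G \<Longrightarrow> P * Q \<in> preordering G"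

lemma preordering_0 [simp]: "0 \<in> preordering G"
  and preordering_1 [simp]: "1 \<in> preordering G"
  using preordering.square[of 0 G] preordering.square[of 1 G] by simp_all

lemma preordering_const_poly:
  assumes "\<And>x. poly c x \<ge> 0"
  shows "[:c:] \<in> preordering G"
proof -
  obtain u v where "c = u\<^sup>2 + v\<^sup>2" using real_poly_nonneg_two_squares assms by blast
  then have "[:c:] = [:u:]\<^sup>2 + [:v:]\<^sup>2" by (simp add: power2_eq_square)
  then show ?thesis by (metis preordering.intros(1,3))
qed

lemma preordering_sum:
  "(\<And>i. i \<in> A \<Longrightarrow> f i \<in> preordering G) \<Longrightarrow> sum f A \<in> preordering G"
  by (induction A rule: infinite_finite_induct) (auto intro: preordering.add)

lemma preordering_subset:
  assumes "G \<subseteq> preordering G'"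
  shows "preordering G \<subseteq> preordering G'"
proof
  fix P assume "P \<in> preordering G"
  then show "P \<in> preordering G'"
    by induction (use assms in \<open>auto intro: preordering.intros\<close>)
qed

lemma preordering_nonneg:
  assumes "P \<in> preordering G" "\<And>g. g \<in> G \<Longrightarrow> evalp g z \<ge> 0"
  shows "evalp P z \<ge> 0"
  using assms by induction auto

text \<open>A product of two generators \<open>g\<close> is a square and moves into the
  coefficients, so degree one in \<open>g\<close> suffices.\<close>

lemma preordering_insert:
  assumes "P \<in> preordering (insert g G)"
  shows "\<exists>A\<in>preordering G. \<exists>B\<in>preordering G. P = A + g * B"
  using assms
proof induction
  case (square P)
  have "P\<^sup>2 = P\<^sup>2 + g * 0" by simp
  then show ?case using preordering.square preordering_0 by metis
next
  case (gen h)
  have "h = h + g * 0" "g = 0 + g * 1" by simp_all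
  then show ?case using gen preordering.gen preordering_0 preordering_1 by (metis insertE)
next
  case (add P Q)
  then obtain A B C D where "A \<in> preordering G" "B \<in> preordering G" "P = A + g * B"
    "C \<in> preordering G" "D \<in> preordering G" "Q = C + g * D" by blast
  moreover from this have "P + Q = (A + C) + g * (B + D)" by (simp add: algebra_simps)
  ultimately show ?case using preordering.add by metis
next
  case (mult P Q)
  then obtain A B C D where *: "A \<in> preordering G" "B \<in> preordering G" "P = A + g * B"
    "C \<in> preordering G" "D \<in> preordering G" "Q = C + g * D" by blast
  then have "P * Q = (A * C + g\<^sup>2 * (B * D)) + g * (A * D + B * C)"
    by (simp add: algebra_simps power2_eq_square)
  moreover have "A * C + g\<^sup>2 * (B * D) \<in> preordering G" "A * D + B * C \<in> preordering G"
    using * by (blast intro: preordering.add preordering.mult preordering.square)+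
  ultimately show ?case by blast
qed

lemma is_sos_mult:
  assumes "is_sos P" "is_sos Q"
  shows "is_sos (P * Q)"
proof -
  obtain Ps Qs where PQ: "P = (\<Sum>A\<leftarrow>Ps. A\<^sup>2)" "Q = (\<Sum>B\<leftarrow>Qs. B\<^sup>2)"
    using assms by (auto simp: is_sos_def)
  have "P * Q = (\<Sum>A\<leftarrow>Ps. \<Sum>B\<leftarrow>Qs. (A * B)\<^sup>2)"
    unfolding PQ by (simp only: sum_list_mult_const[symmetric])
      (simp only: sum_list_const_mult[symmetric] power_mult_distrib)
  also have "\<dots> = (\<Sum>C\<leftarrow>concat (map (\<lambda>A. map (\<lambda>B. A * B) Qs) Ps). C\<^sup>2)"
    by (induction Ps) (simp_all add: o_def)
  finally show ?thesis unfolding is_sos_def by blast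
qed

lemma is_sos_add:
  assumes "is_sos P" "is_sos Q"
  shows "is_sos (P + Q)"
proof -
  obtain Ps Qs where "P = (\<Sum>A\<leftarrow>Ps. A\<^sup>2)" "Q = (\<Sum>B\<leftarrow>Qs. B\<^sup>2)"
    using assms by (auto simp: is_sos_def)
  then have "P + Q = (\<Sum>A\<leftarrow>Ps @ Qs. A\<^sup>2)" by simp
  then show ?thesis unfolding is_sos_def by blast
qed

lemma is_sos_square: "is_sos (P\<^sup>2)"
  unfolding is_sos_def by (rule exI[of _ "[P]"]) simp

lemma preordering_empty_is_sos: "P \<in> preordering {} \<Longrightarrow> is_sos P"
  by (induction rule: preordering.induct) (auto intro: is_sos_square is_sos_add is_sos_mult)

text \<open>The nonzero square multiplier allows square factors of \<open>h\<close> to be dropped or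
  inserted freely. With \<open>G\<close> empty the notion says that \<open>h\<close> is a sum of
  squares of rational functions.\<close>

definition certified :: "bipoly set \<Rightarrow> bipoly \<Rightarrow> bool" where
  "certified G h \<longleftrightarrow> (\<exists>M. M \<noteq> 0 \<and> M\<^sup>2 * h \<in> preordering G)"

lemma certified_mono: "certified G h \<Longrightarrow> G \<subseteq> preordering G' \<Longrightarrow> certified G' h"
  unfolding certified_def using preordering_subset by blast

lemma certified_square_mult:
  assumes "P \<noteq> 0"
  shows "certified G (P\<^sup>2 * h) \<longleftrightarrow> certified G h"
proof
  assume "certified G (P\<^sup>2 * h)"
  then obtain M where "M \<noteq> 0" "(M * P)\<^sup>2 * h \<in> preordering G"
    by (auto simp: certified_def power_mult_distrib mult.assoc)
  then show "certified G h" unfolding certified_def using assms by (metis mult_eq_0_iff)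
next
  assume "certified G h"
  then obtain M where "M \<noteq> 0" "M\<^sup>2 * h \<in> preordering G" by (auto simp: certified_def)
  then have "M\<^sup>2 * (P\<^sup>2 * h) \<in> preordering G"
    using preordering.mult[OF preordering.square[of P]] by (metis mult.left_commute)
  then show "certified G (P\<^sup>2 * h)" unfolding certified_def using \<open>M \<noteq> 0\<close> by blast
qed

text \<open>If \<open>H = A + g B = A' - g B'\<close> then \<open>H (A + A') = H\<^sup>2 + A A' + g\<^sup>2 B B'\<close>,
  which glues certificates over \<open>g \<ge> 0\<close> and \<open>g \<le> 0\<close>.\<close>

lemma certified_merge:
  assumes "certified (insert g G) h" "certified (insert (- g) G) h"
    and S: "open S" "S \<noteq> {}" "\<And>g z. g \<in> G \<Longrightarrow> z \<in> S \<Longrightarrow> evalp g z \<ge> 0"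
  shows "certified G h"
proof -
  obtain M M' where M: "M \<noteq> 0" "M\<^sup>2 * h \<in> preordering (insert g G)"
    and M': "M' \<noteq> 0" "M'\<^sup>2 * h \<in> preordering (insert (- g) G)"
    using assms(1,2) by (auto simp: certified_def)
  define H where "H = (M * M')\<^sup>2 * h"
  have "H = M'\<^sup>2 * (M\<^sup>2 * h)" "H = M\<^sup>2 * (M'\<^sup>2 * h)"
    by (simp_all add: H_def power_mult_distrib algebra_simps)
  then have "H \<in> preordering (insert g G)" "H \<in> preordering (insert (- g) G)"
    using M M' by (metis preordering.mult preordering.square)+
  then obtain A B A' B' where A: "A \<in> preordering G" "B \<in> preordering G" "H = A + g * B"
    and A': "A' \<in> preordering G" "B' \<in> preordering G" "H = A' + - g * B'"
    using preordering_insert by meson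
  define N where "N = H\<^sup>2 + A * A' + g\<^sup>2 * (B * B')"
  have "g * B = H - A" "g * B' = A' - H" using A(3) A'(3) by (simp_all add: algebra_simps)
  then have "g\<^sup>2 * (B * B') = (H - A) * (A' - H)" by (metis mult.assoc mult.left_commute power2_eq_square)
  then have N: "H * (A + A') = N" by (simp add: N_def algebra_simps power2_eq_square)
  show ?thesis
  proof (cases "A + A' = 0")
    case False
    have "(M * M' * (A + A'))\<^sup>2 * h = N * (A + A')"
      by (simp add: N[symmetric] H_def power_mult_distrib power2_eq_square algebra_simps)
    moreover have "N * (A + A') \<in> preordering G"
      unfolding N_def using A A'
      by (blast intro: preordering.add preordering.mult preordering.square)
    ultimately show ?thesis using False M M' unfolding certified_def by (metis mult_eq_0_iff)
  next
    case True
    \<comment> \<open>Here \<open>A + A'\<close> is no usable multiplier. On \<open>S\<close> both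
      parts are nonnegative with sum 0, so they vanish there, and the identity forces
      \<open>H\<close> to vanish on an open set.\<close>
    have "evalp H z = 0" if "z \<in> S" for z
    proof -
      have nn: "evalp P z \<ge> 0" if "P \<in> preordering G" for P
        using preordering_nonneg[OF that] S(3) \<open>z \<in> S\<close> by blast
      have "evalp A z = 0" "evalp A' z = 0"
        using nn[OF A(1)] nn[OF A'(1)] arg_cong[OF True, of "\<lambda>P. evalp P z"] by simp_all
      then have "evalp H z ^ 2 + evalp g z ^ 2 * (evalp B z * evalp B' z) = 0"
        using arg_cong[OF N, of "\<lambda>P. evalp P z"] by (simp add: N_def)
      moreover have "evalp g z ^ 2 * (evalp B z * evalp B' z) \<ge> 0"
        using nn[OF A(2)] nn[OF A'(2)] by simp
      ultimately show ?thesis by (smt (verit) power2_eq_square mult_eq_0_iff zero_le_power2)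
    qed
    then have "H = 0" using evalp_eq_0_open S(1,2) by blast
    then have "h = 0" using M M' by (simp add: H_def)
    then show ?thesis unfolding certified_def by (auto intro!: exI[of _ 1])
  qed
qed

section \<open>Preorderings of vertical strips\<close>

abbreviation strip :: "real \<Rightarrow> real \<Rightarrow> bipoly set" where
  "strip a b \<equiv> {[:[:- a, 1:]:], [:[:b, - 1:]:]}"

lemma strip_subset_preordering:
  assumes "a \<le> a'" "b' \<le> b"
  shows "strip a b \<subseteq> preordering (strip a' b')"
proof -
  have "[:[:- a, 1:]:] = [:[:- a', 1:]:] + [:[:a' - a:]:]"
    "[:[:b, - 1:]:] = [:[:b', - 1:]:] + [:[:b - b':]:]" by simp_all
  moreover have "[:[:a' - a:]:] \<in> preordering (strip a' b')" "[:[:b - b':]:] \<in> preordering (strip a' b')"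
    using assms by (auto intro!: preordering_const_poly)
  moreover have "[:[:- a', 1:]:] \<in> preordering (strip a' b')" "[:[:b', - 1:]:] \<in> preordering (strip a' b')"
    by (auto intro: preordering.gen)
  ultimately show ?thesis by (metis empty_subsetI insert_subset preordering.add)
qed

text \<open>A root outside the open interval gives a linear factor of constant sign on it; this
  factor or its negative is a generator of the strip plus a nonnegative constant.
  \<open>\<sigma>\<close> collects the signs.\<close>

lemma linear_prod_in_preordering:
  assumes "\<And>r. r \<in> set rs \<Longrightarrow> r \<le> a \<or> r \<ge> b"
  shows "\<exists>\<sigma>\<in>{1, - 1}. [:smult \<sigma> (\<Prod>r\<leftarrow>rs. [:- r, 1:]):] \<in> preordering (strip a b) \<and>
     (\<forall>x. a < x \<longrightarrow> x < b \<longrightarrow> \<sigma> * poly (\<Prod>r\<leftarrow>rs. [:- r, 1:]) x > 0)"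
  using assms
proof (induction rs)
  case Nil
  show ?case by (intro bexI[of _ 1]) (auto simp: one_pCons[symmetric])
next
  case (Cons r rs)
  then obtain \<sigma> where \<sigma>: "\<sigma> \<in> {1, - 1}" "[:smult \<sigma> (\<Prod>r\<leftarrow>rs. [:- r, 1:]):] \<in> preordering (strip a b)"
     "\<forall>x. a < x \<longrightarrow> x < b \<longrightarrow> \<sigma> * poly (\<Prod>r\<leftarrow>rs. [:- r, 1:]) x > 0"
    using Cons.IH[OF Cons.prems[OF list.set_intros(2)]] by blast
  have "\<exists>\<tau>\<in>{1, - 1}. [:smult \<tau> [:- r, 1:]:] \<in> preordering (strip a b) \<and>
     (\<forall>x. a < x \<longrightarrow> x < b \<longrightarrow> \<tau> * poly [:- r, 1:] x > 0)"
  proof (cases "r \<le> a")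
    case True
    then have "strip r b \<subseteq> preordering (strip a b)" by (intro strip_subset_preordering) auto
    then show ?thesis using True by (intro bexI[of _ 1]) auto
  next
    case False
    then have "b \<le> r" using Cons.prems by auto
    then have "strip a r \<subseteq> preordering (strip a b)" by (intro strip_subset_preordering) auto
    then show ?thesis using \<open>b \<le> r\<close> by (intro bexI[of _ "- 1"]) auto
  qed
  then obtain \<tau> where \<tau>: "\<tau> \<in> {1, - 1}" "[:smult \<tau> [:- r, 1:]:] \<in> preordering (strip a b)"
     "\<forall>x. a < x \<longrightarrow> x < b \<longrightarrow> \<tau> * poly [:- r, 1:] x > 0" by blast
  let ?p = "(\<Prod>r\<leftarrow>rs. [:- r, 1:])"
  have eq: "[:smult (\<tau> * \<sigma>) (p * q):] = [:smult \<tau> p:] * [:smult \<sigma> q:]" for p q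
    by (simp add: mult.commute)
  show ?case
  proof (intro bexI[of _ "\<tau> * \<sigma>"] conjI allI impI)
    show "[:smult (\<tau> * \<sigma>) (\<Prod>r\<leftarrow>r # rs. [:- r, 1:]):] \<in> preordering (strip a b)"
      using preordering.mult[OF \<tau>(2) \<sigma>(2)] eq[of "[:- r, 1:]" ?p] by (simp only: list.map prod_list.Cons)
    fix x assume "a < x" "x < b"
    then have "(\<tau> * poly [:- r, 1:] x) * (\<sigma> * poly ?p x) > 0" using \<tau>(3) \<sigma>(3) mult_pos_pos by blast
    also have "(\<tau> * poly [:- r, 1:] x) * (\<sigma> * poly ?p x) = \<tau> * \<sigma> * poly (\<Prod>r\<leftarrow>r # rs. [:- r, 1:]) x"
      by (simp add: algebra_simps)
    finally show "0 < \<tau> * \<sigma> * poly (\<Prod>r\<leftarrow>r # rs. [:- r, 1:]) x" .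
  qed (use \<sigma> \<tau> in auto)
qed

text \<open>The cofactor of the power of x - x0 has constant sign on a small interval. Nonnegativity
  of \<open>c\<close> to the right of \<open>x0\<close> makes the total sign 1, and nonnegativity to
  the left then makes the exponent even.\<close>

lemma locally_nonneg_in_preordering:
  fixes c :: "real poly"
  assumes "\<delta> > 0" "\<And>x. \<bar>x - x0\<bar> < \<delta> \<Longrightarrow> poly c x \<ge> 0"
  shows "\<exists>\<epsilon>>0. [:c:] \<in> preordering (strip (x0 - \<epsilon>) (x0 + \<epsilon>))"
proof (cases "c = 0")
  case True
  then show ?thesis by (auto intro!: exI[of _ 1])
next
  case False
  obtain d where d: "c = [:- x0, 1:] ^ order x0 c * d" "\<not> [:- x0, 1:] dvd d"
    using order_decomp[OF False] by blast
  define k where "k = order x0 c"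
  have d0: "d \<noteq> 0" "poly d x0 \<noteq> 0" using d poly_eq_0_iff_dvd by auto
  obtain rs \<kappa> where rs: "d = (\<Prod>r\<leftarrow>rs. [:- r, 1:]) * \<kappa>" "\<forall>x. poly \<kappa> x \<noteq> 0"
    using real_poly_linear_split[OF d0(1)] by blast
  let ?p = "(\<Prod>r\<leftarrow>rs. [:- r, 1:])"
  have ne: "r \<noteq> x0" if "r \<in> set rs" for r
  proof
    have "poly ?p r = 0" using that by (induction rs) auto
    moreover assume "r = x0"
    ultimately show False using d0(2) by (simp add: rs)
  qed
  have "finite (set rs)" by simp
  then obtain \<eta> where \<eta>: "\<eta> > 0" "\<And>r. r \<in> set rs \<Longrightarrow> \<eta> \<le> \<bar>r - x0\<bar>"
    using finite_set_avoid[of "set rs" x0] ne by (auto simp: dist_real_def abs_minus_commute)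
  define \<epsilon> where "\<epsilon> = min \<eta> \<delta>"
  let ?T = "preordering (strip (x0 - \<epsilon>) (x0 + \<epsilon>))"
  have "\<epsilon> > 0" using \<eta> assms by (simp add: \<epsilon>_def)
  have "r \<le> x0 - \<epsilon> \<or> r \<ge> x0 + \<epsilon>" if "r \<in> set rs" for r
    using \<eta>(2)[OF that] by (auto simp: \<epsilon>_def)
  from linear_prod_in_preordering[of rs, OF this]
  obtain \<sigma> where \<sigma>: "\<sigma> \<in> {1, - 1}" "[:smult \<sigma> ?p:] \<in> ?T"
     "\<And>x. x0 - \<epsilon> < x \<Longrightarrow> x < x0 + \<epsilon> \<Longrightarrow> \<sigma> * poly ?p x > 0" by blast
  obtain \<tau> where \<tau>: "\<tau> \<in> {1, - 1}" "\<And>x. \<tau> * poly \<kappa> x > 0"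
    using real_poly_no_root_sign[of \<kappa>] rs(2)
    by (metis insertCI mult_1 mult_minus_left neg_0_less_iff_less)
  have c_eq: "c = smult (\<sigma> * \<tau>) ([:- x0, 1:] ^ k * (smult \<sigma> ?p * smult \<tau> \<kappa>))"
    using \<sigma>(1) \<tau>(1) by (subst d(1)) (auto simp: k_def rs)
  have sgn: "\<sigma> * \<tau> * (x - x0) ^ k \<ge> 0" if "\<bar>x - x0\<bar> < \<epsilon>" for x
  proof -
    have "poly c x = (\<sigma> * \<tau> * (x - x0) ^ k) * ((\<sigma> * poly ?p x) * (\<tau> * poly \<kappa> x))"
      by (subst c_eq) (simp add: algebra_simps)
    moreover have "(\<sigma> * poly ?p x) * (\<tau> * poly \<kappa> x) > 0"
      by (rule mult_pos_pos[OF \<sigma>(3) \<tau>(2)]) (use that in linarith)+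
    moreover have "poly c x \<ge> 0" using assms(2) that by (simp add: \<epsilon>_def)
    ultimately show ?thesis by (metis less_le_not_le zero_le_mult_iff linorder_not_le)
  qed
  have "\<sigma> * \<tau> = 1"
    using sgn[of "x0 + \<epsilon> / 2"] \<open>\<epsilon> > 0\<close> \<sigma>(1) \<tau>(1) zero_less_power[of "\<epsilon> / 2" k]
    by (auto simp: mult_le_0_iff zero_le_mult_iff not_less[symmetric])
  moreover have "even k"
    using sgn[of "x0 - \<epsilon> / 2"] \<open>\<epsilon> > 0\<close> \<open>\<sigma> * \<tau> = 1\<close> by (auto simp: zero_le_power_eq)
  ultimately have "[:c:] = ([:[:- x0, 1:] ^ (k div 2):])\<^sup>2 * ([:smult \<sigma> ?p:] * [:smult \<tau> \<kappa>:])"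
  proof -
    assume "\<sigma> * \<tau> = 1" "even k"
    then have "k div 2 + k div 2 = k" by presburger
    then have "[:- x0, 1:] ^ k = ([:- x0, 1:] ^ (k div 2))\<^sup>2"
      by (metis power2_eq_square power_add)
    then show ?thesis using \<open>\<sigma> * \<tau> = 1\<close> c_eq by (simp add: power2_eq_square mult.commute)
  qed
  moreover have "[:smult \<tau> \<kappa>:] \<in> ?T" using \<tau>(2) by (intro preordering_const_poly) (simp add: less_imp_le)
  ultimately have "[:c:] \<in> ?T" using \<sigma>(2) by (metis preordering.mult preordering.square)
  then show ?thesis using \<open>\<epsilon> > 0\<close> by blast
qed

section \<open>Continuous families of complex roots\<close>

lemma monic_rsquarefree_decompose:
  fixes P :: "complex poly"
  assumes "rsquarefree P" "lead_coeff P = 1"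
  shows "P = (\<Prod>z\<in>{z. poly P z = 0}. [:- z, 1:])" "card {z. poly P z = 0} = degree P"
proof -
  show *: "P = (\<Prod>z\<in>{z. poly P z = 0}. [:- z, 1:])"
    using complex_poly_decompose_rsquarefree[OF assms(1)] assms(2) by simp
  show "card {z. poly P z = 0} = degree P"
    by (subst (2) *) (simp add: degree_prod_eq_sum_degree)
qed

text \<open>The modulus of \<open>poly P z\<close> is the product of the distances from
  \<open>z\<close> to the roots, so they cannot all be at least \<open>\<eta>\<close>.\<close>

lemma monic_rsquarefree_near_root:
  fixes P :: "complex poly"
  assumes "rsquarefree P" "lead_coeff P = 1" "norm (poly P z) < \<eta> ^ degree P" "\<eta> \<ge> 0"
  shows "\<exists>\<beta>. poly P \<beta> = 0 \<and> dist z \<beta> < \<eta>"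
proof (rule ccontr)
  assume contra: "\<not> ?thesis"
  let ?R = "{z. poly P z = 0}"
  have "\<eta> ^ card ?R \<le> (\<Prod>\<beta>\<in>?R. norm (z - \<beta>))"
    unfolding prod_constant[symmetric]
    by (rule prod_mono) (use contra assms(4) in \<open>force simp: dist_norm\<close>)
  also have "\<dots> = norm (poly (\<Prod>\<beta>\<in>?R. [:- \<beta>, 1:]) z)"
    by (simp add: poly_prod prod_norm)
  also have "\<dots> = norm (poly P z)"
    using monic_rsquarefree_decompose(1)[OF assms(1,2)] by metis
  finally show False using assms(3) monic_rsquarefree_decompose(2)[OF assms(1,2)] by simp
qed

text \<open>A holomorphic family of monic polynomials with simple roots. Convexity makes the base
  simply connected, so that roots can be followed over all of \<open>U\<close> without
  monodromy.\<close>

locale root_family =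
  fixes U :: "complex set" and F :: "complex \<Rightarrow> complex poly" and m :: nat
  assumes U: "open U" "convex U"
    and monic: "\<And>w. w \<in> U \<Longrightarrow> lead_coeff (F w) = 1"
    and deg: "\<And>w. w \<in> U \<Longrightarrow> degree (F w) = m"
    and m: "m > 0"
    and sqf: "\<And>w. w \<in> U \<Longrightarrow> rsquarefree (F w)"
    and hol: "\<And>z. (\<lambda>w. poly (F w) z) holomorphic_on U"
begin

definition roots where "roots w = {z. poly (F w) z = 0}"

lemma finite_roots: "w \<in> U \<Longrightarrow> finite (roots w)"
  unfolding roots_def by (rule poly_roots_finite) (use deg m in force)

lemma card_roots: "w \<in> U \<Longrightarrow> card (roots w) = m"
  unfolding roots_def using monic_rsquarefree_decompose(2) sqf monic deg by metis

lemma poly_eq_prod_roots: "w \<in> U \<Longrightarrow> F w = (\<Prod>z\<in>roots w. [:- z, 1:])"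
  unfolding roots_def using monic_rsquarefree_decompose(1) sqf monic by metis

lemma near_root:
  "w \<in> U \<Longrightarrow> norm (poly (F w) z) < \<eta> ^ m \<Longrightarrow> \<eta> \<ge> 0 \<Longrightarrow> \<exists>\<beta>\<in>roots w. dist z \<beta> < \<eta>"
  using monic_rsquarefree_near_root[of "F w" z \<eta>] sqf monic deg by (auto simp: roots_def)

lemma open_poly_less: "open {w \<in> U. norm (poly (F w) z) < e}"
proof -
  have "continuous_on U (\<lambda>w. norm (poly (F w) z))"
    using holomorphic_on_imp_continuous_on[OF hol] by (intro continuous_intros)
  from continuous_open_preimage[OF this U(1), of "{..<e}"]
  have "open (U \<inter> (\<lambda>w. norm (poly (F w) z)) -` {..<e})" by simp
  also have "U \<inter> (\<lambda>w. norm (poly (F w) z)) -` {..<e} = {w \<in> U. norm (poly (F w) z) < e}" by blast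
  finally show ?thesis .
qed

text \<open>Discs around the roots over \<open>w0\<close>, with radius half their least distance,
  are disjoint. Near \<open>w0\<close> each centre has a value below \<delta>^m, so each disc
  contains a root of \<open>F w\<close>; as there are m discs and m roots, it contains exactly
  one.\<close>

lemma local_root_functions:
  assumes w0: "w0 \<in> U"
  shows "\<exists>T \<delta> q. open T \<and> w0 \<in> T \<and> T \<subseteq> U \<and> \<delta> > 0 \<and>
    (\<forall>a\<in>roots w0. continuous_on T (q a)) \<and>
    (\<forall>a\<in>roots w0. \<forall>w\<in>T. q a w \<in> roots w \<and> dist a (q a w) < \<delta>) \<and>
    (\<forall>a\<in>roots w0. \<forall>w\<in>T. \<forall>b\<in>roots w. dist a b < \<delta> \<longrightarrow> b = q a w) \<and>
    (\<forall>w\<in>T. \<forall>b\<in>roots w. \<exists>a\<in>roots w0. dist a b < \<delta>) \<and>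
    (\<forall>a\<in>roots w0. \<forall>b\<in>roots w0. \<forall>z. dist a z < \<delta> \<longrightarrow> dist b z < \<delta> \<longrightarrow> a = b)"
proof -
  let ?A = "roots w0"
  have fin: "finite ?A" using finite_roots w0 by blast
  obtain d where d: "d > 0" "\<And>a b. a \<in> ?A \<Longrightarrow> b \<in> ?A \<Longrightarrow> a \<noteq> b \<Longrightarrow> d \<le> dist a b"
  proof -
    have "\<exists>d>0. \<forall>b\<in>?A. b \<noteq> a \<longrightarrow> d \<le> dist a b" if "a \<in> ?A" for a
      using finite_set_avoid[OF fin, of a] by blast
    then obtain d where d: "\<And>a. a \<in> ?A \<Longrightarrow> d a > 0 \<and> (\<forall>b\<in>?A. b \<noteq> a \<longrightarrow> d a \<le> dist a b)" by metis
    have ne: "?A \<noteq> {}" using card_roots[OF w0] m by auto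
    have "Min (d ` ?A) > 0" using fin ne d by (subst Min_gr_iff) auto
    moreover have "Min (d ` ?A) \<le> dist a b" if "a \<in> ?A" "b \<in> ?A" "a \<noteq> b" for a b
    proof -
      have "Min (d ` ?A) \<le> d a" using fin that by (intro Min_le) auto
      then show ?thesis using d that by force
    qed
    ultimately show ?thesis using that by blast
  qed
  define \<delta> where "\<delta> = d / 2"
  have \<delta>: "\<delta> > 0" using d by (simp add: \<delta>_def)
  have disj: "a = b" if "a \<in> ?A" "b \<in> ?A" "dist a z < \<delta>" "dist b z < \<delta>" for a b z
  proof (rule ccontr)
    assume "a \<noteq> b"
    then have "d \<le> dist a b" using d that by blast
    then show False using that dist_triangle2[of a b z] by (simp add: \<delta>_def)
  qed
  define T where "T = U \<inter> (\<Inter>a\<in>?A. {w \<in> U. norm (poly (F w) a) < \<delta> ^ m})"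
  have T: "open T" unfolding T_def using U fin open_poly_less by (intro open_Int open_INT) auto
  have T0: "w0 \<in> T" unfolding T_def using w0 \<delta> by (auto simp: roots_def)
  have TU: "T \<subseteq> U" unfolding T_def by blast
  define q where "q a w = (SOME \<beta>. \<beta> \<in> roots w \<and> dist a \<beta> < \<delta>)" for a w
  have q: "q a w \<in> roots w \<and> dist a (q a w) < \<delta>" if "a \<in> ?A" "w \<in> T" for a w
  proof -
    have "\<exists>\<beta>\<in>roots w. dist a \<beta> < \<delta>" using that \<delta> by (intro near_root) (auto simp: T_def)
    then show ?thesis unfolding q_def by (metis (mono_tags, lifting) someI_ex)
  qed
  have all: "(\<lambda>a. q a w) ` ?A = roots w" if w: "w \<in> T" for w
  proof (rule card_subset_eq)
    have "inj_on (\<lambda>a. q a w) ?A" using q w disj by (intro inj_onI) metis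
    then show "card ((\<lambda>a. q a w) ` ?A) = card (roots w)"
      using card_roots w \<open>T \<subseteq> U\<close> w0 by (simp add: card_image subset_iff)
  qed (use q w finite_roots \<open>T \<subseteq> U\<close> in auto)
  have uniq: "b = q a w" if ab: "a \<in> ?A" "w \<in> T" "b \<in> roots w" "dist a b < \<delta>" for a b w
  proof -
    obtain a' where a': "a' \<in> ?A" "b = q a' w" using all[OF ab(2)] ab(3) by blast
    then have "a' = a" using q[OF a'(1) ab(2)] disj ab by metis
    then show ?thesis using a' by simp
  qed
  have contq: "continuous_on T (q a)" if a: "a \<in> ?A" for a
  proof -
    have "isCont (q a) w1" if w1: "w1 \<in> T" for w1
      unfolding continuous_at_eps_delta
    proof (intro allI impI)
      fix e :: real assume "e > 0"
      \<comment> \<open>The second bound keeps a root that is close to \<open>q a w1\<close> inside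
        the disc around \<open>a\<close>, where \<open>q a w\<close> is the only root.\<close>
      define \<eta> where "\<eta> = min e (\<delta> - dist a (q a w1))"
      have \<eta>: "\<eta> > 0" using q[OF a w1] \<open>e > 0\<close> by (simp add: \<eta>_def)
      let ?V = "T \<inter> {w \<in> U. norm (poly (F w) (q a w1)) < \<eta> ^ m}"
      have "open ?V" using \<open>open T\<close> open_poly_less by blast
      moreover have "w1 \<in> ?V" using w1 \<open>T \<subseteq> U\<close> q[OF a w1] \<eta> by (auto simp: roots_def)
      ultimately obtain s where s: "s > 0" "ball w1 s \<subseteq> ?V" using open_contains_ball by blast
      have "dist (q a w) (q a w1) < e" if "dist w w1 < s" for w
      proof -
        have w: "w \<in> ?V" using s that by (auto simp: dist_commute)
        then obtain \<beta> where \<beta>: "\<beta> \<in> roots w" "dist (q a w1) \<beta> < \<eta>"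
          using near_root[of w "q a w1" \<eta>] \<eta> by auto
        then have "dist a \<beta> < \<delta>" using dist_triangle[of a \<beta> "q a w1"] by (simp add: \<eta>_def)
        then have "\<beta> = q a w" using uniq a w \<beta> by blast
        then show ?thesis using \<beta> by (simp add: \<eta>_def dist_commute)
      qed
      then show "\<exists>d>0. \<forall>x'. dist x' w1 < d \<longrightarrow> dist (q a x') (q a w1) < e" using s by blast
    qed
    then show ?thesis using continuous_at_imp_continuous_on by blast
  qed
  have ex: "\<exists>a\<in>?A. dist a b < \<delta>" if wb: "w \<in> T" "b \<in> roots w" for b w
  proof -
    obtain a where "a \<in> ?A" "b = q a w" using all[OF wb(1)] wb(2) by blast
    then show ?thesis using q wb by blast
  qed
  show ?thesis
    by (intro exI[of _ T] exI[of _ \<delta>] exI[of _ q] conjI ballI allI impI)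
      (use T T0 TU \<delta> contq q uniq ex disj in blast)+
qed

text \<open>The sheets over \<open>T\<close> are the parts of the root set in the disjoint discs,
  each the graph of one local root function. Global root functions become lifts of the identity of
  \<open>U\<close>.\<close>

lemma covering_space_roots:
  "covering_space {(w, z). w \<in> U \<and> z \<in> roots w} fst U"
proof
  let ?Z = "{(w, z). w \<in> U \<and> z \<in> roots w}"
  show "continuous_on ?Z fst" by (intro continuous_intros)
  have "roots w \<noteq> {}" if "w \<in> U" for w using card_roots[OF that] m by auto
  then show "fst ` ?Z = U" by (force simp: image_iff)
  fix w0 assume w0: "w0 \<in> U"
  obtain T \<delta> q where T: "open T" "w0 \<in> T" "T \<subseteq> U" "\<delta> > 0"
    and cont': "\<forall>a\<in>roots w0. continuous_on T (q a)"
    and q': "\<forall>a\<in>roots w0. \<forall>w\<in>T. q a w \<in> roots w \<and> dist a (q a w) < \<delta>"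
    and uniq': "\<forall>a\<in>roots w0. \<forall>w\<in>T. \<forall>b\<in>roots w. dist a b < \<delta> \<longrightarrow> b = q a w"
    and ex': "\<forall>w\<in>T. \<forall>b\<in>roots w. \<exists>a\<in>roots w0. dist a b < \<delta>"
    and disj': "\<forall>a\<in>roots w0. \<forall>b\<in>roots w0. \<forall>z. dist a z < \<delta> \<longrightarrow> dist b z < \<delta> \<longrightarrow> a = b"
    using local_root_functions[OF w0] by (elim exE conjE)
  note cont = bspec[OF cont'] and ex = bspec[OF bspec[OF ex']]
    and q = bspec[OF bspec[OF q']] and uniq = mp[OF bspec[OF bspec[OF bspec[OF uniq']]]]
  have disj: "a = b" if "a \<in> roots w0" "b \<in> roots w0" "dist a z < \<delta>" "dist b z < \<delta>" for a b z
    using disj' that by blast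
  let ?u = "\<lambda>a. ?Z \<inter> (T \<times> ball a \<delta>)"
  show "\<exists>T. w0 \<in> T \<and> openin (top_of_set U) T \<and> (\<exists>v. \<Union> v = ?Z \<inter> fst -` T \<and>
      (\<forall>u\<in>v. openin (top_of_set ?Z) u) \<and> pairwise disjnt v \<and> (\<forall>u\<in>v. \<exists>q. homeomorphism u T fst q))"
  proof (intro exI[of _ T] conjI exI[of _ "?u ` roots w0"])
    show "openin (top_of_set U) T" using T U by (simp add: openin_open_eq)
    show "\<Union> (?u ` roots w0) = ?Z \<inter> fst -` T" using ex by (auto simp: mem_ball)
    show "\<forall>u\<in>?u ` roots w0. openin (top_of_set ?Z) u"
      using T by (auto intro!: openin_open_Int open_Times)
    show "pairwise disjnt (?u ` roots w0)"
      unfolding pairwise_def disjnt_def using disj by (fastforce simp: mem_ball)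
    show "\<forall>u\<in>?u ` roots w0. \<exists>q. homeomorphism u T fst q"
    proof
      fix u assume "u \<in> ?u ` roots w0"
      then obtain a where a: "a \<in> roots w0" "u = ?u a" by blast
      have "homeomorphism u T fst (\<lambda>w. (w, q a w))"
        unfolding homeomorphism_def
      proof (intro conjI ballI)
        show "continuous_on T (\<lambda>w. (w, q a w))" using cont[OF a(1)] by (intro continuous_intros)
        show "fst ` u = T"
        proof
          show "T \<subseteq> fst ` u"
          proof
            fix w assume "w \<in> T"
            then have "(w, q a w) \<in> u" using q[OF a(1)] T a by auto
            then show "w \<in> fst ` u" by force
          qed
        qed (use a in auto)
        show "(\<lambda>w. (w, q a w)) ` T = u"
        proof
          show "u \<subseteq> (\<lambda>w. (w, q a w)) ` T" using uniq a by (auto simp: mem_ball)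
        qed (use q a T in auto)
        show "(fst z, q a (fst z)) = z" if "z \<in> u" for z
          using that uniq[OF a(1)] a by (auto simp: mem_ball)
      qed (auto intro: continuous_intros)
      then show "\<exists>q. homeomorphism u T fst q" by blast
    qed
  qed (use T in auto)
qed

lemma root_function_unique:
  assumes "continuous_on U f" "continuous_on U g" "\<And>w. w \<in> U \<Longrightarrow> f w \<in> roots w"
    "\<And>w. w \<in> U \<Longrightarrow> g w \<in> roots w" "w0 \<in> U" "f w0 = g w0" "w \<in> U"
  shows "f w = g w"
proof -
  have "(\<lambda>w. (w, f w)) w = (\<lambda>w. (w, g w)) w"
    by (rule covering_space_lift_unique[OF covering_space_roots, where a = w0 and f = "\<lambda>w. w" and T = U])
      (use assms U in \<open>auto intro!: continuous_intros convex_connected\<close>)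
  then show ?thesis by simp
qed

lemma root_function_exists:
  assumes "w0 \<in> U" "a \<in> roots w0"
  shows "\<exists>f. continuous_on U f \<and> (\<forall>w\<in>U. f w \<in> roots w) \<and> f w0 = a"
proof -
  have sc: "simply_connected U" using U convex_imp_simply_connected by blast
  have lp: "locally path_connected U" using U convex_imp_locally_path_connected by blast
  obtain g where g: "continuous_on U g" "g \<in> U \<rightarrow> {(w, z). w \<in> U \<and> z \<in> roots w}"
    "g w0 = (w0, a)" "\<And>y. y \<in> U \<Longrightarrow> fst (g y) = y"
    by (rule covering_space_lift_strong[OF covering_space_roots, of "(w0, a)" w0 U "\<lambda>w. w"])
      (use assms sc lp in auto)
  show ?thesis
  proof (intro exI[of _ "\<lambda>w. snd (g w)"] conjI ballI)
    fix w assume "w \<in> U"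
    then have "fst (g w) = w" by (rule g(4))
    moreover have "g w \<in> {(w, z). w \<in> U \<and> z \<in> roots w}" by (rule funcset_mem[OF g(2) \<open>w \<in> U\<close>])
    ultimately show "snd (g w) \<in> roots w" by (metis (mono_tags, lifting) case_prodD mem_Collect_eq prod.collapse)
  qed (use g in \<open>auto intro!: continuous_intros\<close>)
qed

text \<open>The root function is determined by its value at \<open>w0\<close>, so the choice is
  unique on \<open>U\<close>; the roots over \<open>w0\<close> label all branches.\<close>

definition branch where
  "branch w0 a = (SOME f. continuous_on U f \<and> (\<forall>w\<in>U. f w \<in> roots w) \<and> f w0 = a)"

context
  fixes w0 assumes w0: "w0 \<in> U"
begin

lemma branch:
  assumes "a \<in> roots w0"
  shows "continuous_on U (branch w0 a)" "\<And>w. w \<in> U \<Longrightarrow> branch w0 a w \<in> roots w" "branch w0 a w0 = a"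
  using someI_ex[OF root_function_exists[OF w0 assms]] unfolding branch_def by blast+

lemma branch_eqI:
  assumes "continuous_on U f" "\<And>w. w \<in> U \<Longrightarrow> f w \<in> roots w" "w \<in> U"
  shows "f w = branch w0 (f w0) w"
  by (rule root_function_unique[where f = f and g = "branch w0 (f w0)" and ?w0.0 = w0])
    (use assms branch w0 in auto)

lemma inj_on_branch:
  assumes "w \<in> U" shows "inj_on (\<lambda>a. branch w0 a w) (roots w0)"
proof (rule inj_onI)
  fix a b assume ab: "a \<in> roots w0" "b \<in> roots w0" "branch w0 a w = branch w0 b w"
  have "branch w0 a w0 = branch w0 b w0"
    by (rule root_function_unique[where f = "branch w0 a" and g = "branch w0 b" and ?w0.0 = w])
      (use ab branch assms w0 in auto)
  then show "a = b" using branch ab by simp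
qed

lemma branch_image: "w \<in> U \<Longrightarrow> (\<lambda>a. branch w0 a w) ` roots w0 = roots w"
  by (rule card_subset_eq)
    (use branch finite_roots inj_on_branch card_roots w0 in \<open>auto simp: card_image\<close>)

lemma prod_branch: "w \<in> U \<Longrightarrow> F w = (\<Prod>a\<in>roots w0. [:- branch w0 a w, 1:])"
  using prod.reindex[OF inj_on_branch, of w "\<lambda>z. [:- z, 1:]"] poly_eq_prod_roots[of w] branch_image[of w]
  by (simp add: o_def)

text \<open>At \<open>\<alpha>\<close>, the value of the branch at \<open>w1\<close>, the family
  factors as (\<alpha> - branch) times the product \<open>?Q\<close> over the other branches.
  \<open>?Q\<close> is continuous and nonzero at \<open>w1\<close> because the roots are simple, so
  the difference quotient of the branch is minus that of the family divided by
  \<open>?Q\<close>.\<close>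

lemma holomorphic_branch:
  assumes a: "a \<in> roots w0"
  shows "branch w0 a holomorphic_on U"
  unfolding holomorphic_on_open[OF U(1)]
proof
  fix w1 assume w1: "w1 \<in> U"
  define \<alpha> where "\<alpha> = branch w0 a w1"
  let ?Q = "\<lambda>w. \<Prod>b\<in>roots w0 - {a}. \<alpha> - branch w0 b w"
  obtain D where D: "((\<lambda>w. poly (F w) \<alpha>) has_field_derivative D) (at w1)"
    using hol[of \<alpha>] w1 U holomorphic_on_open by blast
  have fac: "poly (F w) \<alpha> = (\<alpha> - branch w0 a w) * ?Q w" if "w \<in> U" for w
  proof -
    have "poly (F w) \<alpha> = (\<Prod>b\<in>roots w0. \<alpha> - branch w0 b w)"
      by (subst prod_branch[OF that]) (simp add: poly_prod)
    also have "\<dots> = (\<alpha> - branch w0 a w) * ?Q w" by (rule prod.remove[OF finite_roots[OF w0] a])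
    finally show ?thesis .
  qed
  have Q1: "?Q w1 \<noteq> 0"
    using inj_on_branch[OF w1] a finite_roots[OF w0] by (auto simp: \<alpha>_def inj_on_def)
  have cont: "isCont (branch w0 b) w1" if "b \<in> roots w0" for b
    using branch(1)[OF that] w1 U continuous_on_eq_continuous_at by blast
  have Qlim: "(?Q \<longlongrightarrow> ?Q w1) (at w1)"
    using cont unfolding isCont_def by (intro tendsto_prod tendsto_diff tendsto_const) auto
  have "((\<lambda>w. - ((poly (F w) \<alpha> - poly (F w1) \<alpha>) / (w - w1)) / ?Q w) \<longlongrightarrow> - D / ?Q w1) (at w1)"
    using D unfolding has_field_derivative_iff
    by (intro tendsto_divide[OF tendsto_minus Qlim Q1])
  moreover have "eventually (\<lambda>w. - ((poly (F w) \<alpha> - poly (F w1) \<alpha>) / (w - w1)) / ?Q w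
      = (branch w0 a w - branch w0 a w1) / (w - w1)) (at w1)"
  proof -
    have "eventually (\<lambda>w. ?Q w \<noteq> 0) (at w1)"
      using Qlim Q1 tendsto_imp_eventually_ne by blast
    moreover have "eventually (\<lambda>w. w \<in> U) (at w1)"
      using U w1 eventually_at_topological by blast
    ultimately show ?thesis
    proof eventually_elim
      case (elim w)
      have "poly (F w1) \<alpha> = 0" using branch(2)[OF a w1] by (simp add: \<alpha>_def roots_def)
      then have "- ((poly (F w) \<alpha> - poly (F w1) \<alpha>) / (w - w1)) / ?Q w
          = (branch w0 a w - \<alpha>) * ?Q w / (w - w1) / ?Q w"
      proof -
        have "poly (F w) \<alpha> - poly (F w1) \<alpha> = - ((branch w0 a w - \<alpha>) * ?Q w)"
          using fac[OF elim(2)] \<open>poly (F w1) \<alpha> = 0\<close> by (simp add: left_diff_distrib)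
        then show ?thesis by (simp only: minus_divide_left[symmetric] minus_minus)
      qed
      also have "\<dots> = (branch w0 a w - \<alpha>) / (w - w1)" using elim(1) by simp
      finally show ?case by (simp add: \<alpha>_def)
    qed
  qed
  ultimately have "((\<lambda>w. (branch w0 a w - branch w0 a w1) / (w - w1)) \<longlongrightarrow> - D / ?Q w1) (at w1)"
    by (rule Lim_transform_eventually)
  then show "\<exists>f'. (branch w0 a has_field_derivative f') (at w1)"
    unfolding has_field_derivative_iff by blast
qed

end

end

text \<open>Removing a pair \<open>{x, \<alpha> x}\<close> and joining the two \<open>\<beta>\<close>-partners it leaves behind
  keeps the pair of involutions fixpoint free.\<close>

lemma two_involutions_colouring:
  fixes \<alpha> \<beta> :: "'a \<Rightarrow> 'a"
  assumes "finite A" "\<And>x. x \<in> A \<Longrightarrow> \<alpha> x \<in> A \<and> \<alpha> (\<alpha> x) = x \<and> \<alpha> x \<noteq> x"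
    "\<And>x. x \<in> A \<Longrightarrow> \<beta> x \<in> A \<and> \<beta> (\<beta> x) = x \<and> \<beta> x \<noteq> x"
  shows "\<exists>c :: 'a \<Rightarrow> bool. \<forall>x\<in>A. c (\<alpha> x) = (\<not> c x) \<and> c (\<beta> x) = (\<not> c x)"
  using assms
proof (induction "card A" arbitrary: A \<beta> rule: less_induct)
  case less
  note \<alpha> = less.prems(2) and \<beta> = less.prems(3)
  show ?case
  proof (cases "A = {}")
    case False
    then obtain x where x: "x \<in> A" by blast
    define x' where "x' = \<alpha> x"
    define B where "B = A - {x, x'}"
    have x': "x' \<in> A" "x' \<noteq> x" "\<alpha> x' = x" using \<alpha>[OF x] by (auto simp: x'_def)
    have inB: "z \<in> B" if "z \<in> A" "z \<noteq> x" "z \<noteq> x'" for z using that by (simp add: B_def)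
    have outB: "z \<in> A" "z \<noteq> x" "z \<noteq> x'" if "z \<in> B" for z using that by (auto simp: B_def)
    have "card B < card A" using less.prems(1) x unfolding B_def by (intro psubset_card_mono) auto
    moreover have "finite B" using less.prems(1) by (simp add: B_def)
    moreover have \<alpha>B: "\<alpha> z \<in> B \<and> \<alpha> (\<alpha> z) = z \<and> \<alpha> z \<noteq> z" if "z \<in> B" for z
      using \<alpha>[OF outB(1)[OF that]] outB[OF that] x' x'_def inB by metis
    ultimately have IH: "\<exists>c. \<forall>z\<in>B. c (\<alpha> z) = (\<not> c z) \<and> c (\<gamma> z) = (\<not> c z)"
      if "\<And>z. z \<in> B \<Longrightarrow> \<gamma> z \<in> B \<and> \<gamma> (\<gamma> z) = z \<and> \<gamma> z \<noteq> z" for \<gamma>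
      using less.hyps that by blast
    show ?thesis
    proof (cases "\<beta> x = x'")
      case True
      have \<beta>B: "\<beta> z \<in> B \<and> \<beta> (\<beta> z) = z \<and> \<beta> z \<noteq> z" if "z \<in> B" for z
        using \<beta>[OF outB(1)[OF that]] outB[OF that] True \<beta>[OF x] inB by metis
      from IH[OF this] obtain c where c: "\<And>z. z \<in> B \<Longrightarrow> c (\<alpha> z) = (\<not> c z) \<and> c (\<beta> z) = (\<not> c z)" by blast
      define c' where "c' z = (if z = x then True else if z = x' then False else c z)" for z
      have c'B: "c' z = c z" if "z \<in> B" for z using outB[OF that] by (simp add: c'_def)
      have "c' (\<alpha> z) = (\<not> c' z) \<and> c' (\<beta> z) = (\<not> c' z)" if zA: "z \<in> A" for z
      proof -
        consider "z = x" | "z = x'" | "z \<in> B" using inB zA by blast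
        then show ?thesis
        proof cases
          case 3
          then show ?thesis using c c'B \<alpha>B \<beta>B by metis
        next
          case 2
          have "\<beta> x' = x" using True \<beta>[OF x] by auto
          then show ?thesis using 2 x' by (simp add: c'_def)
        qed (use x' True in \<open>simp add: c'_def x'_def[symmetric]\<close>)
      qed
      then show ?thesis by blast
    next
      case False
      define y z where "y = \<beta> x" and "z = \<beta> x'"
      have y: "y \<in> B" "\<beta> y = x" using \<beta>[OF x] False inB by (auto simp: y_def)
      have "z \<noteq> x" using \<beta>[OF x'(1)] False by (auto simp: z_def)
      then have z: "z \<in> B" "\<beta> z = x'" using \<beta>[OF x'(1)] inB by (auto simp: z_def)
      have yz: "y \<noteq> z" using y z x' by auto
      define \<gamma> where "\<gamma> = \<beta>(y := z, z := y)"
      have \<beta>B: "\<beta> u \<in> B \<and> \<beta> u \<noteq> y \<and> \<beta> u \<noteq> z" if u: "u \<in> B" "u \<noteq> y" "u \<noteq> z" for u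
        using \<beta>[OF outB(1)[OF u(1)]] outB[OF u(1)] y z u inB y_def z_def by metis
      have "\<gamma> u \<in> B \<and> \<gamma> (\<gamma> u) = u \<and> \<gamma> u \<noteq> u" if u: "u \<in> B" for u
      proof (cases "u = y \<or> u = z")
        case True
        then show ?thesis using y z yz by (auto simp: \<gamma>_def)
      next
        case False
        then show ?thesis using \<beta>B[OF u] \<beta>[OF outB(1)[OF u]] by (simp add: \<gamma>_def)
      qed
      from IH[OF this] obtain c where c: "\<And>z. z \<in> B \<Longrightarrow> c (\<alpha> z) = (\<not> c z) \<and> c (\<gamma> z) = (\<not> c z)" by blast
      have cyz: "c z = (\<not> c y)" using c[OF y(1)] yz by (simp add: \<gamma>_def)
      \<comment> \<open>\<open>\<gamma>\<close> joins \<open>y\<close> and \<open>z\<close>, which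
        therefore differ in colour. Opposing \<open>x\<close> to its partner \<open>y\<close> and
        \<open>x'\<close> to its partner \<open>z\<close> then makes \<open>x\<close> and
        \<open>x'\<close> differ as well.\<close>
      define c' where "c' u = (if u = x then \<not> c y else if u = x' then \<not> c z else c u)" for u
      have c'B: "c' u = c u" if "u \<in> B" for u using outB[OF that] by (simp add: c'_def)
      have c'x: "c' x = (\<not> c y)" "c' x' = (\<not> c z)" using x' by (simp_all add: c'_def)
      have "c' (\<alpha> u) = (\<not> c' u) \<and> c' (\<beta> u) = (\<not> c' u)" if uA: "u \<in> A" for u
      proof -
        consider "u = x" | "u = x'" | "u = y" | "u = z" | "u \<in> B" "u \<noteq> y" "u \<noteq> z" using inB uA by blast
        then show ?thesis
        proof cases
          case 1
          then show ?thesis using c'x c'B[OF y(1)] cyz y_def x'_def by metis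
        next
          case 2
          then show ?thesis using c'x c'B[OF z(1)] cyz z_def x'(3) by metis
        next
          case 3
          then show ?thesis using c[OF y(1)] c'B y c'x \<alpha>B by metis
        next
          case 4
          then show ?thesis using c[OF z(1)] c'B z c'x \<alpha>B by metis
        next
          case 5
          then have "\<gamma> u = \<beta> u" by (simp add: \<gamma>_def)
          then show ?thesis using c[OF 5(1)] c'B \<alpha>B[OF 5(1)] \<beta>B[OF 5] 5(1) by metis
        qed
      qed
      then show ?thesis by blast
    qed
  qed simp
qed

lemma holomorphic_on_coeff_prod_linear:
  assumes "finite B" "\<And>a. a \<in> B \<Longrightarrow> f a holomorphic_on U"
  shows "(\<lambda>w. coeff (\<Prod>a\<in>B. [:- f a w, 1:]) j) holomorphic_on U"
  using assms
proof (induction B arbitrary: j rule: finite_induct)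
  case (insert a B)
  then have IH: "(\<lambda>w. coeff (\<Prod>a\<in>B. [:- f a w, 1:]) j) holomorphic_on U" for j by blast
  have "coeff (\<Prod>a\<in>insert a B. [:- f a w, 1:]) j = - f a w * coeff (\<Prod>a\<in>B. [:- f a w, 1:]) j
      + (case j of 0 \<Rightarrow> 0 | Suc i \<Rightarrow> coeff (\<Prod>a\<in>B. [:- f a w, 1:]) i)" for w
    using insert.hyps by (simp add: coeff_pCons split: nat.split)
  then show ?case using IH insert.prems
    by (cases j) (auto intro!: holomorphic_intros)
qed simp

lemma bounded_coeff_prod_linear:
  fixes f :: "'a \<Rightarrow> complex \<Rightarrow> complex"
  assumes "finite B" "\<And>a w. a \<in> B \<Longrightarrow> w \<in> V \<Longrightarrow> norm (f a w) \<le> K"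
  shows "\<exists>C. \<forall>w\<in>V. \<forall>j. norm (coeff (\<Prod>a\<in>B. [:- f a w, 1:]) j) \<le> C"
  using assms
proof (induction B rule: finite_induct)
  case empty
  then show ?case by (intro exI[of _ 1]) (auto simp: coeff_1 split: if_splits)
next
  case (insert a B)
  have "\<exists>C. \<forall>w\<in>V. \<forall>j. norm (coeff (\<Prod>a\<in>B. [:- f a w, 1:]) j) \<le> C"
    by (rule insert.IH) (use insert.prems in blast)
  then obtain C where C: "\<And>w j. w \<in> V \<Longrightarrow> norm (coeff (\<Prod>a\<in>B. [:- f a w, 1:]) j) \<le> C" by blast
  have "norm (coeff (\<Prod>a\<in>insert a B. [:- f a w, 1:]) j) \<le> \<bar>K\<bar> * \<bar>C\<bar> + \<bar>C\<bar>" if w: "w \<in> V" for w j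
  proof -
    let ?p = "\<Prod>a\<in>B. [:- f a w, 1:]"
    have "coeff (\<Prod>a\<in>insert a B. [:- f a w, 1:]) j = - f a w * coeff ?p j
        + (case j of 0 \<Rightarrow> 0 | Suc i \<Rightarrow> coeff ?p i)"
      using insert.hyps by (simp add: coeff_pCons split: nat.split)
    also have "norm \<dots> \<le> norm (- f a w * coeff ?p j) + norm (case j of 0 \<Rightarrow> 0 | Suc i \<Rightarrow> coeff ?p i)"
      by (rule norm_triangle_ineq)
    also have "norm (- f a w * coeff ?p j) \<le> \<bar>K\<bar> * \<bar>C\<bar>"
      unfolding norm_mult using insert.prems[of a w] C[OF w, of j] w by (intro mult_mono) auto
    also have "norm (case j of 0 \<Rightarrow> 0 | Suc i \<Rightarrow> coeff ?p i) \<le> \<bar>C\<bar>"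
      using C[OF w] by (auto split: nat.split intro: order_trans[OF _ abs_ge_self])
    finally show ?thesis by simp
  qed
  then show ?case by blast
qed

section \<open>Complex specialisation of the first variable, with bounds on coefficients and
  roots\<close>

definition specialize :: "bipoly \<Rightarrow> complex \<Rightarrow> complex poly" where
  "specialize p t = map_poly (\<lambda>c. poly (of_real_poly c) t) p"

lemma coeff_specialize: "coeff (specialize p t) j = poly (of_real_poly (coeff p j)) t"
  by (simp add: specialize_def coeff_map_poly)

lemma degree_specialize_le: "degree (specialize p t) \<le> degree p"
  by (rule degree_le) (simp add: coeff_specialize coeff_eq_0)

lemma specialize_monic:
  assumes "lead_coeff p = 1"
  shows "degree (specialize p t) = degree p" "lead_coeff (specialize p t) = 1"
proof -
  have "coeff (specialize p t) (degree p) = 1" using assms by (simp add: coeff_specialize)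
  then show deg: "degree (specialize p t) = degree p"
    using degree_specialize_le[of p t] le_degree[of "specialize p t" "degree p"] by simp
  show "lead_coeff (specialize p t) = 1"
    using \<open>coeff (specialize p t) (degree p) = 1\<close> deg by simp
qed

lemma poly_specialize:
  "poly (specialize p t) z = (\<Sum>j\<le>degree p. poly (of_real_poly (coeff p j)) t * z ^ j)"
proof -
  have "poly (specialize p t) z = (\<Sum>j\<le>degree (specialize p t). coeff (specialize p t) j * z ^ j)"
    by (rule poly_altdef)
  also have "\<dots> = (\<Sum>j\<le>degree p. coeff (specialize p t) j * z ^ j)"
    by (rule sum.mono_neutral_left) (use degree_specialize_le[of p t] in \<open>auto simp: coeff_eq_0\<close>)
  finally show ?thesis by (simp add: coeff_specialize)
qed

lemma specialize_add: "specialize (p + q) t = specialize p t + specialize q t"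
  by (rule poly_eqI) (simp add: coeff_specialize)

lemma specialize_mult: "specialize (p * q) t = specialize p t * specialize q t"
proof (rule poly_eqI)
  fix n
  have "of_real_poly (sum f A) = (\<Sum>i\<in>A. of_real_poly (f i))" for f :: "nat \<Rightarrow> real poly" and A
    by (induction A rule: infinite_finite_induct) auto
  then show "coeff (specialize (p * q) t) n = coeff (specialize p t * specialize q t) n"
    by (simp add: coeff_specialize coeff_mult poly_sum)
qed

lemma poly_specialize_of_real:
  "poly (specialize p (of_real x)) (of_real y) = of_real (evalp p (x, y))"
  by (simp add: poly_specialize evalp_sum_coeff[OF order_refl])

lemma poly_of_real_poly_cnj: "poly (of_real_poly c) (cnj t) = cnj (poly (of_real_poly c) t)"
  by (induction c) (auto simp: map_poly_pCons)

lemma poly_specialize_cnj: "poly (specialize p (cnj t)) (cnj z) = cnj (poly (specialize p t) z)"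
  by (simp add: poly_specialize poly_of_real_poly_cnj)

text \<open>If the modulus of \<open>z\<close> exceeds 1, each lower term is at most C |z|^(m-1), so
  |z|^m is at most C m |z|^(m-1).\<close>

lemma monic_root_bound:
  fixes P :: "complex poly"
  assumes "lead_coeff P = 1" "poly P z = 0" "\<And>j. norm (coeff P j) \<le> C"
  shows "norm z \<le> 1 + C * real (degree P)"
proof (rule ccontr)
  assume contra: "\<not> ?thesis"
  let ?m = "degree P"
  have C: "C \<ge> 0" using assms(3)[of 0] norm_ge_zero order_trans by blast
  then have z1: "norm z > 1" using contra by (smt (verit) mult_nonneg_nonneg of_nat_0_le_iff)
  have "?m > 0"
  proof (rule ccontr)
    assume "\<not> ?m > 0"
    then obtain c where "P = [:c:]" by (metis degree_eq_zeroE gr0I)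
    then show False using assms(1,2) by simp
  qed
  have "z ^ ?m + (\<Sum>j<?m. coeff P j * z ^ j) = 0"
    using assms(1,2) by (simp add: poly_altdef lessThan_Suc_atMost[symmetric] add.commute)
  then have "norm z ^ ?m = norm (\<Sum>j<?m. coeff P j * z ^ j)"
    by (metis add_eq_0_iff norm_minus_cancel norm_power)
  also have "\<dots> \<le> (\<Sum>j<?m. C * norm z ^ (?m - 1))"
  proof (rule sum_norm_le)
    fix j assume "j \<in> {..<?m}"
    then have "norm z ^ j \<le> norm z ^ (?m - 1)" using z1 by (intro power_increasing) auto
    then show "norm (coeff P j * z ^ j) \<le> C * norm z ^ (?m - 1)"
      unfolding norm_mult norm_power using assms(3) C by (intro mult_mono) auto
  qed
  also have "\<dots> = C * real ?m * norm z ^ (?m - 1)" by simp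
  finally have "norm z * norm z ^ (?m - 1) \<le> C * real ?m * norm z ^ (?m - 1)"
    using \<open>?m > 0\<close> by (metis power_eq_if less_numeral_extra(3))
  moreover have "norm z ^ (?m - 1) > 0" using z1 by (intro zero_less_power) linarith
  ultimately have "norm z \<le> C * real ?m" by (rule mult_right_le_imp_le)
  then show False using contra by simp
qed

lemma bounded_coeff_specialize:
  "\<exists>C. \<forall>t\<in>cball 0 r. \<forall>j. norm (coeff (specialize p t) j) \<le> C"
proof -
  have "continuous_on (cball 0 r) (\<lambda>t. \<Sum>j\<le>degree p. norm (coeff (specialize p t) j))"
    unfolding coeff_specialize by (intro continuous_intros)
  then have "bounded ((\<lambda>t. \<Sum>j\<le>degree p. norm (coeff (specialize p t) j)) ` cball 0 r)"
    using compact_continuous_image compact_imp_bounded compact_cball by blast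
  then obtain C where C: "\<And>t. t \<in> cball 0 r \<Longrightarrow> norm (\<Sum>j\<le>degree p. norm (coeff (specialize p t) j)) \<le> C"
    unfolding bounded_iff by blast
  have "norm (coeff (specialize p t) j) \<le> \<bar>C\<bar>" if "t \<in> cball 0 r" for t j
  proof (cases "j \<le> degree p")
    case True
    then have "norm (coeff (specialize p t) j) \<le> (\<Sum>j\<le>degree p. norm (coeff (specialize p t) j))"
      by (intro member_le_sum) auto
    also have "\<dots> \<le> \<bar>C\<bar>" using C[OF that] by (simp add: sum_nonneg)
    finally show ?thesis .
  qed (simp add: coeff_specialize coeff_eq_0)
  then show ?thesis by blast
qed

text \<open>Subtracting the value at 0 and dividing by t leaves a holomorphic function; its
  remainder of order N gives one of order N + 1 for \<open>h\<close>.\<close>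

lemma holomorphic_taylor_bound:
  fixes h :: "complex \<Rightarrow> complex"
  assumes "h holomorphic_on ball 0 r" "r > 0"
  shows "\<exists>c C. \<forall>t. norm t \<le> r / 2 \<longrightarrow> norm (h t - (\<Sum>i<N. c i * t ^ i)) \<le> C * norm t ^ N"
  using assms(1)
proof (induction N arbitrary: h)
  case 0
  have "continuous_on (cball 0 (r / 2)) h"
    using 0 assms(2) by (intro holomorphic_on_imp_continuous_on[OF holomorphic_on_subset]) auto
  then have "bounded (h ` cball 0 (r / 2))"
    using compact_continuous_image compact_imp_bounded compact_cball by blast
  then obtain C where "\<And>t. t \<in> cball 0 (r / 2) \<Longrightarrow> norm (h t) \<le> C"
    unfolding bounded_iff by blast
  then show ?case by (intro exI[of _ "\<lambda>_. 0"] exI[of _ C]) auto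
next
  case (Suc N)
  let ?h = "\<lambda>z. if z = 0 then deriv h 0 else (h z - h 0) / (z - 0)"
  have "?h holomorphic_on ball 0 r" by (rule pole_lemma_open[OF Suc.prems]) auto
  from Suc.IH[OF this] obtain c C where
    cC: "\<And>t. norm t \<le> r / 2 \<Longrightarrow> norm (?h t - (\<Sum>i<N. c i * t ^ i)) \<le> C * norm t ^ N" by blast
  define c' where "c' i = (case i of 0 \<Rightarrow> h 0 | Suc i \<Rightarrow> c i)" for i
  have "norm (h t - (\<Sum>i<Suc N. c' i * t ^ i)) \<le> C * norm t ^ Suc N" if "norm t \<le> r / 2" for t
  proof -
    have "(\<Sum>i<Suc N. c' i * t ^ i) = h 0 + t * (\<Sum>i<N. c i * t ^ i)"
      by (simp only: sum.lessThan_Suc_shift c'_def) (simp add: sum_distrib_left algebra_simps)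
    moreover have "h t - h 0 = t * ?h t" by simp
    ultimately have "h t - (\<Sum>i<Suc N. c' i * t ^ i) = t * (?h t - (\<Sum>i<N. c i * t ^ i))"
      by (simp only: right_diff_distrib diff_diff_eq[symmetric])
    then have "norm (h t - (\<Sum>i<Suc N. c' i * t ^ i)) = norm t * norm (?h t - (\<Sum>i<N. c i * t ^ i))"
      by (simp only: norm_mult)
    also have "\<dots> \<le> norm t * (C * norm t ^ N)"
      using cC[OF that] by (rule mult_left_mono) simp
    finally show ?thesis by (simp add: algebra_simps)
  qed
  then show ?case by blast
qed

text \<open>Over the half plane \<open>t = exp w\<close> the roots become global functions. Both conjugations
  \<open>w \<mapsto> cnj w\<close> (fixing \<open>t > 0\<close>) and \<open>w \<mapsto> cnj w + 2 \<pi> i\<close> (fixing \<open>t < 0\<close>) act on them without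
  fixpoints, so half of the roots can be chosen that are exchanged with the rest by both.\<close>

theorem local_hermitian_square:
  assumes p: "lead_coeff p = 1" "degree p = m" "m > 0" and r: "r > 0"
    and sqf: "\<And>t. t \<noteq> 0 \<Longrightarrow> norm t < r \<Longrightarrow> rsquarefree (specialize p t)"
    and noreal: "\<And>t y. t \<noteq> 0 \<Longrightarrow> \<bar>t\<bar> < r \<Longrightarrow> evalp p (t, y) \<noteq> 0"
  shows "\<exists>g. (\<forall>k. g k holomorphic_on ball 0 r) \<and> (\<forall>k>m div 2. \<forall>t. g k t = 0) \<and>
    (\<forall>t j. t \<noteq> 0 \<longrightarrow> \<bar>t\<bar> < r \<longrightarrow> complex_of_real (poly (coeff p j) t)
       = (\<Sum>i\<le>j. g i (of_real t) * cnj (g (j - i) (of_real t))))"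
proof -
  define U where "U = {w. Re w < ln r}"
  define F where "F w = specialize p (exp w)" for w
  have expU: "norm (exp w) < r" if "w \<in> U" for w
    using that r by (simp add: U_def) (metis exp_ln exp_less_mono)
  interpret root_family U F m
  proof
    show "open U" unfolding U_def by (simp add: open_halfspace_Re_lt)
    show "convex U" unfolding U_def by (simp add: convex_halfspace_Re_lt)
    show "rsquarefree (F w)" if "w \<in> U" for w
      unfolding F_def using expU[OF that] by (intro sqf) auto
    show "(\<lambda>w. poly (F w) z) holomorphic_on U" for z
      unfolding F_def poly_specialize by (intro holomorphic_intros)
  qed (use p specialize_monic in \<open>auto simp: F_def\<close>)
  \<comment> \<open>A base point in \<open>U\<close>; being real, it is also the fixed point
    required of the reflection \<open>cnj\<close>.\<close>
  define w0 where "w0 = complex_of_real (ln r - 1)"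
  have w0: "w0 \<in> U" by (simp add: w0_def U_def)
  define A where "A = roots w0"
  define L where "L = branch w0"
  have finA: "finite A" using finite_roots w0 by (simp add: A_def)
  \<comment> \<open>Composing a branch with \<open>\<sigma>\<close> and conjugating its values gives
    another branch; \<open>star \<sigma>\<close> is the resulting map on the labels.\<close>
  define star where "star \<sigma> a = cnj (L a (\<sigma> w0))" for \<sigma> :: "complex \<Rightarrow> complex" and a
  define reflection where "reflection \<sigma> \<longleftrightarrow> continuous_on UNIV \<sigma> \<and> (\<forall>w. Re (\<sigma> w) = Re w \<and> \<sigma> (\<sigma> w) = w
      \<and> exp (\<sigma> w) = cnj (exp w)) \<and> (\<exists>w1\<in>U. \<sigma> w1 = w1)" for \<sigma> :: "complex \<Rightarrow> complex"
  have star_eq: "L (star \<sigma> a) w = cnj (L a (\<sigma> w))" and star_in: "star \<sigma> a \<in> A"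
    if \<sigma>: "reflection \<sigma>" and a: "a \<in> A" and w: "w \<in> U" for \<sigma> a w
  proof -
    have \<sigma>U: "\<sigma> w \<in> U" if "w \<in> U" for w using \<sigma> that by (simp add: reflection_def U_def)
    have root: "cnj (L a (\<sigma> w)) \<in> roots w" if "w \<in> U" for w
    proof -
      have "L a (\<sigma> w) \<in> roots (\<sigma> w)" using branch(2)[OF w0] a \<sigma>U[OF that] by (simp add: A_def L_def)
      then have "poly (specialize p (cnj (exp w))) (L a (\<sigma> w)) = 0"
        using \<sigma> by (simp add: roots_def F_def reflection_def)
      then have "cnj (poly (specialize p (exp w)) (cnj (L a (\<sigma> w)))) = 0"
        using poly_specialize_cnj[of p "exp w" "cnj (L a (\<sigma> w))"] by simp
      then show ?thesis by (simp add: roots_def F_def)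
    qed
    show "star \<sigma> a \<in> A" using root[OF w0] by (simp add: star_def A_def)
    have "continuous_on U (\<lambda>w. L a (\<sigma> w))"
      using branch(1)[OF w0] a \<sigma> \<sigma>U unfolding A_def L_def reflection_def
      by (intro continuous_on_compose2[of U "branch w0 a" U \<sigma>]) (auto intro: continuous_on_subset)
    then have "continuous_on U (\<lambda>w. cnj (L a (\<sigma> w)))" by (intro continuous_intros)
    from branch_eqI[OF w0 this root w] show "L (star \<sigma> a) w = cnj (L a (\<sigma> w))"
      by (simp add: star_def L_def)
  qed
  have star_inv: "star \<sigma> a \<in> A \<and> star \<sigma> (star \<sigma> a) = a \<and> star \<sigma> a \<noteq> a"
    if \<sigma>: "reflection \<sigma>" and a: "a \<in> A" for \<sigma> a
  proof (intro conjI)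
    show "star \<sigma> a \<in> A" using star_in \<sigma> a w0 by blast
    have "star \<sigma> (star \<sigma> a) = cnj (L (star \<sigma> a) (\<sigma> w0))" by (simp add: star_def)
    also have "\<dots> = cnj (cnj (L a (\<sigma> (\<sigma> w0))))"
      using star_eq[OF \<sigma> a, of "\<sigma> w0"] \<sigma> w0 by (simp add: reflection_def U_def)
    also have "\<dots> = a" using \<sigma> branch(3)[OF w0] a by (simp add: reflection_def A_def L_def)
    finally show "star \<sigma> (star \<sigma> a) = a" .
    obtain w1 where w1: "w1 \<in> U" "\<sigma> w1 = w1" using \<sigma> by (auto simp: reflection_def)
    have "exp w1 = cnj (exp w1)" using \<sigma> w1 unfolding reflection_def by metis
    then obtain t where t: "exp w1 = complex_of_real t" by (metis Reals_cases Reals_cnj_iff)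
    then have t': "t \<noteq> 0" "\<bar>t\<bar> < r" using expU[OF w1(1)] exp_not_eq_zero[of w1] by (auto simp del: exp_not_eq_zero)
    \<comment> \<open>Over the fixed point \<open>w1\<close> the parameter is real and nonzero. A
      branch equal to its reflection would take a real value there, which \<open>noreal\<close>
      forbids.\<close>
    show "star \<sigma> a \<noteq> a"
    proof
      assume "star \<sigma> a = a"
      then have "L a w1 = cnj (L a w1)" using star_eq[OF \<sigma> a w1(1)] w1 by simp
      then obtain y where y: "L a w1 = complex_of_real y" by (metis Reals_cases Reals_cnj_iff)
      have "L a w1 \<in> roots w1" using branch(2)[OF w0] a w1 by (simp add: A_def L_def)
      then have "evalp p (t, y) = 0" using t y by (simp add: roots_def F_def poly_specialize_of_real)
      then show False using noreal t' by blast
    qed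
  qed
  define \<sigma>1 where "\<sigma>1 = cnj"
  define \<sigma>2 where "\<sigma>2 w = cnj w + 2 * complex_of_real pi * \<i>" for w
  have \<sigma>1: "reflection \<sigma>1" unfolding reflection_def \<sigma>1_def
    by (auto simp: exp_cnj w0_def intro!: continuous_intros bexI[OF _ w0])
  have \<sigma>2: "reflection \<sigma>2" unfolding reflection_def
  proof (intro conjI allI)
    show "continuous_on UNIV \<sigma>2" unfolding \<sigma>2_def by (intro continuous_intros)
    \<comment> \<open>The fixed points of \<open>\<sigma>2\<close> have imaginary part pi and lie
      over the negative real axis.\<close>
    show "\<exists>w1\<in>U. \<sigma>2 w1 = w1"
      by (rule bexI[of _ "Complex (ln r - 1) pi"]) (simp_all add: U_def \<sigma>2_def complex_eq_iff)
    show "exp (\<sigma>2 w) = cnj (exp w)" for w by (simp add: \<sigma>2_def exp_add exp_cnj)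
  qed (simp_all add: \<sigma>2_def)
  obtain c where c: "\<forall>a\<in>A. c (star \<sigma>1 a) = (\<not> c a) \<and> c (star \<sigma>2 a) = (\<not> c a)"
    using two_involutions_colouring[OF finA star_inv[OF \<sigma>1] star_inv[OF \<sigma>2]] ..
  define B where "B = {a \<in> A. c a}"
  have BA: "B \<subseteq> A" "finite B" using finA by (auto simp: B_def)
  define g where "g w = (\<Prod>a\<in>B. [:- L a w, 1:])" for w
  define h where "h w = (\<Prod>a\<in>A - B. [:- L a w, 1:])" for w
  have gh: "F w = g w * h w" if "w \<in> U" for w
    using prod_branch[OF w0 that] prod.subset_diff[OF BA(1) finA] 
    by (simp add: g_def h_def A_def L_def mult.commute)
  have bij_star: "bij_betw (star \<sigma>) B (A - B)" if "reflection \<sigma>" "\<sigma> = \<sigma>1 \<or> \<sigma> = \<sigma>2" for \<sigma>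
    by (rule bij_betw_byWitness[where f' = "star \<sigma>"])
      (use c that(2) star_inv[OF that(1)] in \<open>auto simp: B_def\<close>)
  have h_eq: "h w = map_poly cnj (g (\<sigma> w))" if \<sigma>: "\<sigma> = \<sigma>1 \<or> \<sigma> = \<sigma>2" and w: "w \<in> U" for \<sigma> w
  proof (rule poly_ext)
    fix z
    have refl: "reflection \<sigma>" using \<sigma> \<sigma>1 \<sigma>2 by blast
    have bij: "bij_betw (star \<sigma>) B (A - B)" using bij_star[OF refl] \<sigma> by blast
    have "poly (h w) z = (\<Prod>b\<in>A - B. z - L b w)" by (simp add: h_def poly_prod)
    also have "\<dots> = (\<Prod>a\<in>B. z - L (star \<sigma> a) w)"
      by (rule prod.reindex_bij_betw[OF bij, symmetric])
    also have "\<dots> = (\<Prod>a\<in>B. z - cnj (L a (\<sigma> w)))"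
      using star_eq[OF refl _ w] BA by (intro prod.cong) auto
    also have "\<dots> = poly (map_poly cnj (g (\<sigma> w))) z"
      by (simp add: g_def poly_prod)
    finally show "poly (h w) z = poly (map_poly cnj (g (\<sigma> w))) z" .
  qed
  \<comment> \<open>The cofactor \<open>h\<close> is the conjugate of \<open>g\<close> under both
    reflections, and these differ by the translation by 2 pi i. So \<open>g\<close> has this period
    and descends to a function of t.\<close>
  have g_shift: "g (w + 2 * complex_of_real pi * \<i>) = g w" if "w \<in> U" for w
  proof -
    have "cnj w \<in> U" using that by (simp add: U_def)
    then have "map_poly cnj (g (\<sigma>1 (cnj w))) = map_poly cnj (g (\<sigma>2 (cnj w)))"
      using h_eq by metis
    then have "map_poly cnj (map_poly cnj (g w)) =
        map_poly cnj (map_poly cnj (g (w + 2 * complex_of_real pi * \<i>)))"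
      by (simp add: \<sigma>1_def \<sigma>2_def)
    then show ?thesis by (simp add: map_poly_map_poly o_def)
  qed
  have g_exp: "g w = g w'" if "w \<in> U" "w' \<in> U" "exp w = exp w'" for w w'
  proof -
    have shift: "g (w + complex_of_real (real n) * (2 * complex_of_real pi * \<i>)) = g w" if "w \<in> U" for n w
    proof (induction n)
      case (Suc n)
      let ?w = "w + complex_of_real (real n) * (2 * complex_of_real pi * \<i>)"
      have "?w \<in> U" using that by (simp add: U_def)
      then have "g (?w + 2 * complex_of_real pi * \<i>) = g ?w" by (rule g_shift)
      then show ?case using Suc by (simp add: algebra_simps)
    qed simp
    obtain n :: int where n: "w = w' + (of_int (2 * n) * pi) * \<i>" using \<open>exp w = exp w'\<close> exp_eq by blast
    show ?thesis
    proof (cases "n \<ge> 0")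
      case True
      then have "w = w' + complex_of_real (real (nat n)) * (2 * complex_of_real pi * \<i>)" by (simp add: n)
      then show ?thesis using shift[OF \<open>w' \<in> U\<close>] by metis
    next
      case False
      then have "w' = w + complex_of_real (real (nat (- n))) * (2 * complex_of_real pi * \<i>)" by (simp add: n)
      then show ?thesis using shift[OF \<open>w \<in> U\<close>] by metis
    qed
  qed
  have LnU: "Ln t \<in> U" if "t \<noteq> 0" "norm t < r" for t
    using that r by (simp add: U_def)
  define H where "H k t = coeff (g (Ln t)) k" for k t
  have Lhol: "L a holomorphic_on U" if "a \<in> B" for a
    using holomorphic_branch[OF w0] that BA by (auto simp: L_def A_def)
  have Ghol: "(\<lambda>w. coeff (g w) k) holomorphic_on U" for k
    unfolding g_def using BA(2) Lhol by (rule holomorphic_on_coeff_prod_linear)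
  have Hhol: "H k holomorphic_on ball 0 r - {0}" for k
    unfolding holomorphic_on_def
  proof
    fix t0 :: complex assume t0: "t0 \<in> ball 0 r - {0}"
    \<comment> \<open>\<open>Ln\<close> jumps across the negative axis. Near \<open>t0\<close> it is
      replaced by the logarithm \<open>Ln (t / t0) + Ln t0\<close>, holomorphic on \<open>V\<close>;
      by \<open>g_exp\<close> both give the same \<open>g\<close>.\<close>
    define V where "V = (ball 0 r - {0}) \<inter> (\<lambda>t. t / t0) -` (- \<real>\<^sub>\<le>\<^sub>0)"
    have "open V" unfolding V_def using t0
      by (intro open_Int open_Diff continuous_open_vimage continuous_intros) (auto simp: open_Compl)
    have "t0 \<in> V" using t0 by (simp add: V_def)
    let ?\<phi> = "\<lambda>t. Ln (t / t0) + Ln t0"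
    have \<phi>U: "?\<phi> t \<in> U" and \<phi>exp: "exp (?\<phi> t) = t" if "t \<in> V" for t
    proof -
      have "t \<noteq> 0" "t0 \<noteq> 0" "norm t < r" using that t0 by (auto simp: V_def)
      then show "exp (?\<phi> t) = t" by (simp add: exp_add)
      show "?\<phi> t \<in> U" using \<open>t \<noteq> 0\<close> \<open>t0 \<noteq> 0\<close> \<open>norm t < r\<close> r
        by (simp add: U_def norm_divide ln_div)
    qed
    have "?\<phi> holomorphic_on V" using t0 by (intro holomorphic_intros) (auto simp: V_def)
    then have "((\<lambda>w. coeff (g w) k) \<circ> ?\<phi>) holomorphic_on V"
      using Ghol \<phi>U by (intro holomorphic_on_compose_gen[of _ _ _ U]) auto
    moreover have "((\<lambda>w. coeff (g w) k) \<circ> ?\<phi>) t = H k t" if "t \<in> V" for t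
    proof -
      have "t \<noteq> 0" "norm t < r" using that by (auto simp: V_def)
      then have "g (?\<phi> t) = g (Ln t)" using \<phi>U[OF that] \<phi>exp[OF that] LnU by (intro g_exp) auto
      then show ?thesis by (simp add: H_def)
    qed
    ultimately have "H k holomorphic_on V" by (rule holomorphic_transform)
    then have "H k field_differentiable at t0"
      using \<open>open V\<close> \<open>t0 \<in> V\<close> holomorphic_on_imp_differentiable_at by blast
    then show "H k field_differentiable at t0 within ball 0 r - {0}"
      by (rule field_differentiable_at_within)
  qed
  obtain C where C: "\<forall>t\<in>cball 0 r. \<forall>j. norm (coeff (specialize p t) j) \<le> C"
    using bounded_coeff_specialize by blast
  have bnd: "norm (L a w) \<le> 1 + C * real m" if "a \<in> B" "w \<in> U" for a w
  proof -
    have "L a w \<in> roots w" using branch(2)[OF w0] that BA by (auto simp: A_def L_def)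
    then have "poly (F w) (L a w) = 0" by (simp add: roots_def)
    then have "norm (L a w) \<le> 1 + C * real (degree (F w))"
      using monic[OF that(2)] C expU[OF that(2)] by (intro monic_root_bound) (auto simp: F_def less_imp_le)
    then show ?thesis using deg[OF that(2)] by simp
  qed
  have "\<exists>C. \<forall>w\<in>U. \<forall>j. norm (coeff (g w) j) \<le> C"
    unfolding g_def by (rule bounded_coeff_prod_linear[OF BA(2) bnd])
  then obtain C' where C': "\<And>w j. w \<in> U \<Longrightarrow> norm (coeff (g w) j) \<le> C'" by blast
  \<comment> \<open>The roots are bounded, hence so are the coefficients of \<open>g\<close>, and
    Riemann's theorem removes the singularity at 0. Ramification of single roots there is no
    obstacle.\<close>
  have "\<exists>f. f holomorphic_on ball 0 r \<and> (\<forall>t\<in>ball 0 r - {0}. f t = H k t)" for k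
  proof -
    have "eventually (\<lambda>t. t \<in> ball 0 r - {0}) (at 0)"
      using r by (intro eventually_at_in_open) auto
    then have "eventually (\<lambda>t. norm (H k t) \<le> C') (at 0)"
      by eventually_elim (auto simp: H_def intro!: C' LnU)
    then show ?thesis using holomorphic_on_extend_bounded[OF Hhol[of k]] r by auto
  qed
  then obtain f where f: "\<And>k. f k holomorphic_on ball 0 r" "\<And>k t. t \<in> ball 0 r - {0} \<Longrightarrow> f k t = H k t"
    by metis
  have degg: "degree (g w) \<le> m div 2" for w
  proof -
    have "card B = card (A - B)"
      using bij_star[OF \<sigma>1] by (auto intro: bij_betw_same_card)
    then have "2 * card B = card A"
      using card_Diff_subset[OF BA(2,1)] card_mono[OF finA BA(1)] by simp
    moreover have "degree (g w) = card B" unfolding g_def by (simp add: degree_prod_eq_sum_degree)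
    ultimately show ?thesis using card_roots[OF w0] by (simp add: A_def)
  qed
  show ?thesis
  proof (intro exI[of _ "\<lambda>k. if k \<le> m div 2 then f k else (\<lambda>_. 0)"] conjI allI impI)
    show "(if k \<le> m div 2 then f k else (\<lambda>_. 0)) holomorphic_on ball 0 r" for k using f by simp
    show "(if k \<le> m div 2 then f k else (\<lambda>_. 0)) t = 0" if "k > m div 2" for k t using that by simp
    fix t :: real and j assume t: "t \<noteq> 0" "\<bar>t\<bar> < r"
    define w where "w = Ln (complex_of_real t)"
    have w: "w \<in> U" using LnU t by (simp add: w_def)
    have expw: "exp w = complex_of_real t" using t by (simp add: w_def)
    \<comment> \<open>The principal logarithm of a nonzero real number has imaginary part 0 or pi,
      so one of the two reflections fixes it and \<open>h w\<close> is the conjugate of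
      \<open>g w\<close> itself.\<close>
    have "\<sigma>1 w = w \<or> \<sigma>2 w = w"
    proof (cases "t > 0")
      case True
      then have "w = complex_of_real (ln t)" by (simp add: w_def Ln_of_real)
      then show ?thesis by (simp add: \<sigma>1_def)
    next
      case False
      then have "w = complex_of_real (ln (- t)) + pi * \<i>"
        using t Ln_minus[of "complex_of_real (- t)"] Ln_of_real[of "- t"] by (simp add: w_def)
      then show ?thesis by (simp add: \<sigma>2_def)
    qed
    then have hw: "h w = map_poly cnj (g w)" using h_eq[OF _ w] by metis
    have fg: "(if k \<le> m div 2 then f k else (\<lambda>_. 0)) (complex_of_real t) = coeff (g w) k" for k
      using f(2)[of "complex_of_real t" k] t degg[of w] by (auto simp: H_def w_def coeff_eq_0)
    have "complex_of_real (poly (coeff p j) t) = coeff (F w) j"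
      by (simp add: F_def expw coeff_specialize)
    also have "\<dots> = (\<Sum>i\<le>j. coeff (g w) i * cnj (coeff (g w) (j - i)))"
      unfolding gh[OF w] hw coeff_mult by (simp add: coeff_map_poly)
    finally show "complex_of_real (poly (coeff p j) t) =
      (\<Sum>i\<le>j. (if i \<le> m div 2 then f i else (\<lambda>_. 0)) (complex_of_real t) *
         cnj ((if j - i \<le> m div 2 then f (j - i) else (\<lambda>_. 0)) (complex_of_real t)))"
      unfolding fg .
  qed
qed

section \<open>Local certificates\<close>

abbreviation even_powers :: "nat \<Rightarrow> bipoly" where
  "even_powers n \<equiv> (\<Sum>i\<le>n. bY ^ (2 * i))"

lemma degree_bY_power [simp]: "degree (bY ^ k) = k"
  by (simp add: degree_power_eq)

lemma bY_power_eq_monom: "bY ^ k = monom 1 k"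
  by (simp add: monom_altdef)

lemma coeff_bY_power: "coeff (bY ^ k) j = (if j = k then 1 else 0)"
  unfolding bY_power_eq_monom by simp

lemma degree_even_powers_le: "degree (even_powers n) \<le> 2 * n"
  by (rule degree_sum_le) auto

lemma coeff_even_powers_top: "coeff (even_powers n) (2 * n) = 1"
  by (simp add: coeff_sum coeff_bY_power)

lemma bounded_poly_specialize:
  "\<exists>C\<ge>0. \<forall>t y. norm t \<le> r \<longrightarrow> norm y \<le> R \<longrightarrow> norm (poly (specialize W t) y) \<le> C"
proof -
  obtain C where C: "\<forall>t\<in>cball 0 r. \<forall>j. norm (coeff (specialize W t) j) \<le> C"
    using bounded_coeff_specialize by blast
  have "norm (poly (specialize W t) y) \<le> (\<Sum>j\<le>degree W. \<bar>C\<bar> * \<bar>R\<bar> ^ j)"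
    if "norm t \<le> r" "norm y \<le> R" for t y
    unfolding poly_specialize
  proof (rule sum_norm_le)
    fix j
    have "norm (coeff (specialize W t) j) \<le> C" using C that by simp
    then have "norm (poly (of_real_poly (coeff W j)) t) \<le> \<bar>C\<bar>" by (simp add: coeff_specialize)
    moreover have "norm y ^ j \<le> \<bar>R\<bar> ^ j" using that by (intro power_mono) auto
    ultimately show "norm (poly (of_real_poly (coeff W j)) t * y ^ j) \<le> \<bar>C\<bar> * \<bar>R\<bar> ^ j"
      unfolding norm_mult norm_power by (intro mult_mono) auto
  qed
  then show ?thesis by (intro exI[of _ "\<Sum>j\<le>degree W. \<bar>C\<bar> * \<bar>R\<bar> ^ j"]) (auto intro: sum_nonneg)
qed

lemma bounded_evalp: "\<exists>C\<ge>0. \<forall>t y. \<bar>t\<bar> \<le> r \<longrightarrow> \<bar>y\<bar> \<le> R \<longrightarrow> \<bar>evalp W (t, y)\<bar> \<le> C"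
proof -
  obtain C where C: "C \<ge> 0"
    "\<And>t y. norm t \<le> r \<Longrightarrow> norm y \<le> R \<Longrightarrow> norm (poly (specialize W t) y) \<le> C"
    using bounded_poly_specialize by blast
  have "\<bar>evalp W (t, y)\<bar> \<le> C" if "\<bar>t\<bar> \<le> r" "\<bar>y\<bar> \<le> R" for t y
    using C(2)[of "complex_of_real t" "complex_of_real y"] that by (simp add: poly_specialize_of_real)
  then show ?thesis using C(1) by blast
qed

lemma monic_large_lower_bound:
  assumes "lead_coeff h = 1" "degree h = 2 * n" "n > 0"
  shows "\<exists>R\<ge>1. \<forall>t y. \<bar>t\<bar> \<le> r \<longrightarrow> \<bar>y\<bar> \<ge> R \<longrightarrow> evalp h (t, y) \<ge> y ^ (2 * n) / 2"
proof -
  obtain C where C: "\<forall>t\<in>cball 0 r. \<forall>j. norm (coeff (specialize h t) j) \<le> C"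
    using bounded_coeff_specialize by blast
  have coeff_le: "\<bar>poly (coeff h j) t\<bar> \<le> \<bar>C\<bar>" if "\<bar>t\<bar> \<le> r" for t j
  proof -
    have "norm (coeff (specialize h (complex_of_real t)) j) \<le> C" using C that by simp
    then show ?thesis by (simp add: coeff_specialize)
  qed
  \<comment> \<open>The 2n lower terms add up to at most 2n |C| |y|^(2n-1), which is at most half of
    y^(2n) once |y| is at least 4n |C|.\<close>
  define R where "R = 1 + 4 * real n * \<bar>C\<bar>"
  have "evalp h (t, y) \<ge> y ^ (2 * n) / 2" if t: "\<bar>t\<bar> \<le> r" and y: "\<bar>y\<bar> \<ge> R" for t y
  proof -
    have y1: "\<bar>y\<bar> \<ge> 1" using y by (simp add: R_def) (smt (verit) mult_nonneg_nonneg of_nat_0_le_iff)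
    have "evalp h (t, y) = y ^ (2 * n) + (\<Sum>j<2 * n. poly (coeff h j) t * y ^ j)"
      using assms(1,2) by (simp add: evalp_sum_coeff[OF order_refl] lessThan_Suc_atMost[symmetric])
    moreover have "norm (\<Sum>j<2 * n. poly (coeff h j) t * y ^ j) \<le> (\<Sum>j<2 * n. \<bar>C\<bar> * \<bar>y\<bar> ^ (2 * n - 1))"
    proof (rule sum_norm_le)
      fix j assume "j \<in> {..<2 * n}"
      then have "\<bar>y\<bar> ^ j \<le> \<bar>y\<bar> ^ (2 * n - 1)" using y1 by (intro power_increasing) auto
      then show "norm (poly (coeff h j) t * y ^ j) \<le> \<bar>C\<bar> * \<bar>y\<bar> ^ (2 * n - 1)"
        unfolding real_norm_def abs_mult power_abs using coeff_le[OF t] by (intro mult_mono) auto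
    qed
    moreover have "(\<Sum>j<2 * n. \<bar>C\<bar> * \<bar>y\<bar> ^ (2 * n - 1)) = (4 * real n * \<bar>C\<bar>) * \<bar>y\<bar> ^ (2 * n - 1) / 2" by simp
    moreover have "(4 * real n * \<bar>C\<bar>) * \<bar>y\<bar> ^ (2 * n - 1) \<le> \<bar>y\<bar> * \<bar>y\<bar> ^ (2 * n - 1)"
      using y by (intro mult_right_mono) (auto simp: R_def)
    moreover have "\<bar>y\<bar> * \<bar>y\<bar> ^ (2 * n - 1) = y ^ (2 * n)"
      using assms(3) by (metis abs_ge_zero even_mult_iff even_numeral mult_pos_pos power_even_abs
          power_eq_if zero_less_numeral less_numeral_extra(3))
    ultimately show ?thesis unfolding real_norm_def by linarith
  qed
  moreover have "R \<ge> 1" by (simp add: R_def)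
  ultimately show ?thesis by blast
qed

text \<open>At an interior minimum in \<open>y\<close> the Bezout identity bounds \<open>h\<close> below by \<open>\<bar>d\<bar> / \<bar>A\<bar>\<close>.\<close>

lemma monic_nonneg_lower_bound:
  assumes h: "lead_coeff h = 1" "degree h = 2 * n" "n > 0" "\<And>z. evalp h z \<ge> 0"
    and bez: "A * h + B * pderiv h = [:d:]"
  shows "\<exists>c>0. \<forall>t y. \<bar>t\<bar> \<le> r \<longrightarrow> c * (poly d t)\<^sup>2 * evalp (even_powers n) (t, y) \<le> evalp h (t, y)"
proof -
  obtain R where R: "R \<ge> 1" "\<And>t y. \<bar>t\<bar> \<le> r \<Longrightarrow> \<bar>y\<bar> \<ge> R \<Longrightarrow> evalp h (t, y) \<ge> y ^ (2 * n) / 2"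
    using monic_large_lower_bound[OF h(1-3)] by blast
  obtain CA where CA: "CA \<ge> 0" "\<And>t y. \<bar>t\<bar> \<le> r \<Longrightarrow> \<bar>y\<bar> \<le> R \<Longrightarrow> \<bar>evalp A (t, y)\<bar> \<le> CA"
    using bounded_evalp by blast
  obtain CE where CE: "CE \<ge> 0" "\<And>t y. \<bar>t\<bar> \<le> r \<Longrightarrow> \<bar>y\<bar> \<le> R \<Longrightarrow> \<bar>evalp (even_powers n) (t, y)\<bar> \<le> CE"
    using bounded_evalp by blast
  obtain D where D: "D \<ge> 0" "\<And>t y. \<bar>t\<bar> \<le> r \<Longrightarrow> \<bar>y\<bar> \<le> R \<Longrightarrow> \<bar>evalp [:d:] (t, y)\<bar> \<le> D"
    using bounded_evalp by blast
  have D': "\<bar>poly d t\<bar> \<le> D" if "\<bar>t\<bar> \<le> r" for t using D(2)[of t 0] that R by simp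
  have one_le: "1 \<le> y ^ (2 * n)" if "\<bar>y\<bar> \<ge> R" for y :: real
    using R(1) that one_le_power[of "\<bar>y\<bar>" "2 * n"] by (simp add: power_even_abs)
  \<comment> \<open>Covers both positions of the minimum: at |y| = R the value of \<open>h\<close>
    is at least 1/2 while d^2 is at most D^2; in the interior d^2 is at most D |d|, hence at most D
    CA h.\<close>
  define K where "K = (2 * D + 1) * (D + 1) * (CA + 1)"
  have K: "K > 0" using D(1) CA(1) by (simp add: K_def)
  have lower: "(poly d t)\<^sup>2 \<le> K * evalp h (t, y)"
    if t: "\<bar>t\<bar> \<le> r" and y: "\<bar>y\<bar> \<le> R" for t y
  proof -
    have "continuous_on {- R..R} (\<lambda>y. evalp h (t, y))" by (intro continuous_intros)
    then obtain y0 where y0: "y0 \<in> {- R..R}" "\<And>y. y \<in> {- R..R} \<Longrightarrow> evalp h (t, y0) \<le> evalp h (t, y)"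
      using continuous_attains_inf[of "{- R..R}" "\<lambda>y. evalp h (t, y)"] R(1) by auto
    have d2: "(poly d t)\<^sup>2 \<le> D * \<bar>poly d t\<bar>"
      using mult_right_mono[OF D'[OF t], of "\<bar>poly d t\<bar>"] by (simp add: power2_eq_square)
    also have "\<dots> \<le> D * D" using D'[OF t] D(1) by (rule mult_left_mono)
    finally have d2': "(poly d t)\<^sup>2 \<le> D * D" .
    have "(poly d t)\<^sup>2 \<le> K * evalp h (t, y0)"
    proof (cases "\<bar>y0\<bar> = R")
      case True
      then have "evalp h (t, y0) \<ge> 1 / 2" using R(2)[OF t, of y0] one_le[of y0] by simp
      have "(poly d t)\<^sup>2 \<le> (2 * D + 1) * (D + 1) * 1 * (1 / 2)" using d2' D(1) by (simp add: algebra_simps)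
      also have "\<dots> \<le> (2 * D + 1) * (D + 1) * (CA + 1) * evalp h (t, y0)"
        using D(1) CA(1) \<open>evalp h (t, y0) \<ge> 1 / 2\<close> by (intro mult_mono) auto
      finally show ?thesis unfolding K_def .
    next
      case False
      define q where "q = map_poly (\<lambda>c. poly c t) h"
      have hq: "evalp h (t, y) = poly q y" for y by (simp add: q_def evalp_map_poly)
      have "coeff (map_poly (\<lambda>c. poly c t) (pderiv h)) j = coeff (pderiv q) j" for j
        by (simp add: q_def coeff_map_poly coeff_pderiv)
      then have hq': "evalp (pderiv h) (t, y) = poly (pderiv q) y" for y
        unfolding evalp_map_poly by (metis poly_eqI)
      have int: "- R < y0" "y0 < R" using y0(1) False by auto
      have "poly (pderiv q) y0 = 0"
      proof (rule DERIV_local_min[OF poly_DERIV])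
        show "min (y0 + R) (R - y0) > 0" using int by simp
        show "\<forall>y. \<bar>y0 - y\<bar> < min (y0 + R) (R - y0) \<longrightarrow> poly q y0 \<le> poly q y"
          using y0(2) by (auto simp: hq[symmetric] abs_less_iff)
      qed
      then have "evalp A (t, y0) * evalp h (t, y0) = poly d t"
        using arg_cong[OF bez, of "\<lambda>P. evalp P (t, y0)"] by (simp add: hq')
      then have "\<bar>poly d t\<bar> \<le> CA * evalp h (t, y0)"
        using CA(2)[OF t, of y0] y0(1) h(4)[of "(t, y0)"]
        by (metis abs_le_iff abs_mult abs_of_nonneg atLeastAtMost_iff minus_le_iff mult_right_mono)
      then have "(poly d t)\<^sup>2 \<le> D * (CA * evalp h (t, y0))"
        using d2 D(1) by (meson mult_left_mono order_trans)
      also have "\<dots> = D * CA * evalp h (t, y0)" by simp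
      also have "\<dots> \<le> ((2 * D + 1) * (D + 1)) * (CA + 1) * evalp h (t, y0)"
        using D(1) CA(1) h(4) by (intro mult_mono) (auto simp: algebra_simps)
      finally show ?thesis unfolding K_def .
    qed
    also have "\<dots> \<le> K * evalp h (t, y)"
      using y0(2)[of y] y K by (intro mult_left_mono) (auto simp: abs_le_iff)
    finally show ?thesis .
  qed
  \<comment> \<open>The first summand serves |y| \<le> R, where the even powers are bounded by
    \<open>CE\<close>. The second serves larger |y|, where their sum is at most (n + 1) y^(2n) and
    y^(2n) at most 2 h.\<close>
  define c where "c = 1 / (K * (CE + 1) + 2 * (D\<^sup>2 + 1) * (real n + 1))"
  have den: "K * (CE + 1) + 2 * (D\<^sup>2 + 1) * (real n + 1) > 0"
  proof (rule add_pos_pos)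
    have "D\<^sup>2 + 1 > 0" by (rule add_nonneg_pos) auto
    then show "2 * (D\<^sup>2 + 1) * (real n + 1) > 0" by simp
    show "K * (CE + 1) > 0" using K CE(1) by simp
  qed
  have "c * (poly d t)\<^sup>2 * evalp (even_powers n) (t, y) \<le> evalp h (t, y)" if t: "\<bar>t\<bar> \<le> r" for t y
  proof -
    let ?E = "evalp (even_powers n) (t, y)"
    have E: "?E = (\<Sum>i\<le>n. y ^ (2 * i))" by simp
    have E0: "?E \<ge> 0" unfolding E by (intro sum_nonneg) auto
    have "(poly d t)\<^sup>2 * ?E \<le> (K * (CE + 1) + 2 * (D\<^sup>2 + 1) * (real n + 1)) * evalp h (t, y)"
    proof (cases "\<bar>y\<bar> \<le> R")
      case True
      have "(poly d t)\<^sup>2 * ?E \<le> (K * evalp h (t, y)) * (CE + 1)"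
        using lower[OF t True] CE(2)[OF t True] K E0 h(4)
        by (intro mult_mono) (auto simp: abs_le_iff)
      also have "\<dots> \<le> (K * (CE + 1) + 2 * (D\<^sup>2 + 1) * (real n + 1)) * evalp h (t, y)"
        using h(4)[of "(t, y)"] by (simp add: algebra_simps)
      finally show ?thesis .
    next
      case False
      have "?E \<le> (\<Sum>i\<le>n. y ^ (2 * n))" unfolding E
      proof (rule sum_mono)
        fix i assume "i \<in> {..n}"
        then have "\<bar>y\<bar> ^ (2 * i) \<le> \<bar>y\<bar> ^ (2 * n)" using R(1) False by (intro power_increasing) auto
        then show "y ^ (2 * i) \<le> y ^ (2 * n)" by (simp add: power_even_abs)
      qed
      also have "\<dots> = (real n + 1) * y ^ (2 * n)" by simp
      also have "\<dots> \<le> (real n + 1) * (2 * evalp h (t, y))"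
        using R(2)[OF t, of y] False by (intro mult_left_mono) auto
      finally have "?E \<le> (real n + 1) * (2 * evalp h (t, y))" .
      moreover have "(poly d t)\<^sup>2 \<le> D\<^sup>2 + 1"
        using power_mono[OF D'[OF t], of 2] by simp
      ultimately have "(poly d t)\<^sup>2 * ?E \<le> (D\<^sup>2 + 1) * ((real n + 1) * (2 * evalp h (t, y)))"
        using E0 by (intro mult_mono) auto
      also have "\<dots> = (2 * (D\<^sup>2 + 1) * (real n + 1)) * evalp h (t, y)" by simp
      also have "\<dots> \<le> (K * (CE + 1) + 2 * (D\<^sup>2 + 1) * (real n + 1)) * evalp h (t, y)"
        using h(4)[of "(t, y)"] K CE(1) by (intro mult_right_mono) auto
      finally show ?thesis .
    qed
    then show ?thesis using den by (simp add: c_def pos_divide_le_eq mult.commute mult.left_commute)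
  qed
  moreover have "c > 0" using den by (simp add: c_def)
  ultimately show ?thesis by blast
qed

section \<open>Absorption of small perturbations by even powers of y\<close>

text \<open>An odd power is a difference of squares, y = ((1 + y)^2 - (1 - y)^2) / 4. Half of
  \<open>s\<close> times the even powers goes with the even coefficients of the perturbation; the
  other half is spread over the squares of y^i (1 + y) and y^i (1 - y), which yields s/4 (y^(2i) +
  y^(2i+2)) and misses only s/4 (1 + y^(2n)) at the two ends.\<close>

lemma even_powers_absorb_real:
  fixes e :: "nat \<Rightarrow> real" and s y :: real
  shows "s * (\<Sum>i\<le>n. y ^ (2 * i)) + (\<Sum>j\<le>2 * n. e j * y ^ j) =
    (\<Sum>i\<le>n. (s / 2 + e (2 * i)) * (y ^ i)\<^sup>2) +
    (\<Sum>i<n. (s / 8 + e (2 * i + 1) / 4) * (y ^ i * (1 + y))\<^sup>2 +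
      (s / 8 - e (2 * i + 1) / 4) * (y ^ i * (1 - y))\<^sup>2) + s / 4 * (1 + (y ^ n)\<^sup>2)"
proof (induction n)
  case (Suc n)
  have two: "2 * Suc n = Suc (Suc (2 * n))" by simp
  define a where "a = y ^ n"
  have a: "y ^ (2 * n) = a * a" "y ^ (n * 2) = a * a" "y ^ n = a"
    by (simp_all add: a_def power_add[symmetric] mult_2 mult_2_right)
  define u v where "u = e (Suc (2 * n))" and "v = e (Suc (Suc (2 * n)))"
  have step: "s * y ^ Suc (Suc (2 * n)) + (u * y ^ Suc (2 * n) + v * y ^ Suc (Suc (2 * n))) =
    (s / 2 + v) * (y ^ Suc n)\<^sup>2 + ((s / 8 + u / 4) * (y ^ n * (1 + y))\<^sup>2 + (s / 8 - u / 4) * (y ^ n * (1 - y))\<^sup>2)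
     + s / 4 * (1 + (y ^ Suc n)\<^sup>2) - s / 4 * (1 + (y ^ n)\<^sup>2)"
  proof -
    define s' u' where "s' = s / 8" and "u' = u / 4"
    then have "s = 8 * s'" "u = 4 * u'" by simp_all
    then show ?thesis by (simp add: a power2_eq_square algebra_simps)
  qed
  have combine: "s * S + T = P + Q + w \<Longrightarrow> s * X + (Y + Y') = p + q + w' - w \<Longrightarrow>
      s * (S + X) + (T + Y + Y') = (P + p) + (Q + q) + w'" for S T P Q X Y Y' p q w w' :: real
  proof -
    assume *: "s * S + T = P + Q + w" "s * X + (Y + Y') = p + q + w' - w"
    have "s * (S + X) + (T + Y + Y') = (s * S + T) + (s * X + (Y + Y'))"
      by (simp only: distrib_left add.assoc add.commute add.left_commute)
    also have "\<dots> = (P + p) + (Q + q) + w'" unfolding * by simp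
    finally show ?thesis .
  qed
  have odd: "2 * n + 1 = Suc (2 * n)" by simp
  show ?case
    unfolding two sum.atMost_Suc sum.lessThan_Suc odd
    by (rule combine[OF Suc.IH step[unfolded u_def v_def]])
next
  case 0
  show ?case by simp
qed

lemma even_powers_absorb:
  assumes "degree e \<le> 2 * n"
  shows "[:s:] * even_powers n + e =
    (\<Sum>i\<le>n. [:smult (1 / 2) s + coeff e (2 * i):] * (bY ^ i)\<^sup>2) +
    (\<Sum>i<n. [:smult (1 / 8) s + smult (1 / 4) (coeff e (2 * i + 1)):] * (bY ^ i * (1 + bY))\<^sup>2 +
      [:smult (1 / 8) s - smult (1 / 4) (coeff e (2 * i + 1)):] * (bY ^ i * (1 - bY))\<^sup>2) +
    [:smult (1 / 4) s:] * (1 + (bY ^ n)\<^sup>2)" (is "?L = ?R")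
proof (rule evalp_eqI)
  fix z :: "real \<times> real"
  obtain x y where z: "z = (x, y)" by (cases z)
  show "evalp ?L z = evalp ?R z"
    using even_powers_absorb_real[of "poly s x" y n "\<lambda>j. poly (coeff e j) x"]
    unfolding z evalp_add evalp_mult evalp_sum evalp_power evalp_const_poly evalp_sum_coeff[OF assms] fst_conv
    by (simp add: evalp_sum_coeff[OF assms])
qed

lemma poly_nonneg_punctured:
  fixes p :: "real poly"
  assumes "\<delta> > 0" "\<And>x. x \<noteq> x0 \<Longrightarrow> \<bar>x - x0\<bar> < \<delta> \<Longrightarrow> poly p x \<ge> 0" "\<bar>x - x0\<bar> < \<delta>"
  shows "poly p x \<ge> 0"
proof (cases "x = x0")
  case True
  have "(poly p \<longlongrightarrow> poly p x0) (at x0)" using isCont_def poly_isCont by blast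
  moreover have "eventually (\<lambda>x. poly p x \<ge> 0) (at x0)"
    unfolding eventually_at using assms by (intro exI[of _ \<delta>]) (auto simp: dist_real_def)
  ultimately have "poly p x0 \<ge> 0" by (rule tendsto_lowerbound) simp
  then show ?thesis using True by simp
qed (use assms in auto)

lemma strip_shrink:
  assumes "\<epsilon>' \<le> \<epsilon>" "P \<in> preordering (strip (x0 - \<epsilon>) (x0 + \<epsilon>))"
  shows "P \<in> preordering (strip (x0 - \<epsilon>') (x0 + \<epsilon>'))"
proof -
  have "strip (x0 - \<epsilon>) (x0 + \<epsilon>) \<subseteq> preordering (strip (x0 - \<epsilon>') (x0 + \<epsilon>'))"
    using assms(1) by (intro strip_subset_preordering) auto
  then show ?thesis using preordering_subset assms(2) by blast
qed

text \<open>With coefficients of \<open>e\<close> at most s/2 in modulus, the factors s/2 + e and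
  s/8 \<plusminus> e/4 of the preceding identity are nonnegative near \<open>x0\<close>, so each
  lies in the preordering of a small strip; they are finitely many.\<close>

lemma absorb_in_preordering:
  assumes deg: "degree e \<le> 2 * n" and \<delta>: "\<delta> > 0"
    and le: "\<And>x j. x \<noteq> x0 \<Longrightarrow> \<bar>x - x0\<bar> < \<delta> \<Longrightarrow> \<bar>poly (coeff e j) x\<bar> \<le> poly s x / 2"
  shows "\<exists>\<epsilon>>0. [:s:] * even_powers n + e \<in> preordering (strip (x0 - \<epsilon>) (x0 + \<epsilon>))"
proof -
  define X where "X = insert (smult (1 / 4) s) ((\<lambda>j. smult (1 / 2) s + coeff e j) ` {..2 * n} \<union>
    (\<lambda>j. smult (1 / 8) s + smult (1 / 4) (coeff e j)) ` {..2 * n} \<union>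
    (\<lambda>j. smult (1 / 8) s - smult (1 / 4) (coeff e j)) ` {..2 * n})"
  have finX: "finite X" by (simp add: X_def)
  have "\<exists>\<epsilon>>0. [:c:] \<in> preordering (strip (x0 - \<epsilon>) (x0 + \<epsilon>))" if c: "c \<in> X" for c
  proof (rule locally_nonneg_in_preordering[OF \<delta>])
    fix x assume x: "\<bar>x - x0\<bar> < \<delta>"
    show "poly c x \<ge> 0"
    proof (rule poly_nonneg_punctured[OF \<delta> _ x])
      fix x assume "x \<noteq> x0" "\<bar>x - x0\<bar> < \<delta>"
      then have *: "\<bar>poly (coeff e j) x\<bar> \<le> poly s x / 2" for j by (rule le)
      have **: "- (poly s x / 2) \<le> poly (coeff e j) x" "poly (coeff e j) x \<le> poly s x / 2" for j
        using *[of j] by linarith+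
      have s0: "poly s x \<ge> 0" using *[of 0] by linarith
      from c consider "c = smult (1 / 4) s" | j where "c = smult (1 / 2) s + coeff e j"
        | j where "c = smult (1 / 8) s + smult (1 / 4) (coeff e j)"
        | j where "c = smult (1 / 8) s - smult (1 / 4) (coeff e j)" by (auto simp: X_def)
      then show "poly c x \<ge> 0"
      proof cases
        case (2 j)
        then show ?thesis using **[of j] by simp
      next
        case (3 j)
        then show ?thesis using **[of j] by simp
      next
        case (4 j)
        then show ?thesis using **[of j] by simp
      qed (use s0 in simp)
    qed
  qed
  then obtain \<eta> where \<eta>: "\<And>c. c \<in> X \<Longrightarrow> \<eta> c > 0 \<and> [:c:] \<in> preordering (strip (x0 - \<eta> c) (x0 + \<eta> c))"
    by metis
  define \<epsilon> where "\<epsilon> = Min (\<eta> ` X)"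
  have Xne: "X \<noteq> {}" by (simp add: X_def)
  have "\<epsilon> > 0" unfolding \<epsilon>_def using finX Xne \<eta> by (subst Min_gr_iff) auto
  let ?T = "preordering (strip (x0 - \<epsilon>) (x0 + \<epsilon>))"
  have inT: "[:c:] \<in> ?T" if "c \<in> X" for c
  proof (rule strip_shrink)
    show "\<epsilon> \<le> \<eta> c" unfolding \<epsilon>_def using finX that by (intro Min_le) auto
  qed (use \<eta> that in blast)
  have X1: "smult (1 / 4) s \<in> X" and X2: "smult (1 / 2) s + coeff e j \<in> X"
    and X3: "smult (1 / 8) s + smult (1 / 4) (coeff e j) \<in> X"
    and X4: "smult (1 / 8) s - smult (1 / 4) (coeff e j) \<in> X" if "j \<le> 2 * n" for j
    using that by (auto simp: X_def)
  have "[:s:] * even_powers n + e \<in> ?T"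
    unfolding even_powers_absorb[OF deg]
    by (intro preordering.add preordering_sum preordering.mult preordering.square inT X1[of 0] X2 X3 X4
        preordering_1) auto
  then show ?thesis using \<open>\<epsilon> > 0\<close> by blast
qed

lemma specialize_const_poly [simp]: "specialize [:c:] t = [:poly (of_real_poly c) t:]"
  by (simp add: specialize_def map_poly_pCons)

lemma specialize_1 [simp]: "specialize 1 t = 1"
  by (simp add: specialize_def)

lemma specialize_pderiv: "specialize (pderiv p) t = pderiv (specialize p t)"
proof (rule poly_eqI)
  have "of_real_poly (of_nat n * q) = of_nat n * of_real_poly q" for n and q :: "real poly"
    by (rule poly_eqI) (simp add: coeff_map_poly of_nat_poly)
  then show "coeff (specialize (pderiv p) t) n = coeff (pderiv (specialize p t)) n" for n
    by (simp only: coeff_specialize coeff_pderiv poly_mult poly_of_nat)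
qed

text \<open>\<open>U\<close> and \<open>V\<close> have as coefficients the real and imaginary parts
  of the Taylor polynomials of the coefficients of the holomorphic factor. On the real axis the
  product of that factor with its conjugate is \<open>p\<close>, and truncation changes it by
  O(|t|^N) in each coefficient.\<close>

lemma local_truncated_squares:
  assumes p: "lead_coeff p = 1" "degree p = 2 * n" "n > 0" and r: "r > 0"
    and sqf: "\<And>t. t \<noteq> 0 \<Longrightarrow> norm t < r \<Longrightarrow> rsquarefree (specialize p t)"
    and noreal: "\<And>t y. t \<noteq> 0 \<Longrightarrow> \<bar>t\<bar> < r \<Longrightarrow> evalp p (t, y) \<noteq> 0"
  shows "\<exists>U V C. degree (p - U\<^sup>2 - V\<^sup>2) \<le> 2 * n \<and>
    (\<forall>t j. t \<noteq> 0 \<longrightarrow> \<bar>t\<bar> < r / 2 \<longrightarrow> \<bar>poly (coeff (p - U\<^sup>2 - V\<^sup>2) j) t\<bar> \<le> C * \<bar>t\<bar> ^ N)"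
proof -
  have two_ne: "(2 :: nat) \<noteq> 0" by simp
  have "\<exists>g. (\<forall>k. g k holomorphic_on ball 0 r) \<and> (\<forall>k>2 * n div 2. \<forall>t. g k t = 0) \<and>
    (\<forall>t j. t \<noteq> 0 \<longrightarrow> \<bar>t\<bar> < r \<longrightarrow> complex_of_real (poly (coeff p j) t)
       = (\<Sum>i\<le>j. g i (of_real t) * cnj (g (j - i) (of_real t))))"
    by (rule local_hermitian_square[OF p(1,2) _ r sqf noreal]) (use p(3) in simp_all)
  then obtain g where g: "\<And>k. g k holomorphic_on ball 0 r" "\<And>k t. k > n \<Longrightarrow> g k t = 0"
    "\<And>t j. t \<noteq> 0 \<Longrightarrow> \<bar>t\<bar> < r \<Longrightarrow> complex_of_real (poly (coeff p j) t)
       = (\<Sum>i\<le>j. g i (of_real t) * cnj (g (j - i) (of_real t)))"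
    unfolding nonzero_mult_div_cancel_left[OF two_ne] by blast
  have "\<exists>c C. \<forall>t. norm t \<le> r / 2 \<longrightarrow> norm (g k t - (\<Sum>i<N. c i * t ^ i)) \<le> C * norm t ^ N" for k
    by (rule holomorphic_taylor_bound[OF g(1) r])
  then obtain c C where c: "\<And>k t. norm t \<le> r / 2 \<Longrightarrow> norm (g k t - (\<Sum>i<N. c k i * t ^ i)) \<le> C k * norm t ^ N"
    by metis
  have "\<exists>C'. \<forall>t. norm t \<le> r / 2 \<longrightarrow> norm (g k t) \<le> C'" for k
    using holomorphic_taylor_bound[OF g(1) r, of k 0] by auto
  then obtain K where K: "\<And>k t. norm t \<le> r / 2 \<Longrightarrow> norm (g k t) \<le> K k" by metis
  define a where "a k = (if k \<le> n then \<Sum>i<N. monom (Re (c k i)) i else 0)" for k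
  define b where "b k = (if k \<le> n then \<Sum>i<N. monom (Im (c k i)) i else 0)" for k
  define G where "G k t = Complex (poly (a k) t) (poly (b k) t)" for k t
  define C1 where "C1 = (\<Sum>k\<le>n. \<bar>C k\<bar>)"
  define K1 where "K1 = (\<Sum>k\<le>n. \<bar>K k\<bar>)"
  have C1: "C1 \<ge> 0" and K1: "K1 \<ge> 0" by (simp_all add: C1_def K1_def sum_nonneg)
  have Gc: "G k t = (\<Sum>i<N. c k i * complex_of_real t ^ i)" if "k \<le> n" for k t
    using that by (simp add: G_def a_def b_def complex_eq_iff poly_sum poly_monom of_real_power[symmetric] del: of_real_power)
  have gG: "norm (g k (of_real t) - G k t) \<le> C1 * \<bar>t\<bar> ^ N" if "\<bar>t\<bar> \<le> r / 2" for k t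
  proof (cases "k \<le> n")
    case True
    have "norm (g k (of_real t) - G k t) \<le> C k * \<bar>t\<bar> ^ N"
      using c[of "complex_of_real t" k] that Gc[OF True] by simp
    also have "C k \<le> C1"
      using member_le_sum[of k "{..n}" "\<lambda>k. \<bar>C k\<bar>"] True by (simp add: C1_def)
    finally show ?thesis by (simp add: mult_right_mono)
  next
    case False
    then have "G k t = 0" by (simp add: G_def a_def b_def complex_eq_iff)
    then show ?thesis using False g(2) C1 by simp
  qed
  have gK: "norm (g k (of_real t)) \<le> K1" if "\<bar>t\<bar> \<le> r / 2" for k t
  proof (cases "k \<le> n")
    case True
    have "norm (g k (of_real t)) \<le> K k" using K that by simp
    also have "K k \<le> K1"
      using member_le_sum[of k "{..n}" "\<lambda>k. \<bar>K k\<bar>"] True by (simp add: K1_def)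
    finally show ?thesis .
  qed (use g(2) K1 in simp)
  define T where "T = (1 + r / 2) ^ N"
  have T: "\<bar>t\<bar> ^ N \<le> T" if "\<bar>t\<bar> \<le> r / 2" for t
    unfolding T_def using that by (intro power_mono) auto
  define C2 where "C2 = real (2 * n + 1) * (C1 * (2 * K1 + C1 * T))"
  define U where "U = (\<Sum>i\<le>n. monom (a i) i)"
  define V where "V = (\<Sum>i\<le>n. monom (b i) i)"
  have coeffs: "coeff U i = a i" "coeff V i = b i" for i
    by (simp_all add: U_def V_def coeff_sum a_def b_def)
  have "degree U \<le> n" "degree V \<le> n"
    by (auto intro!: degree_le simp: coeffs a_def b_def)
  then have "degree (U\<^sup>2) \<le> 2 * n" "degree (V\<^sup>2) \<le> 2 * n"
    using degree_power_le[of U 2] degree_power_le[of V 2] by linarith+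
  then have deg: "degree (p - U\<^sup>2 - V\<^sup>2) \<le> 2 * n" using p(2) by (intro degree_diff_le) auto
  have "\<bar>poly (coeff (p - U\<^sup>2 - V\<^sup>2) j) t\<bar> \<le> C2 * \<bar>t\<bar> ^ N"
    if t: "t \<noteq> 0" "\<bar>t\<bar> < r / 2" for t j
  proof (cases "j \<le> 2 * n")
    case False
    then have "coeff (p - U\<^sup>2 - V\<^sup>2) j = 0" using deg by (intro coeff_eq_0) simp
    moreover have "C2 \<ge> 0" using C1 K1 r by (simp add: C2_def T_def)
    ultimately show ?thesis by simp
  next
    case True
    let ?g = "\<lambda>i. g i (complex_of_real t)" and ?G = "\<lambda>i. G i t"
    have t2: "\<bar>t\<bar> \<le> r / 2" "\<bar>t\<bar> < r" using t r by auto
    have Gre: "Re (?G i * cnj (?G k)) = poly (a i) t * poly (a k) t + poly (b i) t * poly (b k) t" for i k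
      by (simp add: G_def)
    have "poly (coeff (p - U\<^sup>2 - V\<^sup>2) j) t = poly (coeff p j) t
        - (\<Sum>i\<le>j. poly (a i) t * poly (a (j - i)) t + poly (b i) t * poly (b (j - i)) t)"
      by (simp add: power2_eq_square coeff_mult coeffs poly_sum sum.distrib)
    also have "\<dots> = Re (complex_of_real (poly (coeff p j) t)) - Re (\<Sum>i\<le>j. ?G i * cnj (?G (j - i)))"
      by (simp only: Gre[symmetric] Re_sum Re_complex_of_real)
    also have "\<dots> = Re (\<Sum>i\<le>j. ?g i * cnj (?g (j - i)) - ?G i * cnj (?G (j - i)))"
      unfolding g(3)[OF t(1) t2(2)] by (simp add: sum_subtractf)
    also have "\<bar>\<dots>\<bar> \<le> norm (\<Sum>i\<le>j. ?g i * cnj (?g (j - i)) - ?G i * cnj (?G (j - i)))"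
      by (rule abs_Re_le_cmod)
    also have "\<dots> \<le> (\<Sum>i\<le>j. C1 * \<bar>t\<bar> ^ N * (2 * K1 + C1 * T))"
    proof (rule sum_norm_le)
      fix i
      let ?k = "j - i"
      have GK: "norm (?G i) \<le> K1 + C1 * T"
      proof -
        have "norm (?G i) \<le> norm (?g i) + norm (?g i - ?G i)" by (metis norm_minus_commute norm_triangle_sub)
        also have "\<dots> \<le> K1 + C1 * T"
          using gK[OF t2(1), of i] gG[OF t2(1), of i] mult_left_mono[OF T[OF t2(1)] C1] by linarith
        finally show ?thesis .
      qed
      have "?g i * cnj (?g ?k) - ?G i * cnj (?G ?k) = (?g i - ?G i) * cnj (?g ?k) + ?G i * cnj (?g ?k - ?G ?k)"
        by (simp add: algebra_simps)
      also have "norm \<dots> \<le> norm (?g i - ?G i) * norm (?g ?k) + norm (?G i) * norm (?g ?k - ?G ?k)"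
        by (metis complex_mod_cnj norm_mult norm_triangle_ineq)
      also have "\<dots> \<le> (C1 * \<bar>t\<bar> ^ N) * K1 + (K1 + C1 * T) * (C1 * \<bar>t\<bar> ^ N)"
        using gG[OF t2(1)] gK[OF t2(1)] GK C1 K1 by (intro add_mono mult_mono) (auto intro: order_trans[OF norm_ge_zero])
      also have "\<dots> = C1 * \<bar>t\<bar> ^ N * (2 * K1 + C1 * T)" by (simp add: algebra_simps)
      finally show "norm (?g i * cnj (?g ?k) - ?G i * cnj (?G ?k)) \<le> C1 * \<bar>t\<bar> ^ N * (2 * K1 + C1 * T)" .
    qed
    also have "\<dots> = real (j + 1) * ((C1 * (2 * K1 + C1 * T)) * \<bar>t\<bar> ^ N)" by simp
    also have "\<dots> \<le> real (2 * n + 1) * ((C1 * (2 * K1 + C1 * T)) * \<bar>t\<bar> ^ N)"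
      using True C1 K1 r by (intro mult_right_mono) (auto simp: T_def)
    also have "\<dots> = C2 * \<bar>t\<bar> ^ N" by (simp add: C2_def)
    finally show ?thesis .
  qed
  then show ?thesis using deg by blast
qed

text \<open>The certificate is produced for \<open>(1 + \<epsilon> d\<^sup>2) h - \<epsilon> d\<^sup>2 E\<close> with \<open>E = 1 + y\<^sup>2 + \<dots> + y\<^sup>2\<^sup>n\<close>, which is still
  monic, positive and has simple roots; the slack \<open>\<epsilon> d\<^sup>2 E\<close> then absorbs the truncation error.\<close>

lemma local_certificate_0:
  assumes h: "lead_coeff h = 1" "degree h = 2 * n" "n > 0" "\<And>z. evalp h z \<ge> 0"
    and bez: "A * h + B * pderiv h = [:d:]" and d: "d \<noteq> 0"
  shows "\<exists>\<epsilon>>0. certified (strip (0 - \<epsilon>) (0 + \<epsilon>)) h"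
proof -
  let ?E = "even_powers n"
  obtain c where c: "c > 0" "\<And>t y. \<bar>t\<bar> \<le> 1 \<Longrightarrow> c * (poly d t)\<^sup>2 * evalp ?E (t, y) \<le> evalp h (t, y)"
    using monic_nonneg_lower_bound[OF h bez] by blast
  define h2 where "h2 = [:d\<^sup>2:] * (h - ?E)"
  \<comment> \<open>Chosen so that \<open>p = h + \<epsilon> h2\<close> satisfies A p + B p' = d (1
    + \<epsilon> d W): where d is nonzero, a double root of \<open>p\<close> would need \<epsilon> d
    W = -1.\<close>
  define W where "W = [:d:] - (A * ?E + B * pderiv ?E)"
  have W: "A * h2 + B * pderiv h2 = [:d:] * ([:d:] * W)"
  proof -
    have pd: "pderiv h2 = [:d\<^sup>2:] * (pderiv h - pderiv ?E)"
      by (simp add: h2_def pderiv_smult pderiv_diff)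
    have "A * h2 + B * pderiv h2 = A * ([:d\<^sup>2:] * (h - ?E)) + B * ([:d\<^sup>2:] * (pderiv h - pderiv ?E))"
      by (simp only: pd) (simp only: h2_def)
    also have "\<dots> = [:d\<^sup>2:] * ((A * h + B * pderiv h) - (A * ?E + B * pderiv ?E))"
      by (simp only: algebra_simps)
    also have "\<dots> = [:d:] * ([:d:] * W)" unfolding bez W_def by (simp add: power2_eq_square)
    finally show ?thesis .
  qed
  obtain C1 where C1: "\<forall>t\<in>cball 0 1. \<forall>j. norm (coeff (specialize h t) j) \<le> C1"
    using bounded_coeff_specialize by blast
  obtain C2 where C2: "\<forall>t\<in>cball 0 1. \<forall>j. norm (coeff (specialize h2 t) j) \<le> C2"
    using bounded_coeff_specialize by blast
  define R where "R = 1 + (C1 + \<bar>C2\<bar>) * real (2 * n)"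
  obtain CW where CW: "CW \<ge> 0"
    "\<And>t y. norm t \<le> 1 \<Longrightarrow> norm y \<le> R \<Longrightarrow> norm (poly (specialize ([:d:] * W) t) y) \<le> CW"
    using bounded_poly_specialize by blast
  \<comment> \<open>The bound 1 makes the root bound \<open>R\<close> independent of
    \<open>\<epsilon>\<close>, the bound c/2 keeps \<open>p\<close> positive off the zeros of d, and
    the last one gives \<epsilon> |d W| < 1 on the region that contains the roots.\<close>
  define \<epsilon> where "\<epsilon> = min (min 1 (c / 2)) (1 / (2 * (CW + 1)))"
  have \<epsilon>: "\<epsilon> > 0" "\<epsilon> \<le> 1" "\<epsilon> \<le> c / 2" using c CW(1) by (auto simp: \<epsilon>_def)
  have "\<epsilon> * CW \<le> 1 / (2 * (CW + 1)) * CW" using CW(1) by (intro mult_right_mono) (auto simp: \<epsilon>_def)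
  also have "\<dots> < 1" using CW(1) by (simp add: field_simps)
  finally have \<epsilon>CW: "\<epsilon> * CW < 1" .
  define s where "s = smult \<epsilon> (d\<^sup>2)"
  define p where "p = h + [:[:\<epsilon>:]:] * h2"
  have p_eq: "p = [:1 + s:] * h - [:s:] * ?E"
    by (rule evalp_eqI) (simp add: p_def h2_def s_def algebra_simps)
  have "coeff h2 (2 * n) = 0"
    using h(1,2) coeff_even_powers_top[of n] by (simp add: h2_def)
  then have ptop: "coeff p (2 * n) = 1" using h(1,2) by (simp add: p_def)
  have "degree (h - ?E) \<le> 2 * n" using h(2) degree_even_powers_le by (intro degree_diff_le) auto
  then have "degree p \<le> 2 * n" unfolding p_def h2_def using h(2)
    by (intro degree_add_le) (auto intro: order_trans[OF degree_smult_le])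
  then have pdeg: "degree p = 2 * n" using ptop le_degree[of p "2 * n"] by simp
  have plead: "lead_coeff p = 1" using pdeg ptop by simp
  have finite: "finite {t. poly (of_real_poly d) t = 0}"
    using d by (intro poly_roots_finite) (simp add: map_poly_eq_0_iff)
  obtain r0 where r0: "r0 > 0" "\<And>t. poly (of_real_poly d) t = 0 \<Longrightarrow> t \<noteq> 0 \<Longrightarrow> r0 \<le> dist 0 t"
    using finite_set_avoid[OF finite, of 0] by auto
  define r where "r = min r0 1"
  have r: "r > 0" "r \<le> 1" using r0 by (auto simp: r_def)
  have dne: "poly (of_real_poly d) t \<noteq> 0" if "t \<noteq> 0" "norm t < r" for t
    using r0(2)[of t] that by (auto simp: r_def)
  have dne': "poly d t \<noteq> 0" if "t \<noteq> 0" "\<bar>t\<bar> < r" for t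
    using dne[of "complex_of_real t"] that by simp
  have sqf: "rsquarefree (specialize p t)" if t: "t \<noteq> 0" "norm t < r" for t
  proof (rule ccontr)
    assume "\<not> ?thesis"
    then obtain y where y: "poly (specialize p t) y = 0" "poly (pderiv (specialize p t)) y = 0"
      by (auto simp: rsquarefree_roots)
    have t1: "norm t \<le> 1" using t r by simp
    have "norm y \<le> 1 + (C1 + \<bar>C2\<bar>) * real (degree (specialize p t))"
    proof (rule monic_root_bound[OF _ y(1)])
      show "lead_coeff (specialize p t) = 1" using specialize_monic[OF plead] by simp
      fix j
      have "coeff (specialize p t) j = coeff (specialize h t) j + of_real \<epsilon> * coeff (specialize h2 t) j"
        unfolding p_def specialize_add specialize_mult specialize_const_poly by (simp add: map_poly_pCons)
      also have "norm \<dots> \<le> norm (coeff (specialize h t) j) + \<epsilon> * norm (coeff (specialize h2 t) j)"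
        using \<epsilon>(1) by (metis (no_types, opaque_lifting) abs_of_pos norm_mult norm_of_real norm_triangle_ineq)
      also have "\<dots> \<le> C1 + 1 * \<bar>C2\<bar>"
        using C1 C2 t1 \<epsilon> by (intro add_mono mult_mono) (auto intro: order_trans[OF _ abs_ge_self])
      finally show "norm (coeff (specialize p t) j) \<le> C1 + \<bar>C2\<bar>" by simp
    qed
    then have yR: "norm y \<le> R" using specialize_monic(1)[OF plead, of t] by (simp add: pdeg R_def)
    have "A * p + B * pderiv p = [:d:] * (1 + [:[:\<epsilon>:]:] * ([:d:] * W))"
    proof -
      have "pderiv p = pderiv h + [:[:\<epsilon>:]:] * pderiv h2"
        by (simp add: p_def pderiv_add pderiv_smult)
      then have "A * p + B * pderiv p = (A * h + B * pderiv h) + [:[:\<epsilon>:]:] * (A * h2 + B * pderiv h2)"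
        unfolding p_def by (simp only: algebra_simps)
      then show ?thesis unfolding bez W by (simp only: algebra_simps)
    qed
    from arg_cong[OF this, of "\<lambda>P. poly (specialize P t) y"] y
    have "poly (of_real_poly d) t * (1 + of_real \<epsilon> * poly (specialize ([:d:] * W) t) y) = 0"
      by (simp only: specialize_add specialize_mult specialize_pderiv specialize_1 poly_add poly_mult
          specialize_const_poly) (simp add: map_poly_pCons)
    then have "of_real \<epsilon> * poly (specialize ([:d:] * W) t) y = - 1"
      using dne[OF t] by (simp add: add_eq_0_iff)
    then have "norm (of_real \<epsilon> * poly (specialize ([:d:] * W) t) y) = 1" by simp
    then have "\<epsilon> * norm (poly (specialize ([:d:] * W) t) y) = 1" using \<epsilon>(1) by (simp add: norm_mult)
    moreover have "\<epsilon> * norm (poly (specialize ([:d:] * W) t) y) \<le> \<epsilon> * CW"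
      using CW(2)[OF t1 yR] \<epsilon>(1) by (intro mult_left_mono) auto
    ultimately show False using \<epsilon>CW by simp
  qed
  have noreal: "evalp p (t, y) \<noteq> 0" if t: "t \<noteq> 0" "\<bar>t\<bar> < r" for t y
  proof -
    have E1: "evalp ?E (t, y) \<ge> 1"
      using member_le_sum[of 0 "{..n}" "\<lambda>i. y ^ (2 * i)"] by simp
    have d2: "(poly d t)\<^sup>2 > 0" using dne'[OF t] by simp
    have "\<epsilon> * ((poly d t)\<^sup>2 * evalp ?E (t, y)) \<le> c / 2 * ((poly d t)\<^sup>2 * evalp ?E (t, y))"
      using \<epsilon>(3) E1 by (intro mult_right_mono) auto
    also have "\<dots> \<le> evalp h (t, y) / 2" using c(2)[of t y] t r by simp
    finally have "\<epsilon> * ((poly d t)\<^sup>2 * evalp ?E (t, y)) \<le> evalp h (t, y) / 2" .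
    moreover have "\<epsilon> * ((poly d t)\<^sup>2 * evalp ?E (t, y)) > 0" using \<epsilon>(1) d2 E1 by simp
    moreover have "evalp p (t, y) = evalp h (t, y) + \<epsilon> * (poly d t)\<^sup>2 * evalp h (t, y)
       - \<epsilon> * ((poly d t)\<^sup>2 * evalp ?E (t, y))"
      unfolding p_eq s_def by (simp add: algebra_simps)
    moreover have "\<epsilon> * (poly d t)\<^sup>2 * evalp h (t, y) \<ge> 0" using \<epsilon>(1) h(4) by simp
    ultimately show ?thesis by linarith
  qed
  obtain d1 where d1: "d = [:- 0, 1:] ^ order 0 d * d1" "\<not> [:- 0, 1:] dvd d1"
    using order_decomp[OF d] by blast
  define k where "k = order 0 d"
  have d10: "poly d1 0 \<noteq> 0" using d1(2) poly_eq_0_iff_dvd by blast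
  \<comment> \<open>The slack \<open>s\<close> has order \<open>2 * k\<close> at 0. With an error of
    order one more, any fixed multiple of it is below \<open>s / 2\<close> close to 0.\<close>
  obtain U V C where UV: "degree (p - U\<^sup>2 - V\<^sup>2) \<le> 2 * n"
    "\<And>t j. t \<noteq> 0 \<Longrightarrow> \<bar>t\<bar> < r / 2 \<Longrightarrow> \<bar>poly (coeff (p - U\<^sup>2 - V\<^sup>2) j) t\<bar> \<le> C * \<bar>t\<bar> ^ (2 * k + 1)"
    using local_truncated_squares[OF plead pdeg h(3) r(1) sqf noreal, of "2 * k + 1"] by metis
  define e where "e = p - U\<^sup>2 - V\<^sup>2"
  define \<eta> where "\<eta> = \<epsilon> * (poly d1 0)\<^sup>2 / 4"
  have \<eta>: "\<eta> > 0" using \<epsilon>(1) d10 by (simp add: \<eta>_def)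
  have "(poly d1 \<longlongrightarrow> poly d1 0) (at 0)" using poly_isCont isCont_def by blast
  then have "((\<lambda>t. \<epsilon> * (poly d1 t)\<^sup>2 / 2) \<longlongrightarrow> \<epsilon> * (poly d1 0)\<^sup>2 / 2) (at 0)"
    by (intro tendsto_intros) simp
  moreover have "\<eta> < \<epsilon> * (poly d1 0)\<^sup>2 / 2" using \<eta> by (simp add: \<eta>_def)
  ultimately have "eventually (\<lambda>t. \<eta> < \<epsilon> * (poly d1 t)\<^sup>2 / 2) (at 0)" by (rule order_tendstoD)
  then obtain \<delta>1 where \<delta>1: "\<delta>1 > 0" "\<And>t. t \<noteq> 0 \<Longrightarrow> \<bar>t\<bar> < \<delta>1 \<Longrightarrow> \<eta> < \<epsilon> * (poly d1 t)\<^sup>2 / 2"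
    unfolding eventually_at by (auto simp: dist_real_def)
  define \<delta> where "\<delta> = min (min (r / 2) \<delta>1) (\<eta> / (\<bar>C\<bar> + 1))"
  have \<delta>: "\<delta> > 0" using r \<delta>1 \<eta> by (simp add: \<delta>_def)
  have "\<bar>poly (coeff e j) t\<bar> \<le> poly s t / 2" if t: "t \<noteq> 0" "\<bar>t - 0\<bar> < \<delta>" for t j
  proof -
    have t': "\<bar>t\<bar> < r / 2" "\<bar>t\<bar> < \<delta>1" "\<bar>t\<bar> \<le> \<eta> / (\<bar>C\<bar> + 1)" using t by (auto simp: \<delta>_def)
    have "\<bar>poly (coeff e j) t\<bar> \<le> C * \<bar>t\<bar> ^ (2 * k + 1)" unfolding e_def by (rule UV(2)[OF t(1) t'(1)])
    also have "\<dots> \<le> (\<bar>C\<bar> + 1) * \<bar>t\<bar> ^ (2 * k + 1)" by (intro mult_right_mono) auto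
    also have "\<dots> = ((\<bar>C\<bar> + 1) * \<bar>t\<bar>) * \<bar>t\<bar> ^ (2 * k)" by simp
    also have "\<dots> \<le> \<eta> * \<bar>t\<bar> ^ (2 * k)"
      using t'(3) by (intro mult_right_mono) (auto simp: pos_le_divide_eq mult.commute)
    also have "\<dots> \<le> (\<epsilon> * (poly d1 t)\<^sup>2 / 2) * \<bar>t\<bar> ^ (2 * k)"
      using \<delta>1(2)[OF t(1) t'(2)] by (intro mult_right_mono) auto
    also have "\<dots> = poly s t / 2"
    proof -
      have "poly d t = t ^ k * poly d1 t" by (subst d1(1)) (simp add: k_def)
      then show ?thesis
        by (simp add: s_def power_mult_distrib power_mult[symmetric] power_even_abs mult.commute)
    qed
    finally show ?thesis .
  qed
  from absorb_in_preordering[OF UV(1)[folded e_def] \<delta> this] obtain \<epsilon>' where \<epsilon>':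
    "\<epsilon>' > 0" "[:s:] * ?E + e \<in> preordering (strip (0 - \<epsilon>') (0 + \<epsilon>'))" by blast
  let ?T = "preordering (strip (0 - \<epsilon>') (0 + \<epsilon>'))"
  have "[:1 + s:] * h = U\<^sup>2 + V\<^sup>2 + ([:s:] * ?E + e)"
    unfolding e_def p_eq by simp
  then have "[:1 + s:] * h \<in> ?T"
    using \<epsilon>'(2) preordering.square preordering.add by metis
  \<comment> \<open>A second factor 1 + s, itself in the preordering, turns the multiplier of
    \<open>h\<close> into a square.\<close>
  moreover have spos: "poly (1 + s) x \<ge> 1" for x using \<epsilon>(1) by (simp add: s_def)
  then have "[:1 + s:] \<in> ?T" by (intro preordering_const_poly) (meson order_trans zero_le_one)
  ultimately have "[:1 + s:] * ([:1 + s:] * h) \<in> ?T" by (metis preordering.mult)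
  then have "[:1 + s:]\<^sup>2 * h \<in> ?T" by (simp only: power2_eq_square mult.assoc)
  moreover have "poly (1 + s) 0 \<noteq> 0" using spos[of 0] by linarith
  then have "[:1 + s:] \<noteq> 0" by (metis pCons_eq_0_iff poly_0)
  ultimately show ?thesis using \<epsilon>'(1) unfolding certified_def by blast
qed

section \<open>Transport of certificates by translation in x\<close>

lemma preordering_image:
  assumes "P \<in> preordering G"
    and "\<And>P Q. \<phi> (P + Q) = \<phi> P + \<phi> Q" "\<And>P Q. \<phi> (P * Q) = \<phi> P * \<phi> Q"
    and "\<And>g. g \<in> G \<Longrightarrow> \<phi> g \<in> preordering G'"
  shows "\<phi> P \<in> preordering G'"
  using assms(1)
proof induction
  case (square P)
  then show ?case using preordering.square[of "\<phi> P"] by (simp add: power2_eq_square assms(3))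
qed (use assms in \<open>auto intro: preordering.intros\<close>)

definition translate :: "real \<Rightarrow> bipoly \<Rightarrow> bipoly" where
  "translate a P = map_poly (\<lambda>c. pcompose c [:a, 1:]) P"

lemma coeff_translate: "coeff (translate a P) j = pcompose (coeff P j) [:a, 1:]"
  by (simp add: translate_def coeff_map_poly)

lemma evalp_translate [simp]: "evalp (translate a P) (x, y) = evalp P (a + x, y)"
proof -
  have "degree (translate a P) \<le> degree P" by (rule degree_le) (simp add: coeff_translate coeff_eq_0)
  from evalp_sum_coeff[OF this] show ?thesis
    by (simp add: evalp_sum_coeff[OF order_refl] coeff_translate poly_pcompose)
qed

lemma translate_add: "translate a (P + Q) = translate a P + translate a Q"
  and translate_mult: "translate a (P * Q) = translate a P * translate a Q"
  by (rule evalp_eqI; force)+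

lemma translate_translate [simp]: "translate (- a) (translate a P) = P" "translate a (translate (- a) P) = P"
  by (rule evalp_eqI; force)+

lemma translate_const: "translate a [:c:] = [:pcompose c [:a, 1:]:]"
  by (simp add: translate_def map_poly_pCons)

lemma translate_eq_0_iff: "translate a P = 0 \<longleftrightarrow> P = 0"
proof
  assume "translate a P = 0"
  then have "translate (- a) (translate a P) = translate (- a) 0" by (simp only:)
  also have "\<dots> = 0" by (simp add: translate_def)
  finally show "P = 0" by simp
qed (simp add: translate_def)

lemma pcompose_linear_eq_0_iff: "pcompose c [:a, 1:] = 0 \<longleftrightarrow> c = 0" for c :: "real poly"
  by (simp add: pcompose_eq_0_iff)

lemma translate_monic:
  assumes "lead_coeff P = 1"
  shows "degree (translate a P) = degree P" "lead_coeff (translate a P) = 1"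
proof -
  have "coeff (translate a P) (degree P) = 1" using assms by (simp add: coeff_translate pcompose_1)
  moreover have "degree (translate a P) \<le> degree P"
    by (rule degree_le) (simp add: coeff_translate coeff_eq_0)
  ultimately show *: "degree (translate a P) = degree P"
    using le_degree[of "translate a P" "degree P"] by simp
  show "lead_coeff (translate a P) = 1" using \<open>coeff (translate a P) (degree P) = 1\<close> * by simp
qed

lemma translate_pderiv: "pderiv (translate a P) = translate a (pderiv P)"
proof (rule poly_eqI)
  have "pcompose (of_nat n) q = of_nat n" for n and q :: "real poly"
    by (simp add: of_nat_poly)
  then show "coeff (pderiv (translate a P)) n = coeff (translate a (pderiv P)) n" for n
    by (simp only: coeff_pderiv coeff_translate pcompose_mult)
qed

lemma local_certificate:
  assumes h: "lead_coeff h = 1" "degree h = 2 * n" "n > 0" "\<And>z. evalp h z \<ge> 0"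
    and bez: "A * h + B * pderiv h = [:d:]" and d: "d \<noteq> 0"
  shows "\<exists>\<epsilon>>0. certified (strip (x0 - \<epsilon>) (x0 + \<epsilon>)) h"
proof -
  let ?h = "translate x0 h"
  have "\<exists>\<epsilon>>0. certified (strip (0 - \<epsilon>) (0 + \<epsilon>)) ?h"
  proof (rule local_certificate_0)
    show "lead_coeff ?h = 1" "degree ?h = 2 * n" using translate_monic[OF h(1)] h(2) by auto
    show "evalp ?h z \<ge> 0" for z using h(4) by (cases z) simp
    have "translate x0 (A * h + B * pderiv h) = translate x0 [:d:]" by (simp only: bez)
    then show "translate x0 A * ?h + translate x0 B * pderiv ?h = [:pcompose d [:x0, 1:]:]"
      by (simp only: translate_add translate_mult translate_pderiv translate_const)
    show "pcompose d [:x0, 1:] \<noteq> 0" using d pcompose_linear_eq_0_iff by blast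
  qed fact
  then obtain \<epsilon> M where \<epsilon>: "\<epsilon> > 0" "M \<noteq> 0" "M\<^sup>2 * ?h \<in> preordering (strip (0 - \<epsilon>) (0 + \<epsilon>))"
    by (auto simp: certified_def)
  have "translate (- x0) (M\<^sup>2 * ?h) \<in> preordering (strip (x0 - \<epsilon>) (x0 + \<epsilon>))"
  proof (rule preordering_image[OF \<epsilon>(3)])
    fix g assume "g \<in> strip (0 - \<epsilon>) (0 + \<epsilon>)"
    then have "translate (- x0) g \<in> strip (x0 - \<epsilon>) (x0 + \<epsilon>)"
      by (auto simp: translate_const pcompose_pCons)
    then show "translate (- x0) g \<in> preordering (strip (x0 - \<epsilon>) (x0 + \<epsilon>))"
      by (rule preordering.gen)
  qed (simp_all only: translate_add translate_mult)
  then have "(translate (- x0) M)\<^sup>2 * h \<in> preordering (strip (x0 - \<epsilon>) (x0 + \<epsilon>))"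
    by (simp add: translate_mult power2_eq_square)
  then show ?thesis using \<epsilon> translate_eq_0_iff unfolding certified_def by blast
qed

section \<open>Certificates over strips\<close>

text \<open>The two certificates are merged along the sign of b - x; the open strip from a to c is
  the set on which the remaining generators are nonnegative.\<close>

lemma certified_strip_join:
  assumes "certified (strip a b) h" "certified (strip b c) h" "a \<le> b" "b \<le> c"
  shows "certified (strip a c) h"
proof (cases "a = c")
  case False
  let ?g = "[:[:b, - 1:]:] :: bipoly"
  show ?thesis
  proof (rule certified_merge)
    show "certified (insert ?g (strip a c)) h"
      by (rule certified_mono[OF assms(1)]) (auto intro: preordering.gen)
    show "certified (insert (- ?g) (strip a c)) h"
      by (rule certified_mono[OF assms(2)]) (auto intro: preordering.gen)
    show "open ({a<..<c} \<times> (UNIV :: real set))" by (intro open_Times) auto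
    show "{a<..<c} \<times> (UNIV :: real set) \<noteq> {}" using False assms(3,4) by auto
  qed auto
qed (use assms in auto)

text \<open>Compactness of the interval, in the form of a bisection argument: short strips around
  each point have certificates, and adjacent strips join.\<close>

lemma certified_strip_bezout:
  assumes h: "lead_coeff h = 1" "degree h = 2 * n" "n > 0" "\<And>z. evalp h z \<ge> 0"
    and bez: "A * h + B * pderiv h = [:d:]" and d: "d \<noteq> 0" and "a \<le> b"
  shows "certified (strip a b) h"
  using \<open>a \<le> b\<close>
proof (induction rule: Bolzano)
  case (trans a b c)
  then show ?case by (rule certified_strip_join)
next
  case (local x)
  obtain \<epsilon> where \<epsilon>: "\<epsilon> > 0" "certified (strip (x - \<epsilon>) (x + \<epsilon>)) h"
    using local_certificate[OF h bez d] by blast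
  have "certified (strip u v) h" if "u \<le> x" "x \<le> v" "v - u < \<epsilon>" for u v
    by (rule certified_mono[OF \<epsilon>(2)], rule strip_subset_preordering) (use that in auto)
  then show ?case using \<epsilon>(1) by blast
qed

text \<open>In a sum of two real squares the top coefficients cannot cancel, so the degree is twice
  the larger of the two degrees.\<close>

lemma real_poly_nonneg_degree_lead:
  fixes p :: "real poly"
  assumes "\<And>x. poly p x \<ge> 0"
  shows "even (degree p) \<and> lead_coeff p \<ge> 0"
proof -
  obtain u v where p: "p = u\<^sup>2 + v\<^sup>2" using real_poly_nonneg_two_squares assms by blast
  have *: "even (degree p) \<and> lead_coeff p \<ge> 0" if "p = u\<^sup>2 + v\<^sup>2" "degree v \<le> degree u" for u v
  proof -
    let ?m = "degree u"
    have top: "coeff (q\<^sup>2) (2 * ?m) = (coeff q ?m)\<^sup>2" if "degree q \<le> ?m" for q :: "real poly"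
    proof (cases "degree q = ?m")
      case True
      then show ?thesis using coeff_degree_mult[of q q] degree_mult_le[of q q]
        by (metis coeff_mult_degree_sum mult_2 power2_eq_square)
    next
      case False
      then have "degree (q\<^sup>2) < 2 * ?m" using that degree_power_le[of q 2] by linarith
      then show ?thesis using False that by (simp add: coeff_eq_0)
    qed
    have c: "coeff p (2 * ?m) = (coeff u ?m)\<^sup>2 + (coeff v ?m)\<^sup>2"
      using top[of u] top[of v] that by simp
    have "degree p \<le> 2 * ?m" unfolding that(1) using degree_power_le[of u 2] degree_power_le[of v 2] that(2)
      by (intro degree_add_le) linarith+
    show ?thesis
    proof (cases "u = 0")
      case True
      then have "degree v = 0" using that(2) by simp
      then obtain w where "v = [:w:]" by (meson degree_eq_zeroE)
      then show ?thesis using that True by (simp add: power2_eq_square)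
    next
      case False
      then have "coeff p (2 * ?m) > 0" unfolding c by (simp add: add_pos_nonneg)
      then have "degree p = 2 * ?m" using \<open>degree p \<le> 2 * ?m\<close> le_degree[of p "2 * ?m"] by simp
      then show ?thesis using \<open>coeff p (2 * ?m) > 0\<close> by simp
    qed
  qed
  show ?thesis
  proof (cases "degree v \<le> degree u")
    case False
    then show ?thesis using *[of v u] p by (simp add: add.commute)
  qed (use * p in blast)
qed

lemma bipoly_nonneg_degree_lead:
  assumes "h \<noteq> 0" "\<And>z. evalp h z \<ge> 0"
  shows "even (degree h) \<and> (\<forall>x. poly (lead_coeff h) x \<ge> 0)"
proof -
  let ?h = "\<lambda>x. map_poly (\<lambda>c. poly c x) h"
  have *: "even (degree h) \<and> poly (lead_coeff h) x \<ge> 0" if x: "poly (lead_coeff h) x \<noteq> 0" for x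
  proof -
    have deg: "degree (?h x) = degree h"
      by (intro antisym degree_le le_degree) (use x in \<open>auto simp: coeff_map_poly coeff_eq_0\<close>)
    have "poly (?h x) y \<ge> 0" for y using assms(2)[of "(x, y)"] by (simp add: evalp_map_poly)
    from real_poly_nonneg_degree_lead[OF this] show ?thesis by (simp add: deg coeff_map_poly)
  qed
  moreover obtain x where "poly (lead_coeff h) x \<noteq> 0"
    using assms(1) by (metis leading_coeff_0_iff poly_all_0_iff_0)
  ultimately show ?thesis by (metis order_refl)
qed

text \<open>Writing h = \<pi> k, the prime divides k \<pi>', and it does not divide \<pi>', whose
  degree is smaller.\<close>

lemma prime_square_dvd:
  fixes h :: bipoly
  assumes "prime_elem \<pi>" "degree \<pi> > 0" "\<pi> dvd h" "\<pi> dvd pderiv h"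
  shows "\<pi>\<^sup>2 dvd h"
proof -
  obtain k where k: "h = \<pi> * k" using assms(3) by (rule dvdE)
  have "pderiv h = \<pi> * pderiv k + k * pderiv \<pi>" by (simp add: k pderiv_mult)
  then have "\<pi> dvd k * pderiv \<pi>" using assms(4) by (metis dvd_add_right_iff dvd_triv_left)
  moreover have "\<not> \<pi> dvd pderiv \<pi>"
  proof
    assume "\<pi> dvd pderiv \<pi>"
    moreover have "pderiv \<pi> \<noteq> 0" using assms(2) by (simp add: pderiv_eq_0_iff)
    ultimately have "degree \<pi> \<le> degree (pderiv \<pi>)" by (rule dvd_imp_degree_le)
    then show False using assms(2) by (simp add: degree_pderiv)
  qed
  ultimately have "\<pi> dvd k" using assms(1) prime_elem_dvd_mult_iff by blast
  then show ?thesis by (simp add: k power2_eq_square)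
qed

text \<open>Either \<open>h\<close> and its derivative satisfy a Bezout identity, so the roots are
  simple for all but finitely many x, or a repeated prime factor exists; its square is split off and
  the degree drops.\<close>

lemma certified_strip_monic:
  assumes "lead_coeff h = 1" "\<And>z. evalp h z \<ge> 0" "a \<le> b"
  shows "certified (strip a b) h"
  using assms
proof (induction "degree h" arbitrary: h rule: less_induct)
  case less
  have h0: "h \<noteq> 0" using less.prems(1) by auto
  show ?case
  proof (cases "degree h = 0")
    case True
    then obtain c where "h = [:c:]" by (meson degree_eq_zeroE)
    then have "h = 1" using less.prems(1) by (simp add: one_pCons)
    then show ?thesis unfolding certified_def by (auto intro!: exI[of _ 1])
  next
    case False
    consider A B d where "d \<noteq> 0" "A * h + B * pderiv h = [:d:]"
      | \<pi> where "prime_elem \<pi>" "degree \<pi> > 0" "\<pi> dvd h" "\<pi> dvd pderiv h"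
      using bezout_or_common_prime[OF h0, of "pderiv h"] by blast
    then show ?thesis
    proof cases
      case (1 A B d)
      obtain n where n: "degree h = 2 * n"
        using bipoly_nonneg_degree_lead[OF h0 less.prems(2)] by (meson evenE)
      then show ?thesis
        using certified_strip_bezout[OF less.prems(1) n _ less.prems(2) 1(2,1) less.prems(3)] False by simp
    next
      case (2 \<pi>)
      obtain k where k: "h = \<pi>\<^sup>2 * k" using prime_square_dvd[OF 2] by (rule dvdE)
      define u where "u = lead_coeff \<pi>"
      define v where "v = lead_coeff k"
      have uv: "u\<^sup>2 * v = 1" using less.prems(1)
        by (simp add: k lead_coeff_mult lead_coeff_power u_def v_def)
      \<comment> \<open>Since u^2 v = 1, both leading coefficients are units of R[x]. The rescaling
        makes the cofactor monic again without changing the product.\<close>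
      define \<pi>' where "\<pi>' = [:u * v:] * \<pi>"
      define k' where "k' = [:u\<^sup>2:] * k"
      have "\<pi>'\<^sup>2 * k' = ([:u\<^sup>2 * v:])\<^sup>2 * h"
        unfolding \<pi>'_def k'_def k by (simp add: power2_eq_square algebra_simps)
      then have h: "h = \<pi>'\<^sup>2 * k'" by (simp add: uv one_pCons[symmetric])
      have lead: "lead_coeff k' = 1"
        unfolding k'_def lead_coeff_mult using uv by (simp add: v_def)
      have \<pi>'0: "\<pi>' \<noteq> 0" and "k' \<noteq> 0" using h h0 by auto
      have nn: "evalp k' z \<ge> 0" for z
      proof (rule continuous_ge_dense[OF \<pi>'0])
        show "continuous_on UNIV (evalp k')" using continuous_on_evalp[OF continuous_on_id] by simp
        fix w assume "evalp \<pi>' w \<noteq> 0"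
        then have "(evalp \<pi>' w)\<^sup>2 > 0" by simp
        then show "evalp k' w \<ge> 0" using less.prems(2)[of w] mult_pos_neg[of "(evalp \<pi>' w)\<^sup>2" "evalp k' w"]
          unfolding h evalp_mult evalp_power by linarith
      qed
      have "u * v \<noteq> 0" using uv by auto
      then have "degree \<pi>' = degree \<pi>" unfolding \<pi>'_def by simp
      then have "degree k' < degree h"
        using 2(2) \<pi>'0 \<open>k' \<noteq> 0\<close> by (simp add: h degree_mult_eq degree_power_eq)
      from less.hyps[OF this lead nn less.prems(3)] show ?thesis
        unfolding h using certified_square_mult[OF \<pi>'0] by blast
    qed
  qed
qed

lemma evalp_eq_0_of_const_mult:
  assumes "a \<noteq> 0" "\<And>x y. poly a x \<noteq> 0 \<Longrightarrow> evalp P (x, y) = 0"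
  shows "P = 0"
proof (rule evalp_eqI_nonzero[of "[:a:]"])
  show "evalp P z = evalp 0 z" if "evalp [:a:] z \<noteq> 0" for z
    using that assms(2) by (cases z) simp
qed (use assms in simp)

text \<open>\<open>k(x, z) = a\<^sup>m\<^sup>-\<^sup>1 h(x, z / a)\<close> is monic for the leading coefficient \<open>a\<close> of \<open>h\<close>.\<close>

lemma certified_strip:
  assumes "\<And>z. evalp h z \<ge> 0" "a \<le> b"
  shows "certified (strip a b) h"
proof (cases "degree h = 0")
  case True
  then obtain c where h: "h = [:c:]" by (meson degree_eq_zeroE)
  then have "poly c x \<ge> 0" for x using assms(1)[of "(x, 0)"] by simp
  then have "1\<^sup>2 * h \<in> preordering (strip a b)" unfolding h by (simp add: preordering_const_poly)
  then show ?thesis unfolding certified_def using one_neq_zero by blast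
next
  case False
  then have h0: "h \<noteq> 0" by auto
  define m where "m = degree h"
  define c where "c = lead_coeff h"
  have c0: "c \<noteq> 0" using h0 by (simp add: c_def)
  obtain n where n: "m = 2 * n" and cnn: "\<And>x. poly c x \<ge> 0"
    using bipoly_nonneg_degree_lead[OF h0 assms(1)] by (auto simp: m_def c_def elim: evenE)
  have n0: "n > 0" "m > 0" using False n by (auto simp: m_def)
  define k where "k = monom 1 m + (\<Sum>j<m. monom (coeff h j * c ^ (m - 1 - j)) j)"
  have kj: "coeff k j = (if j = m then 1 else if j < m then coeff h j * c ^ (m - 1 - j) else 0)" for j
    by (simp add: k_def coeff_sum)
  have kdeg: "degree k = m"
    by (intro antisym degree_le le_degree) (auto simp: kj)
  then have klead: "lead_coeff k = 1" by (simp add: kj)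
  have kh: "evalp k (x, poly c x * y) = poly c x ^ (m - 1) * evalp h (x, y)" for x y
  proof -
    have "evalp k (x, poly c x * y) = (\<Sum>j\<le>m. poly (coeff k j) x * (poly c x * y) ^ j)"
      using evalp_sum_coeff[of k m] kdeg by simp
    also have "\<dots> = (\<Sum>j\<le>m. poly c x ^ (m - 1) * (poly (coeff h j) x * y ^ j))"
    proof (rule sum.cong)
      fix j assume "j \<in> {..m}"
      then consider "j = m" | "j < m" by fastforce
      then show "poly (coeff k j) x * (poly c x * y) ^ j = poly c x ^ (m - 1) * (poly (coeff h j) x * y ^ j)"
      proof cases
        case 1
        then have "poly (coeff h j) x = poly c x" by (simp add: c_def m_def)
        then show ?thesis using 1 power_minus_mult[OF n0(2), of "poly c x"]
          by (simp add: kj power_mult_distrib mult_ac)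
      next
        case 2
        then have "poly c x ^ (m - 1 - j) * poly c x ^ j = poly c x ^ (m - 1)"
          by (simp add: power_add[symmetric])
        then show ?thesis using 2 by (simp add: kj power_mult_distrib mult_ac)
      qed
    qed simp
    also have "\<dots> = poly c x ^ (m - 1) * evalp h (x, y)"
      by (simp add: evalp_sum_coeff[of h m] m_def sum_distrib_left)
    finally show ?thesis .
  qed
  have "[:c:] \<noteq> 0" using c0 by simp
  then have "evalp k z \<ge> 0" for z
  proof (rule continuous_ge_dense)
    show "continuous_on UNIV (evalp k)" using continuous_on_evalp[OF continuous_on_id] by simp
    fix w assume "evalp [:c:] w \<noteq> 0"
    then have "poly c (fst w) \<noteq> 0" by simp
    then have "evalp k w = poly c (fst w) ^ (m - 1) * evalp h (fst w, snd w / poly c (fst w))"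
      using kh[of "fst w" "snd w / poly c (fst w)"] by simp
    then show "evalp k w \<ge> 0" using cnn assms(1) by simp
  qed
  from certified_strip_monic[OF klead this assms(2)]
  obtain M where M: "M \<noteq> 0" "M\<^sup>2 * k \<in> preordering (strip a b)" by (auto simp: certified_def)
  define \<phi> where "\<phi> P = bsubst P bX ([:c:] * bY)" for P
  have \<phi>: "evalp (\<phi> P) (x, y) = evalp P (x, poly c x * y)" for P x y by (simp add: \<phi>_def mult.commute)
  have "\<phi> (M\<^sup>2 * k) \<in> preordering (strip a b)"
  proof (rule preordering_image[OF M(2)])
    show "\<phi> (P + Q) = \<phi> P + \<phi> Q" "\<phi> (P * Q) = \<phi> P * \<phi> Q" for P Q
      by (rule evalp_eqI; simp add: \<phi>_def)+
    fix g assume g: "g \<in> strip a b"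
    then have "\<phi> g = g" by (intro evalp_eqI) (auto simp: \<phi>_def)
    then show "\<phi> g \<in> preordering (strip a b)" using preordering.gen[OF g] by simp
  qed
  \<comment> \<open>The substitution of c y for y turned \<open>k\<close> into c^(m-1) h with m - 1
    odd. One more factor c, allowed because c is nonnegative, completes the square.\<close>
  moreover have "[:c:] \<in> preordering (strip a b)" using cnn by (rule preordering_const_poly)
  ultimately have "[:c:] * \<phi> (M\<^sup>2 * k) \<in> preordering (strip a b)" by (intro preordering.mult)
  also have "[:c:] * \<phi> (M\<^sup>2 * k) = (\<phi> M * [:c:] ^ n)\<^sup>2 * h"
  proof (rule evalp_eqI)
    fix z :: "real \<times> real"
    obtain x y where z: "z = (x, y)" by (cases z)
    have *: "poly c x ^ (m - 1) * poly c x = (poly c x ^ n)\<^sup>2"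
      using power_minus_mult[OF n0(2), of "poly c x"] by (simp add: n power_mult[symmetric] mult.commute)
    have "evalp ([:c:] * \<phi> (M\<^sup>2 * k)) z
        = poly c x * ((evalp M (x, poly c x * y))\<^sup>2 * (poly c x ^ (m - 1) * evalp h (x, y)))"
      unfolding z evalp_mult \<phi> evalp_power kh by simp
    also have "\<dots> = (poly c x ^ (m - 1) * poly c x) * ((evalp M (x, poly c x * y))\<^sup>2 * evalp h (x, y))"
      by (simp only: mult_ac)
    also have "\<dots> = evalp ((\<phi> M * [:c:] ^ n)\<^sup>2 * h) z"
      unfolding * z evalp_mult \<phi> evalp_power by (simp add: power_mult_distrib mult_ac)
    finally show "evalp ([:c:] * \<phi> (M\<^sup>2 * k)) z = evalp ((\<phi> M * [:c:] ^ n)\<^sup>2 * h) z" .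
  qed
  finally have "(\<phi> M * [:c:] ^ n)\<^sup>2 * h \<in> preordering (strip a b)" .
  moreover have "\<phi> M \<noteq> 0"
  proof
    assume "\<phi> M = 0"
    have "M = 0"
    proof (rule evalp_eq_0_of_const_mult[OF c0])
      fix x y assume "poly c x \<noteq> 0"
      then show "evalp M (x, y) = 0"
        using \<phi>[of M x "y / poly c x"] \<open>\<phi> M = 0\<close> by simp
    qed
    then show False using M(1) by simp
  qed
  ultimately show ?thesis using c0 unfolding certified_def by (metis mult_eq_0_iff pCons_eq_0_iff power_not_zero)
qed

section \<open>The line at infinity\<close>

text \<open>The reversal x^L P(1/x, y), which brings the line at infinity to x = 0. The exponent is
  kept free so that sums can share it and products can add it.\<close>

definition inverts :: "nat \<Rightarrow> bipoly \<Rightarrow> bipoly \<Rightarrow> bool" where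
  "inverts L P Q \<longleftrightarrow> (\<forall>x y. x \<noteq> 0 \<longrightarrow> evalp Q (x, y) = x ^ L * evalp P (1 / x, y))"

lemma inverts_mult: "inverts L P Q \<Longrightarrow> inverts L' P' Q' \<Longrightarrow> inverts (L + L') (P * P') (Q * Q')"
  by (simp add: inverts_def power_add)

lemma inverts_add: "inverts L P Q \<Longrightarrow> inverts L P' Q' \<Longrightarrow> inverts L (P + P') (Q + Q')"
  by (simp add: inverts_def distrib_left)

lemma inverts_const_poly:
  assumes "degree c \<le> L"
  shows "inverts L [:c:] [:\<Sum>i\<le>degree c. monom (coeff c i) (L - i):]"
proof -
  have "(\<Sum>i\<le>degree c. coeff c i * x ^ (L - i)) = x ^ L * poly c (1 / x)" if "x \<noteq> 0" for x
    unfolding poly_altdef sum_distrib_left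
    by (rule sum.cong) (use that assms in \<open>auto simp: power_diff power_one_over field_simps\<close>)
  then show ?thesis by (simp add: inverts_def poly_sum poly_monom)
qed

lemma inverts_exists: "\<exists>L0. \<forall>L\<ge>L0. \<exists>Q. inverts L P Q"
proof (induction P)
  case 0
  then show ?case by (auto simp: inverts_def intro!: exI[of _ 0])
next
  case (pCons c P)
  then obtain L0 where L0: "\<And>L. L \<ge> L0 \<Longrightarrow> \<exists>Q. inverts L P Q" by blast
  have "\<exists>Q. inverts L (pCons c P) Q" if "L \<ge> max L0 (degree c)" for L
  proof -
    obtain Q where Q: "inverts L P Q" using L0 \<open>L \<ge> max L0 (degree c)\<close> by auto
    have C: "inverts L [:c:] [:\<Sum>i\<le>degree c. monom (coeff c i) (L - i):]"
      by (rule inverts_const_poly) (use \<open>L \<ge> max L0 (degree c)\<close> in simp)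
    have "inverts L (pCons c P) ([:\<Sum>i\<le>degree c. monom (coeff c i) (L - i):] + bY * Q)"
      using Q C by (simp add: inverts_def distrib_left mult_ac)
    then show ?thesis by blast
  qed
  then show ?case by blast
qed

text \<open>The identity x^2 (1 - 1/x^2) = x^2 - 1 exchanges the generators. Even exponents keep
  squares squares; in a product the exponent is split as \<open>2 * L0\<close> and the rest.\<close>

lemma inverts_preordering:
  assumes "P \<in> preordering {[:[:1, 0, - 1:]:]}"
  shows "\<exists>L0. \<forall>L\<ge>L0. \<exists>Q\<in>preordering {[:[:- 1, 0, 1:]:]}. inverts (2 * L) P Q"
  using assms
proof induction
  case (square P)
  obtain L0 where L0: "\<And>L. L \<ge> L0 \<Longrightarrow> \<exists>Q. inverts L P Q" using inverts_exists by blast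
  have "\<exists>Q\<in>preordering {[:[:- 1, 0, 1:]:]}. inverts (2 * L) (P\<^sup>2) Q" if "L \<ge> L0" for L
  proof -
    obtain Q where "inverts L P Q" using L0 \<open>L \<ge> L0\<close> by blast
    then have "inverts (2 * L) (P\<^sup>2) (Q\<^sup>2)"
      using inverts_mult[of L P Q L P Q] by (simp add: power2_eq_square mult_2)
    then show ?thesis using preordering.square by blast
  qed
  then show ?case by blast
next
  case (gen g)
  let ?g' = "[:[:- 1, 0, 1:]:] :: bipoly"
  have "inverts (2 * L) g ((bX ^ (L - 1))\<^sup>2 * ?g')" if "L \<ge> 1" for L
  proof -
    have "2 * L = (L - 1) + (L - 1) + 2" using that by simp
    then have "x ^ (2 * L) = (x ^ (L - 1))\<^sup>2 * x\<^sup>2" for x :: real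
      by (simp only: power_add power2_eq_square[of "x ^ (L - 1)"])
    then show ?thesis using gen by (auto simp: inverts_def field_simps power2_eq_square)
  qed
  moreover have "(bX ^ (L - 1))\<^sup>2 * ?g' \<in> preordering {?g'}" for L
    by (intro preordering.mult preordering.square preordering.gen) simp
  ultimately show ?case by blast
next
  case (add P Q)
  then obtain L0 L1 where "\<And>L. L \<ge> L0 \<Longrightarrow> \<exists>R\<in>preordering {[:[:- 1, 0, 1:]:]}. inverts (2 * L) P R"
    "\<And>L. L \<ge> L1 \<Longrightarrow> \<exists>R\<in>preordering {[:[:- 1, 0, 1:]:]}. inverts (2 * L) Q R" by blast
  then have "\<exists>R\<in>preordering {[:[:- 1, 0, 1:]:]}. inverts (2 * L) (P + Q) R" if "L \<ge> max L0 L1" for L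
    using that by (meson inverts_add preordering.add max.boundedE)
  then show ?case by blast
next
  case (mult P Q)
  then obtain L0 L1 where L: "\<And>L. L \<ge> L0 \<Longrightarrow> \<exists>R\<in>preordering {[:[:- 1, 0, 1:]:]}. inverts (2 * L) P R"
    "\<And>L. L \<ge> L1 \<Longrightarrow> \<exists>R\<in>preordering {[:[:- 1, 0, 1:]:]}. inverts (2 * L) Q R" by blast
  have "\<exists>R\<in>preordering {[:[:- 1, 0, 1:]:]}. inverts (2 * L) (P * Q) R" if "L \<ge> L0 + L1" for L
  proof -
    obtain R where R: "R \<in> preordering {[:[:- 1, 0, 1:]:]}" "inverts (2 * L0) P R" using L(1)[of L0] by auto
    obtain S where S: "S \<in> preordering {[:[:- 1, 0, 1:]:]}" "inverts (2 * (L - L0)) Q S"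
    proof -
      have "L - L0 \<ge> L1" using \<open>L \<ge> L0 + L1\<close> by simp
      then show ?thesis using L(2) that by blast
    qed
    have "2 * L0 + 2 * (L - L0) = 2 * L" using that by simp
    then have "inverts (2 * L) (P * Q) (R * S)" using inverts_mult[OF R(2) S(2)] by simp
    then show ?thesis using preordering.mult[OF R(1) S(1)] by blast
  qed
  then show ?case by blast
qed

text \<open>Both generators are of the form ((1 \<plusminus> x)^2 + (1 - x^2)) / 2. The single
  generator makes the strip and its complement opposite signs of one polynomial.\<close>

lemma strip_subset_disc: "strip (- 1) 1 \<subseteq> preordering {[:[:1, 0, - 1:]:]}"
proof -
  let ?T = "preordering {[:[:1, 0, - 1:]:]}"
  have "[:[:1 / 2:]:] * ([:[:1, \<sigma>:]:]\<^sup>2 + [:[:1, 0, - 1:]:]) \<in> ?T" for \<sigma>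
    by (intro preordering.mult preordering.add preordering.square preordering.gen preordering_const_poly) auto
  moreover have "[:[:1 / 2:]:] * ([:[:1, \<sigma>:]:]\<^sup>2 + [:[:1, 0, - 1:]:]) = [:[:1, \<sigma>:]:]" if "\<sigma>\<^sup>2 = 1" for \<sigma> :: real
    using that by (intro evalp_eqI) (simp add: power2_eq_square field_simps)
  ultimately have "[:[:1, \<sigma>:]:] \<in> ?T" if "\<sigma>\<^sup>2 = 1" for \<sigma> using that by metis
  from this[of 1] this[of "- 1"] show ?thesis by simp
qed

text \<open>The reversal \<open>H\<close> with even exponent is again nonnegative and is certified
  where |x| \<le> 1. Reversing that certificate returns \<open>h\<close>, up to even powers of x, on
  |x| \<ge> 1.\<close>

lemma certified_outside:
  assumes "\<And>z. evalp h z \<ge> 0"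
  shows "certified {[:[:- 1, 0, 1:]:]} h"
proof -
  obtain L0 where L0: "\<And>L. L \<ge> L0 \<Longrightarrow> \<exists>Q. inverts L h Q" using inverts_exists by blast
  then obtain H where H: "inverts (2 * L0) h H" by (metis le_add2 mult_2)
  have "[:[:0, 1:]:] \<noteq> (0 :: bipoly)" by simp
  then have "evalp H z \<ge> 0" for z
  proof (rule continuous_ge_dense)
    show "continuous_on UNIV (evalp H)" using continuous_on_evalp[OF continuous_on_id] by simp
    fix w assume "evalp bX w \<noteq> 0"
    then show "evalp H w \<ge> 0" using H assms by (cases w) (simp add: inverts_def power_mult)
  qed
  from certified_mono[OF certified_strip[OF this, of "- 1" 1] strip_subset_disc]
  obtain M where M: "M \<noteq> 0" "M\<^sup>2 * H \<in> preordering {[:[:1, 0, - 1:]:]}" by (auto simp: certified_def)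
  obtain L Q where Q: "Q \<in> preordering {[:[:- 1, 0, 1:]:]}" "inverts (2 * L) (M\<^sup>2 * H) Q"
    using inverts_preordering[OF M(2)] by blast
  obtain L1 M' where M': "inverts L1 M M'" using inverts_exists by blast
  have H': "evalp H (1 / x, y) * x ^ (2 * L0) = evalp h (x, y)" if "x \<noteq> 0" for x y
    using H that by (simp add: inverts_def field_simps power_one_over)
  have eq: "(M' * bX ^ L)\<^sup>2 * h = (bX ^ (L1 + L0))\<^sup>2 * Q"
  proof (rule evalp_eqI_nonzero[of bX])
    fix z assume "evalp bX z \<noteq> 0"
    obtain x y where z: "z = (x, y)" by (cases z)
    have x: "x \<noteq> 0" using \<open>evalp bX z \<noteq> 0\<close> z by simp
    have "evalp Q (x, y) = x ^ (2 * L) * ((evalp M (1 / x, y))\<^sup>2 * evalp H (1 / x, y))"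
      using Q(2) x by (simp add: inverts_def)
    then have "(x ^ (L1 + L0))\<^sup>2 * evalp Q (x, y)
        = (x ^ L1 * evalp M (1 / x, y) * x ^ L)\<^sup>2 * (evalp H (1 / x, y) * x ^ (2 * L0))"
      by (simp add: power_add power_mult power_mult_distrib mult_ac power2_eq_square power_mult[symmetric])
    then show "evalp ((M' * bX ^ L)\<^sup>2 * h) z = evalp ((bX ^ (L1 + L0))\<^sup>2 * Q) z"
      using M' x unfolding H'[OF x] by (simp add: z inverts_def)
  qed simp
  have "(bX ^ (L1 + L0))\<^sup>2 * Q \<in> preordering {[:[:- 1, 0, 1:]:]}"
    using Q(1) by (intro preordering.mult preordering.square)
  moreover have "M' \<noteq> 0"
  proof
    assume "M' = 0"
    have "M = 0"
    proof (rule evalp_eq_0_of_const_mult[of "[:0, 1:]"])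
      fix x y :: real assume "poly [:0, 1:] x \<noteq> 0"
      then have "x \<noteq> 0" by simp
      then show "evalp M (x, y) = 0"
        using M' \<open>M' = 0\<close> unfolding inverts_def by (auto dest: spec[of _ "1 / x"])
    qed simp
    then show False using M(1) by simp
  qed
  ultimately show ?thesis unfolding certified_def eq[symmetric]
    by (intro exI[of _ "M' * bX ^ L"]) simp
qed

text \<open>Hilbert's 17th problem for the plane: the regions 1 - x^2 \<ge> 0 and 1 - x^2 \<le> 0
  are merged with no further generators.\<close>

theorem nonneg_square_mult_sos:
  assumes "\<And>z. evalp h z \<ge> 0"
  shows "\<exists>M. M \<noteq> 0 \<and> is_sos (M\<^sup>2 * h)"
proof -
  have "certified {[:[:1, 0, - 1:]:]} h"
    by (rule certified_mono[OF certified_strip[OF assms, of "- 1" 1] strip_subset_disc]) simp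
  moreover have "certified {- [:[:1, 0, - 1:]:]} h" using certified_outside[OF assms] by simp
  ultimately have "certified {} h" by (rule certified_merge[of _ "{}" _ UNIV]) auto
  then show ?thesis unfolding certified_def using preordering_empty_is_sos by blast
qed

section \<open>The Cassels-Pfister theorem\<close>

text \<open>The approximating vector must have a single denominator in x, so one multiplier has to
  serve all components.\<close>

lemma common_pseudo_division:
  fixes M :: bipoly
  assumes "M \<noteq> 0"
  shows "\<exists>c. c \<noteq> 0 \<and> (\<forall>g\<in>set gs. \<exists>q r. [:c:] * g = M * q + r \<and> (r = 0 \<or> degree r < degree M))"
proof (induction gs)
  case Nil
  then show ?case by (intro exI[of _ 1]) auto
next
  case (Cons g gs)
  then obtain c where c: "c \<noteq> 0"
    "\<And>g. g \<in> set gs \<Longrightarrow> \<exists>q r. [:c:] * g = M * q + r \<and> (r = 0 \<or> degree r < degree M)" by blast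
  obtain q r where qr: "pseudo_divmod g M = (q, r)" by fastforce
  define b where "b = coeff M (degree M) ^ (Suc (degree g) - degree M)"
  have b: "b \<noteq> 0" "smult b g = M * q + r" "r = 0 \<or> degree r < degree M"
    using pseudo_divmod[OF assms qr] assms by (auto simp: b_def)
  have scale: "\<exists>q' r'. [:d * e:] * g' = M * q' + r' \<and> (r' = 0 \<or> degree r' < degree M)"
    if "[:e:] * g' = M * q + r" "r = 0 \<or> degree r < degree M" for d e and g' q r :: bipoly
  proof (intro exI conjI)
    have "[:d * e:] = [:d:] * [:e:]" by simp
    then have "[:d * e:] * g' = [:d:] * ([:e:] * g')" by (simp only: mult.assoc)
    also have "\<dots> = M * ([:d:] * q) + [:d:] * r" unfolding that(1) by (simp only: algebra_simps)
    finally show "[:d * e:] * g' = M * ([:d:] * q) + [:d:] * r" .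
    show "[:d:] * r = 0 \<or> degree ([:d:] * r) < degree M"
      using that(2) degree_smult_le[of d r] by auto
  qed
  have "\<exists>q r. [:c * b:] * g' = M * q + r \<and> (r = 0 \<or> degree r < degree M)" if "g' \<in> set (g # gs)" for g'
  proof (cases "g' = g")
    case True
    then show ?thesis using scale[of b g q r c] b by simp
  next
    case False
    then have "g' \<in> set gs" using that by simp
    from c(2)[OF this] obtain q r where "[:c:] * g' = M * q + r" "r = 0 \<or> degree r < degree M" by blast
    from scale[OF this, of b] show ?thesis by (simp only: mult.commute)
  qed
  then show ?case using b(1) c(1) by (intro exI[of _ "c * b"]) auto
qed

lemma sum_list_squares_eq_0:
  fixes r :: "'a \<Rightarrow> bipoly"
  assumes "(\<Sum>g\<leftarrow>gs. (r g)\<^sup>2) = 0" "g \<in> set gs"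
  shows "r g = 0"
proof (rule evalp_eqI)
  fix z
  have "(\<Sum>g\<leftarrow>gs. (evalp (r g) z)\<^sup>2) = 0"
    using arg_cong[OF assms(1), of "\<lambda>P. evalp P z"] by (simp add: o_def)
  moreover have "(evalp (r g) z)\<^sup>2 \<le> (\<Sum>g\<leftarrow>gs. (evalp (r g) z)\<^sup>2)"
    using assms(2) by (intro member_le_sum_list) auto
  ultimately show "evalp (r g) z = evalp 0 z" by simp
qed

lemma degree_sum_list_le: "(\<And>p. p \<in> set ps \<Longrightarrow> degree p \<le> n) \<Longrightarrow> degree (sum_list ps) \<le> n"
  by (induction ps) (auto intro: degree_add_le)

text \<open>The line through \<open>g / M\<close> and the approximation \<open>q / c\<close> meets the quadric \<open>\<langle>v, v\<rangle> = h\<close> in a second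
  point, whose denominator \<open>\<langle>r, r\<rangle> / M\<close> has lower degree.\<close>

lemma cassels_pfister:
  assumes "M \<noteq> 0" "M\<^sup>2 * h = (\<Sum>g\<leftarrow>gs. g\<^sup>2)"
  shows "\<exists>s. s \<noteq> 0 \<and> is_sos ([:s:]\<^sup>2 * h)"
  using assms
proof (induction "degree M" arbitrary: M gs rule: less_induct)
  case less
  obtain c where c: "c \<noteq> 0"
    "\<And>g. g \<in> set gs \<Longrightarrow> \<exists>q r. [:c:] * g = M * q + r \<and> (r = 0 \<or> degree r < degree M)"
    using common_pseudo_division[OF less.prems(1)] by blast
  then obtain q r where qr: "\<And>g. g \<in> set gs \<Longrightarrow> [:c:] * g = M * q g + r g"
    "\<And>g. g \<in> set gs \<Longrightarrow> r g = 0 \<or> degree (r g) < degree M" by metis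
  define gg where "gg = (\<Sum>g\<leftarrow>gs. g\<^sup>2)"
  define gq where "gq = (\<Sum>g\<leftarrow>gs. g * q g)"
  define qq where "qq = (\<Sum>g\<leftarrow>gs. (q g)\<^sup>2)"
  define rr where "rr = (\<Sum>g\<leftarrow>gs. (r g)\<^sup>2)"
  have h: "M\<^sup>2 * h = gg" using less.prems(2) by (simp add: gg_def)
  have lin: "(\<Sum>g\<leftarrow>gs. (a * g + b * q g)\<^sup>2) = a\<^sup>2 * gg + 2 * a * b * gq + b\<^sup>2 * qq" for a b :: bipoly
    unfolding gg_def gq_def qq_def
    by (induction gs) (simp_all add: power2_eq_square algebra_simps)
  have "rr = (\<Sum>g\<leftarrow>gs. ([:c:] * g + (- M) * q g)\<^sup>2)"
    unfolding rr_def by (intro arg_cong[of _ _ sum_list] map_cong) (use qr(1) in \<open>auto simp: algebra_simps\<close>)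
  then have rr: "rr = [:c:]\<^sup>2 * gg - 2 * [:c:] * M * gq + M\<^sup>2 * qq" unfolding lin by simp
  show ?case
  proof (cases "rr = 0")
    case True
    \<comment> \<open>All divisions are exact, so g / M equals q / c and the denominator c depends
      on x alone.\<close>
    have "r g = 0" if "g \<in> set gs" for g
      using sum_list_squares_eq_0[of r gs] True that by (simp add: rr_def)
    then have cg: "[:c:] * g = M * q g" if "g \<in> set gs" for g using qr(1)[OF that] that by simp
    have "M\<^sup>2 * ([:c:]\<^sup>2 * h) = [:c:]\<^sup>2 * gg" unfolding h[symmetric] by (simp only: mult_ac)
    also have "\<dots> = (\<Sum>g\<leftarrow>gs. ([:c:] * g)\<^sup>2)"
      unfolding gg_def by (simp only: power_mult_distrib sum_list_const_mult)
    also have "\<dots> = (\<Sum>g\<leftarrow>gs. (M * q g)\<^sup>2)"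
      by (intro arg_cong[of _ _ sum_list] map_cong) (use cg in auto)
    also have "\<dots> = M\<^sup>2 * (\<Sum>g\<leftarrow>map q gs. g\<^sup>2)"
      by (simp only: power_mult_distrib sum_list_const_mult) (simp add: o_def)
    finally have "[:c:]\<^sup>2 * h = (\<Sum>g\<leftarrow>map q gs. g\<^sup>2)" using less.prems(1) by simp
    then show ?thesis using c(1) unfolding is_sos_def by blast
  next
    case False
    \<comment> \<open>\<open>A\<close> measures, up to c^2, how far q / c is from the quadric; the
      second intersection point is (A g + b q) / M'.\<close>
    define A where "A = qq - [:c:]\<^sup>2 * h"
    define b where "b = 2 * ([:c:] * M * h - gq)"
    define M' where "M' = A * M + [:c:] * b"
    have MM': "M * M' = rr"
    proof -
      have "M * M' = M\<^sup>2 * qq - [:c:]\<^sup>2 * (M\<^sup>2 * h) + 2 * [:c:]\<^sup>2 * (M\<^sup>2 * h) - 2 * [:c:] * M * gq"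
        unfolding M'_def A_def b_def by (simp only: algebra_simps power2_eq_square)
      also have "\<dots> = rr" unfolding rr h by (simp only: algebra_simps)
      finally show ?thesis .
    qed
    then have M'0: "M' \<noteq> 0" using False by auto
    have "(\<Sum>g\<leftarrow>map (\<lambda>g. A * g + b * q g) gs. g\<^sup>2) = A\<^sup>2 * gg + 2 * A * b * gq + b\<^sup>2 * qq"
      using lin[of A b] by (simp add: o_def)
    also have "\<dots> = A\<^sup>2 * (M\<^sup>2 * h) + A * b * (2 * [:c:] * M * h - b) + b\<^sup>2 * (A + [:c:]\<^sup>2 * h)"
      unfolding h by (simp add: A_def b_def algebra_simps)
    also have "\<dots> = M'\<^sup>2 * h"
      unfolding M'_def by (simp only: power2_eq_square algebra_simps)
    finally have eq: "M'\<^sup>2 * h = (\<Sum>g\<leftarrow>map (\<lambda>g. A * g + b * q g) gs. g\<^sup>2)" by simp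
    have "degree M > 0"
    proof (rule ccontr)
      assume "\<not> degree M > 0"
      then have "r g = 0" if "g \<in> set gs" for g using qr(2)[OF that] by auto
      then have "rr = 0" unfolding rr_def by (induction gs) auto
      then show False using False by simp
    qed
    have "degree rr \<le> 2 * (degree M - 1)"
      unfolding rr_def
    proof (rule degree_sum_list_le)
      fix p assume "p \<in> set (map (\<lambda>g. (r g)\<^sup>2) gs)"
      then obtain g where g: "g \<in> set gs" "p = (r g)\<^sup>2" by auto
      have "degree (r g) \<le> degree M - 1" using qr(2)[OF g(1)] \<open>degree M > 0\<close> by auto
      then show "degree p \<le> 2 * (degree M - 1)" unfolding g(2) using degree_power_le[of "r g" 2] by linarith
    qed
    then have "degree M + degree M' \<le> 2 * (degree M - 1)"
      unfolding MM'[symmetric] using degree_mult_eq[OF less.prems(1) M'0] by simp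
    then have "degree M' < degree M" using \<open>degree M > 0\<close> by linarith
    then show ?thesis using less.hyps M'0 eq by blast
  qed
qed

theorem nonneg_const_square_mult_sos:
  assumes "\<And>z. evalp h z \<ge> 0"
  shows "\<exists>s. s \<noteq> 0 \<and> is_sos ([:s:]\<^sup>2 * h)"
  using nonneg_square_mult_sos[OF assms] cassels_pfister unfolding is_sos_def by metis

lemma is_sos_bswap:
  assumes "is_sos P" shows "is_sos (bswap P)"
proof -
  obtain Ps where "P = (\<Sum>Q\<leftarrow>Ps. Q\<^sup>2)" using assms by (auto simp: is_sos_def)
  then have "bswap P = (\<Sum>Q\<leftarrow>map bswap Ps. Q\<^sup>2)"
    by (intro evalp_eqI) (force simp: o_def)
  then show ?thesis unfolding is_sos_def by blast
qed

lemma real_poly_dvd_uniform_power: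
  fixes s :: "real poly"
  assumes "s \<noteq> 0"
  shows "\<exists>Z \<kappa> N0. finite Z \<and> (\<forall>x. poly \<kappa> x \<noteq> 0) \<and> (\<forall>N\<ge>N0. s dvd (\<Prod>r\<in>Z. [:- r, 1:]) ^ N * \<kappa>)"
proof -
  obtain rs \<kappa> where rs: "s = (\<Prod>r\<leftarrow>rs. [:- r, 1:]) * \<kappa>" "\<forall>x. poly \<kappa> x \<noteq> 0"
    using real_poly_linear_split[OF assms] by blast
  let ?p = "\<Prod>r\<in>set rs. [:- r, 1:]"
  have "(\<Prod>r\<leftarrow>rs'. [:- r, 1:]) dvd ?p ^ length rs'" if "set rs' \<subseteq> set rs" for rs'
    using that
  proof (induction rs')
    case (Cons r rs')
    have "[:- r, 1:] dvd ?p" by (rule dvd_prodI) (use Cons in auto)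
    then have "[:- r, 1:] * (\<Prod>r\<leftarrow>rs'. [:- r, 1:]) dvd ?p * ?p ^ length rs'"
      using Cons by (intro mult_dvd_mono) auto
    then show ?case by (simp only: list.map prod_list.Cons list.size power_Suc add_Suc_right add_0_right One_nat_def)
  qed simp
  then have "(\<Prod>r\<leftarrow>rs. [:- r, 1:]) dvd ?p ^ length rs" by blast
  then have "s dvd ?p ^ N * \<kappa>" if "N \<ge> length rs" for N
    unfolding rs(1) using that by (intro mult_dvd_mono) (auto intro: dvd_trans le_imp_power_dvd)
  then show ?thesis using rs(2) by (intro exI[of _ "set rs"] exI[of _ \<kappa>] exI[of _ "length rs"]) auto
qed

section \<open>Lowest homogeneous components\<close>

definition hom_comp :: "nat \<Rightarrow> bipoly \<Rightarrow> real \<times> real \<Rightarrow> real" where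
  "hom_comp k R v = (\<Sum>i\<le>k. hcoef R i (k - i) * fst v ^ i * snd v ^ (k - i))"

text \<open>The multiplicity of \<open>P\<close> at \<open>a\<close> is at least
  \<open>m\<close>.\<close>

definition vanishes :: "real \<times> real \<Rightarrow> bipoly \<Rightarrow> nat \<Rightarrow> bool" where
  "vanishes a P m \<longleftrightarrow> (\<forall>k<m. \<forall>i\<le>k. hcoef (shift2 a P) i (k - i) = 0)"

lemma low_comp_eq: "low_comp a P (a + v) = hom_comp (low_deg a P) (shift2 a P) v"
  by (simp add: low_comp_def hom_comp_def)

lemma evalp_shift2: "evalp (shift2 a P) v = evalp P (a + v)"
proof -
  have "shift2 a P = translate (fst a) (pcompose P [:[:snd a:], 1:])"
    by (simp add: shift2_def translate_def)
  moreover have "evalp (pcompose P [:[:snd a:], 1:]) (x, y) = evalp P (x, snd a + y)" for x y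
    by (simp add: evalp_def poly_pcompose add.commute)
  ultimately show ?thesis by (cases v, cases a) simp
qed

lemma shift2_eq_0_iff: "shift2 a P = 0 \<longleftrightarrow> P = 0"
proof
  assume "shift2 a P = 0"
  then have "evalp P (a + v) = 0" for v using evalp_shift2[of a P v] by simp
  from this[of "z - a" for z] have "evalp P z = 0" for z by (metis add.commute diff_add_cancel)
  then show "P = 0" using evalp_eq_0_iff by blast
qed (simp add: shift2_def)

lemma evalp_hom_sum: "\<exists>K0. \<forall>K\<ge>K0. \<forall>v. evalp R v = (\<Sum>k\<le>K. hom_comp k R v)"
proof -
  define D where "D = (\<Sum>j\<le>degree R. degree (coeff R j))"
  have D: "degree (coeff R j) \<le> D" for j
  proof (cases "j \<le> degree R")
    case True
    then show ?thesis unfolding D_def by (intro member_le_sum) auto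
  qed (simp add: coeff_eq_0)
  have "evalp R v = (\<Sum>k\<le>K. hom_comp k R v)" if K: "K \<ge> degree R + D" for K v
  proof -
    obtain x y where v: "v = (x, y)" by (cases v)
    let ?f = "\<lambda>i j. hcoef R i j * x ^ i * y ^ j"
    have fin: "finite {(i, j). i + j \<le> K}"
      by (rule finite_subset[of _ "{..K} \<times> {..K}"]) auto
    have coeff: "poly (coeff R j) x = (\<Sum>i\<le>D. hcoef R i j * x ^ i)" for j
      unfolding poly_altdef hcoef_def
      by (rule sum.mono_neutral_left) (use D in \<open>auto simp: coeff_eq_0\<close>)
    have "evalp R v = (\<Sum>j\<le>degree R. \<Sum>i\<le>D. ?f i j)"
      unfolding v evalp_sum_coeff[OF order_refl] coeff by (simp add: sum_distrib_right)
    also have "\<dots> = (\<Sum>(i, j)\<in>{..D} \<times> {..degree R}. ?f i j)"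
      by (subst sum.swap) (simp add: sum.cartesian_product)
    also have "\<dots> = (\<Sum>(i, j)\<in>{(i, j). i + j \<le> K}. ?f i j)"
    proof (rule sum.mono_neutral_left[OF fin])
      show "{..D} \<times> {..degree R} \<subseteq> {(i, j). i + j \<le> K}" using K by auto
      have "hcoef R i j = 0" if "\<not> (i \<le> D \<and> j \<le> degree R)" for i j
        using that D[of j] by (auto simp: hcoef_def coeff_eq_0 not_le)
      then show "\<forall>z\<in>{(i, j). i + j \<le> K} - {..D} \<times> {..degree R}. (case z of (i, j) \<Rightarrow> ?f i j) = 0"
        by (metis (no_types, lifting) DiffD2 SigmaI atMost_iff case_prod_conv mult_eq_0_iff surj_pair)
    qed
    also have "\<dots> = (\<Sum>k\<le>K. \<Sum>i\<le>k. ?f i (k - i))" by (rule sum.triangle_reindex_eq)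
    finally show ?thesis by (simp add: hom_comp_def v)
  qed
  then show ?thesis by blast
qed

lemma hom_comp_scale: "hom_comp k R (s *\<^sub>R v) = s ^ k * hom_comp k R v"
  unfolding hom_comp_def sum_distrib_left
proof (rule sum.cong)
  fix i assume "i \<in> {..k}"
  then have "s ^ k = s ^ i * s ^ (k - i)" by (simp add: power_add[symmetric])
  then show "hcoef R i (k - i) * fst (s *\<^sub>R v) ^ i * snd (s *\<^sub>R v) ^ (k - i)
      = s ^ k * (hcoef R i (k - i) * fst v ^ i * snd v ^ (k - i))"
    by (simp add: power_mult_distrib)
qed simp

lemma abs_fst_le_norm: "\<bar>fst v\<bar> \<le> norm v" and abs_snd_le_norm: "\<bar>snd v\<bar> \<le> norm v" for v :: "real \<times> real"
  by (auto simp: norm_prod_def real_le_rsqrt)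

lemma hom_comp_bound: "\<bar>hom_comp k R v\<bar> \<le> (\<Sum>i\<le>k. \<bar>hcoef R i (k - i)\<bar>) * norm v ^ k"
proof -
  have "\<bar>hom_comp k R v\<bar> \<le> (\<Sum>i\<le>k. \<bar>hcoef R i (k - i) * fst v ^ i * snd v ^ (k - i)\<bar>)"
    unfolding hom_comp_def by (rule sum_abs)
  also have "\<dots> \<le> (\<Sum>i\<le>k. \<bar>hcoef R i (k - i)\<bar> * norm v ^ k)"
  proof (rule sum_mono)
    fix i assume "i \<in> {..k}"
    then have k: "norm v ^ k = norm v ^ i * norm v ^ (k - i)" by (simp add: power_add[symmetric])
    have "\<bar>fst v\<bar> ^ i * \<bar>snd v\<bar> ^ (k - i) \<le> norm v ^ i * norm v ^ (k - i)"
      by (intro mult_mono power_mono abs_fst_le_norm abs_snd_le_norm) auto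
    then show "\<bar>hcoef R i (k - i) * fst v ^ i * snd v ^ (k - i)\<bar> \<le> \<bar>hcoef R i (k - i)\<bar> * norm v ^ k"
      unfolding k abs_mult power_abs mult.assoc by (intro mult_left_mono) auto
  qed
  finally show ?thesis by (simp add: sum_distrib_right)
qed

lemma hom_comp_0: "k > 0 \<Longrightarrow> hom_comp k R 0 = 0"
  unfolding hom_comp_def by (intro sum.neutral) (auto simp: power_0_left)

lemma continuous_on_hom_comp [continuous_intros]: "continuous_on S (hom_comp k R)"
  unfolding hom_comp_def by (intro continuous_intros)

lemma hom_comp_eq_0D:
  assumes "\<And>v. hom_comp k R v = 0" "i \<le> k"
  shows "hcoef R i (k - i) = 0"
proof -
  define p where "p = (\<Sum>i\<le>k. monom (hcoef R i (k - i)) i)"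
  have "poly p x = hom_comp k R (x, 1)" for x by (simp add: p_def poly_sum poly_monom hom_comp_def)
  then have "p = 0" using assms(1) by (simp add: poly_all_0_iff_0[symmetric])
  moreover have "coeff p i = hcoef R i (k - i)" using assms(2) by (simp add: p_def coeff_sum)
  ultimately show ?thesis by simp
qed

lemma vanishes_hom_comp: "vanishes a P m \<Longrightarrow> k < m \<Longrightarrow> hom_comp k (shift2 a P) v = 0"
  by (simp add: vanishes_def hom_comp_def)

lemma vanishes_eval:
  assumes "vanishes a P m"
  shows "\<exists>K. \<forall>v. evalp P (a + v) = (\<Sum>k\<le>K. hom_comp (m + k) (shift2 a P) v)"
proof -
  obtain K0 where K0: "\<And>K v. K \<ge> K0 \<Longrightarrow> evalp (shift2 a P) v = (\<Sum>k\<le>K. hom_comp k (shift2 a P) v)"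
    using evalp_hom_sum by blast
  have "evalp P (a + v) = (\<Sum>k\<le>K0. hom_comp (m + k) (shift2 a P) v)" for v
  proof -
    have "evalp P (a + v) = (\<Sum>k\<le>m + K0. hom_comp k (shift2 a P) v)"
      using K0[of "m + K0" v] by (simp add: evalp_shift2)
    also have "\<dots> = (\<Sum>k\<in>{m..m + K0}. hom_comp k (shift2 a P) v)"
      by (rule sum.mono_neutral_right) (auto intro: vanishes_hom_comp[OF assms])
    also have "\<dots> = (\<Sum>k\<in>{0..K0}. hom_comp (k + m) (shift2 a P) v)"
      using sum.shift_bounds_cl_nat_ivl[of "\<lambda>k. hom_comp k (shift2 a P) v" 0 m K0] by (simp add: add.commute)
    finally show ?thesis by (simp add: atMost_atLeast0 add.commute)
  qed
  then show ?thesis by blast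
qed

lemma vanishes_expansion:
  assumes "vanishes a P m"
  shows "\<exists>C\<ge>0. \<forall>v. norm v \<le> 1 \<longrightarrow> \<bar>evalp P (a + v) - hom_comp m (shift2 a P) v\<bar> \<le> C * norm v ^ Suc m"
proof -
  let ?h = "\<lambda>k v. hom_comp k (shift2 a P) v"
  let ?c = "\<lambda>k. \<Sum>i\<le>k. \<bar>hcoef (shift2 a P) i (k - i)\<bar>"
  obtain K where K: "\<And>v. evalp P (a + v) = (\<Sum>k\<le>K. ?h (m + k) v)" using vanishes_eval[OF assms] by blast
  have "\<bar>evalp P (a + v) - ?h m v\<bar> \<le> (\<Sum>k\<in>{1..K}. ?c (m + k)) * norm v ^ Suc m" if "norm v \<le> 1" for v
  proof -
    have "evalp P (a + v) - ?h m v = (\<Sum>k\<in>{1..K}. ?h (m + k) v)"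
      unfolding K by (simp add: atMost_atLeast0 sum.atLeast_Suc_atMost)
    also have "\<bar>\<dots>\<bar> \<le> (\<Sum>k\<in>{1..K}. \<bar>?h (m + k) v\<bar>)" by (rule sum_abs)
    also have "\<dots> \<le> (\<Sum>k\<in>{1..K}. ?c (m + k) * norm v ^ Suc m)"
    proof (rule sum_mono)
      fix k assume k: "k \<in> {1..K}"
      have "\<bar>?h (m + k) v\<bar> \<le> ?c (m + k) * norm v ^ (m + k)" by (rule hom_comp_bound)
      also have "\<dots> \<le> ?c (m + k) * norm v ^ Suc m"
        using that k by (intro mult_left_mono power_decreasing sum_nonneg) auto
      finally show "\<bar>?h (m + k) v\<bar> \<le> ?c (m + k) * norm v ^ Suc m" .
    qed
    finally show ?thesis by (simp add: sum_distrib_right)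
  qed
  moreover have "(\<Sum>k\<in>{1..K}. ?c (m + k)) \<ge> 0" by (intro sum_nonneg) auto
  ultimately show ?thesis by blast
qed

lemma vanishes_upper_bound:
  assumes "vanishes a P m"
  shows "\<exists>K\<ge>0. \<forall>v. norm v \<le> 1 \<longrightarrow> \<bar>evalp P (a + v)\<bar> \<le> K * norm v ^ m"
proof -
  obtain C where C: "C \<ge> 0" "\<And>v. norm v \<le> 1 \<Longrightarrow> \<bar>evalp P (a + v) - hom_comp m (shift2 a P) v\<bar> \<le> C * norm v ^ Suc m"
    using vanishes_expansion[OF assms] by blast
  define K where "K = (\<Sum>i\<le>m. \<bar>hcoef (shift2 a P) i (m - i)\<bar>) + C"
  have "\<bar>evalp P (a + v)\<bar> \<le> K * norm v ^ m" if "norm v \<le> 1" for v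
  proof -
    have "C * norm v ^ Suc m \<le> C * norm v ^ m"
      using that C(1) by (intro mult_left_mono power_decreasing) auto
    then show ?thesis using C(2)[OF that] hom_comp_bound[of m "shift2 a P" v] by (simp add: K_def distrib_right)
  qed
  moreover have "K \<ge> 0" using C(1) by (simp add: K_def sum_nonneg)
  ultimately show ?thesis by blast
qed

text \<open>The remaining components contribute positive powers of s. Such limits along rays replace
  coefficient computations for lowest components of products and sums.\<close>

lemma vanishes_ray_limit:
  assumes "vanishes a P m"
  shows "((\<lambda>s. evalp P (a + s *\<^sub>R v) / s ^ m) \<longlongrightarrow> hom_comp m (shift2 a P) v) (at_right 0)"
proof -
  let ?h = "\<lambda>k. hom_comp k (shift2 a P) v"
  obtain K where K: "\<And>v. evalp P (a + v) = (\<Sum>k\<le>K. hom_comp (m + k) (shift2 a P) v)"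
    using vanishes_eval[OF assms] by blast
  have "((\<lambda>s. \<Sum>k\<le>K. s ^ k * ?h (m + k)) \<longlongrightarrow> (\<Sum>k\<le>K. 0 ^ k * ?h (m + k))) (at_right 0)"
    by (intro tendsto_intros)
  moreover have "(\<Sum>k\<le>K. 0 ^ k * ?h (m + k)) = ?h m"
    by (subst sum.remove[of _ 0]) (auto simp: power_0_left intro!: sum.neutral)
  moreover have "eventually (\<lambda>s. (\<Sum>k\<le>K. s ^ k * ?h (m + k)) = evalp P (a + s *\<^sub>R v) / s ^ m) (at_right 0)"
  proof (rule eventually_at_rightI[of 0 1])
    fix s :: real assume "s \<in> {0<..<1}"
    then show "(\<Sum>k\<le>K. s ^ k * ?h (m + k)) = evalp P (a + s *\<^sub>R v) / s ^ m"
      unfolding K hom_comp_scale by (simp add: sum_divide_distrib power_add)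
  qed simp
  ultimately show ?thesis using Lim_transform_eventually by fastforce
qed

lemma vanishes_SucI:
  assumes "vanishes a P k" "\<And>v. hom_comp k (shift2 a P) v = 0"
  shows "vanishes a P (Suc k)"
  using assms hom_comp_eq_0D[OF assms(2)] unfolding vanishes_def by (metis less_antisym)

text \<open>Along each ray the bound makes the quotient by s^k tend to 0 for every k < m, so the
  components of degree below \<open>m\<close> vanish one after the other.\<close>

lemma vanishes_of_bound:
  assumes "e > 0" "\<And>v. norm v < e \<Longrightarrow> \<bar>evalp P (a + v)\<bar> \<le> C * norm v ^ m"
  shows "vanishes a P m"
proof -
  have "vanishes a P k" if "k \<le> m" for k
    using that
  proof (induction k)
    case 0
    then show ?case by (simp add: vanishes_def)
  next
    case (Suc k)
    then have IH: "vanishes a P k" by simp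
    have "hom_comp k (shift2 a P) v = 0" for v
    proof (cases "v = 0")
      case True
      show ?thesis
      proof (cases "k = 0")
        case k0: True
        have "evalp P (a + 0) = 0" using assms(2)[of 0] assms(1) Suc.prems by (simp add: power_0_left)
        then show ?thesis using True k0 vanishes_ray_limit[of a P 0 0]
          by (simp add: vanishes_def tendsto_const_iff)
      qed (simp add: True hom_comp_0)
    next
      case False
      have lim: "((\<lambda>s. \<bar>evalp P (a + s *\<^sub>R v) / s ^ k\<bar>) \<longlongrightarrow> \<bar>hom_comp k (shift2 a P) v\<bar>) (at_right 0)"
        by (intro tendsto_rabs vanishes_ray_limit IH)
      have "((\<lambda>s. C * norm v ^ m * s ^ (m - k)) \<longlongrightarrow> C * norm v ^ m * 0 ^ (m - k)) (at_right 0)"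
        by (intro tendsto_intros)
      then have lim0: "((\<lambda>s. C * norm v ^ m * s ^ (m - k)) \<longlongrightarrow> 0) (at_right 0)"
        using Suc.prems by (simp add: power_0_left)
      have "eventually (\<lambda>s. \<bar>evalp P (a + s *\<^sub>R v) / s ^ k\<bar> \<le> C * norm v ^ m * s ^ (m - k)) (at_right 0)"
      proof (rule eventually_at_rightI[of 0 "e / norm v"])
        fix s assume s: "s \<in> {0<..<e / norm v}"
        then have "norm (s *\<^sub>R v) < e" using False by (simp add: pos_less_divide_eq)
        then have "\<bar>evalp P (a + s *\<^sub>R v)\<bar> \<le> C * norm (s *\<^sub>R v) ^ m" by (rule assms(2))
        also have "\<dots> = C * norm v ^ m * s ^ m" using s by (simp add: power_mult_distrib)
        also have "s ^ m = s ^ (m - k) * s ^ k" using Suc.prems by (simp add: power_add[symmetric])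
        finally show "\<bar>evalp P (a + s *\<^sub>R v) / s ^ k\<bar> \<le> C * norm v ^ m * s ^ (m - k)"
          using s by (simp add: abs_divide pos_divide_le_eq mult.assoc)
      qed (use assms(1) False in simp)
      from tendsto_le[OF _ lim0 lim this] show ?thesis by simp
    qed
    from vanishes_SucI[OF IH this] show ?case .
  qed
  then show ?thesis by blast
qed

lemma low_deg_properties:
  assumes "P \<noteq> 0"
  shows "vanishes a P (low_deg a P)" "\<exists>v. hom_comp (low_deg a P) (shift2 a P) v \<noteq> 0"
proof -
  let ?R = "shift2 a P"
  let ?Q = "\<lambda>m. \<exists>i\<le>m. hcoef ?R i (m - i) \<noteq> 0"
  have "?R \<noteq> 0" using assms shift2_eq_0_iff by blast
  then obtain j where "coeff ?R j \<noteq> 0" by (metis leading_coeff_0_iff)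
  then obtain i where "hcoef ?R i j \<noteq> 0" unfolding hcoef_def by (metis leading_coeff_0_iff)
  then have "?Q (i + j)" by (intro exI[of _ i]) simp
  then have "?Q (low_deg a P)" unfolding low_deg_def by (rule LeastI)
  then show "\<exists>v. hom_comp (low_deg a P) ?R v \<noteq> 0" using hom_comp_eq_0D by blast
  show "vanishes a P (low_deg a P)"
    unfolding vanishes_def low_deg_def using not_less_Least by blast
qed

text \<open>A nonzero limit after division by s^j excludes a finite limit for any larger exponent.
  Hence the exponent and the limit function are read off from ray limits.\<close>

lemma low_comp_eqI:
  assumes "\<And>v. ((\<lambda>s. evalp P (a + s *\<^sub>R v) / s ^ m) \<longlongrightarrow> F v) (at_right 0)" "F v0 \<noteq> 0"
  shows "low_deg a P = m" "low_comp a P (a + v) = F v"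
proof -
  let ?k = "low_deg a P" and ?h = "hom_comp (low_deg a P) (shift2 a P)"
  have nz: "trivial_limit (at_right (0 :: real)) = False" by simp
  have "P \<noteq> 0"
  proof
    assume "P = 0"
    then have "((\<lambda>s. 0 :: real) \<longlongrightarrow> F v0) (at_right (0 :: real))" using assms(1)[of v0] by simp
    then show False using assms(2) by (simp add: tendsto_const_iff)
  qed
  note k = low_deg_properties[OF this, of a]
  note lim = vanishes_ray_limit[OF k(1)]
  have zero: "G v = 0"
    if "i < j" and f: "((\<lambda>s. f s / s ^ j) \<longlongrightarrow> G' v) (at_right 0)" and g: "((\<lambda>s. f s / s ^ i) \<longlongrightarrow> G v) (at_right 0)"
    for i j and f :: "real \<Rightarrow> real" and G G' :: "real \<times> real \<Rightarrow> real" and v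
  proof -
    have "((\<lambda>s. s ^ (j - i) * (f s / s ^ j)) \<longlongrightarrow> 0 ^ (j - i) * G' v) (at_right 0)"
      by (intro tendsto_intros f)
    then have "((\<lambda>s. s ^ (j - i) * (f s / s ^ j)) \<longlongrightarrow> 0) (at_right 0)"
      using that(1) by (simp add: power_0_left)
    moreover have "eventually (\<lambda>s. s ^ (j - i) * (f s / s ^ j) = f s / s ^ i) (at_right 0)"
    proof (rule eventually_at_rightI[of 0 1])
      fix s :: real assume "s \<in> {0<..<1}"
      moreover have "s ^ j = s ^ (j - i) * s ^ i" using that(1) by (simp add: power_add[symmetric])
      ultimately show "s ^ (j - i) * (f s / s ^ j) = f s / s ^ i" by simp
    qed simp
    ultimately have "((\<lambda>s. f s / s ^ i) \<longlongrightarrow> 0) (at_right 0)" by (rule Lim_transform_eventually)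
    then show ?thesis using tendsto_unique[OF _ g] by simp
  qed
  have "\<not> ?k < m" using zero[of ?k m _ F _ ?h, OF _ assms(1) lim] k(2) by blast
  moreover have "\<not> m < ?k" using zero[of m ?k _ ?h v0 F, OF _ lim assms(1)] assms(2) by blast
  ultimately show eq: "low_deg a P = m" by simp
  show "low_comp a P (a + v) = F v"
    unfolding low_comp_eq using tendsto_unique[OF _ lim[of v] assms(1)[of v, folded eq]] by simp
qed

lemma low_comp_ray_limit:
  assumes "P \<noteq> 0"
  shows "((\<lambda>s. evalp P (a + s *\<^sub>R v) / s ^ low_deg a P) \<longlongrightarrow> low_comp a P (a + v)) (at_right 0)"
  unfolding low_comp_eq by (rule vanishes_ray_limit[OF low_deg_properties(1)[OF assms]])

lemma loc_pos_defI:
  assumes "\<And>v. ((\<lambda>s. evalp P (a + s *\<^sub>R v) / s ^ m) \<longlongrightarrow> F v) (at_right 0)"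
    "\<And>v. v \<noteq> 0 \<Longrightarrow> F v > 0"
  shows "loc_pos_def a P"
proof -
  have F0: "F (1, 0) \<noteq> 0" using assms(2)[of "(1, 0)"] by (force simp: zero_prod_def)
  have "P \<noteq> 0"
  proof
    assume "P = 0"
    then have "((\<lambda>s. 0 :: real) \<longlongrightarrow> F (1, 0)) (at_right (0 :: real))" using assms(1)[of "(1, 0)"] by simp
    then show False using F0 by (simp add: tendsto_const_iff)
  qed
  moreover have "low_comp a P z > 0" if "z \<noteq> a" for z
    using low_comp_eqI(2)[OF assms(1) F0, of "z - a"] assms(2)[of "z - a"] that by simp
  ultimately show ?thesis by (simp add: loc_pos_def_def)
qed

lemma loc_pos_defD:
  assumes "loc_pos_def a P"
  shows "P \<noteq> 0" "v \<noteq> 0 \<Longrightarrow> low_comp a P (a + v) > 0"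
proof -
  have "\<forall>z. z \<noteq> a \<longrightarrow> low_comp a P z > 0" using assms unfolding loc_pos_def_def by (rule conjunct2)
  moreover assume "v \<noteq> 0"
  then have "a + v \<noteq> a" by simp
  ultimately show "low_comp a P (a + v) > 0" by blast
qed (use assms in \<open>simp add: loc_pos_def_def\<close>)

lemma loc_pos_def_mult:
  assumes "loc_pos_def a P" "loc_pos_def a Q"
  shows "loc_pos_def a (P * Q)"
proof (rule loc_pos_defI)
  fix v :: "real \<times> real"
  have "((\<lambda>s. (evalp P (a + s *\<^sub>R v) / s ^ low_deg a P) * (evalp Q (a + s *\<^sub>R v) / s ^ low_deg a Q))
      \<longlongrightarrow> low_comp a P (a + v) * low_comp a Q (a + v)) (at_right 0)"
    by (intro tendsto_mult low_comp_ray_limit loc_pos_defD(1)[OF assms(1)] loc_pos_defD(1)[OF assms(2)])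
  then show "((\<lambda>s. evalp (P * Q) (a + s *\<^sub>R v) / s ^ (low_deg a P + low_deg a Q))
      \<longlongrightarrow> low_comp a P (a + v) * low_comp a Q (a + v)) (at_right 0)"
    by (simp add: power_add)
  show "low_comp a P (a + v) * low_comp a Q (a + v) > 0" if "v \<noteq> 0"
    using loc_pos_defD(2)[OF assms(1) that] loc_pos_defD(2)[OF assms(2) that] by (rule mult_pos_pos)
qed

text \<open>The lowest component has a positive minimum \<open>\<mu>\<close> on the unit circle, so
  by homogeneity it is at least \<mu> |v|^m; on the chosen ball the higher terms use up at most half
  of this.\<close>

lemma loc_pos_def_lower_bound:
  assumes "loc_pos_def a P"
  shows "\<exists>c>0. \<exists>e>0. \<forall>v. norm v < e \<longrightarrow> evalp P (a + v) \<ge> c * norm v ^ low_deg a P"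
proof -
  let ?m = "low_deg a P" and ?h = "hom_comp (low_deg a P) (shift2 a P)"
  have P: "P \<noteq> 0" using loc_pos_defD(1)[OF assms] .
  have pos: "?h v > 0" if "v \<noteq> 0" for v
    using loc_pos_defD(2)[OF assms that] by (simp add: low_comp_eq)
  have "sphere (0 :: real \<times> real) 1 \<noteq> {}" using norm_Pair[of 1 0] by (auto intro!: exI[of _ "(1, 0)"] simp: norm_Pair)
  then obtain v0 where v0: "v0 \<in> sphere 0 1" "\<And>v. v \<in> sphere 0 1 \<Longrightarrow> ?h v0 \<le> ?h v"
    using continuous_attains_inf[of "sphere 0 1" ?h] continuous_on_hom_comp by auto
  define \<mu> where "\<mu> = ?h v0"
  have \<mu>: "\<mu> > 0" unfolding \<mu>_def using v0(1) by (intro pos) auto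
  have h: "?h v \<ge> \<mu> * norm v ^ ?m" for v
  proof (cases "v = 0")
    case False
    have "?h v = norm v ^ ?m * ?h ((1 / norm v) *\<^sub>R v)"
      using hom_comp_scale[of ?m "shift2 a P" "norm v" "(1 / norm v) *\<^sub>R v"] False by simp
    moreover have "?h ((1 / norm v) *\<^sub>R v) \<ge> \<mu>" unfolding \<mu>_def using v0(2) False by simp
    ultimately show ?thesis by (simp add: mult.commute[of \<mu>] mult_left_mono)
  next
    case True
    show ?thesis
    proof (cases "?m = 0")
      case True
      then have "?h v = ?h v0" by (simp add: hom_comp_def)
      then show ?thesis using True by (simp add: \<mu>_def)
    next
      case False
      then show ?thesis using \<open>v = 0\<close> by (simp add: power_0_left hom_comp_0)
    qed
  qed
  obtain C where C: "C \<ge> 0" "\<And>v. norm v \<le> 1 \<Longrightarrow> \<bar>evalp P (a + v) - ?h v\<bar> \<le> C * norm v ^ Suc ?m"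
    using vanishes_expansion[OF low_deg_properties(1)[OF P]] by blast
  define e where "e = min 1 (\<mu> / (2 * (C + 1)))"
  have e: "e > 0" "e \<le> 1" using \<mu> C(1) by (auto simp: e_def)
  have "evalp P (a + v) \<ge> \<mu> / 2 * norm v ^ ?m" if v: "norm v < e" for v
  proof -
    have "C * norm v \<le> (C + 1) * (\<mu> / (2 * (C + 1)))"
      using v C(1) by (intro mult_mono) (auto simp: e_def)
    also have "\<dots> = \<mu> / 2" using C(1) by (simp add: field_simps)
    finally have "C * norm v * norm v ^ ?m \<le> \<mu> / 2 * norm v ^ ?m" by (rule mult_right_mono) simp
    moreover have "\<bar>evalp P (a + v) - ?h v\<bar> \<le> C * norm v * norm v ^ ?m" using C(2)[of v] v e by (simp add: mult.assoc)
    moreover have "?h v \<ge> \<mu> * norm v ^ ?m" by (rule h)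
    ultimately show ?thesis by (simp add: abs_le_iff)
  qed
  then show ?thesis using \<mu> e(1) by (intro exI[of _ "\<mu> / 2"]) auto
qed

lemma loc_pos_def_isolated:
  assumes "loc_pos_def a P"
  shows "\<exists>e>0. \<forall>z. z \<noteq> a \<longrightarrow> dist a z < e \<longrightarrow> evalp P z > 0"
proof -
  obtain c e where ce: "c > 0" "e > 0" "\<And>v. norm v < e \<Longrightarrow> evalp P (a + v) \<ge> c * norm v ^ low_deg a P"
    using loc_pos_def_lower_bound[OF assms] by blast
  have "evalp P z > 0" if "z \<noteq> a" "dist a z < e" for z
  proof -
    have "norm (z - a) < e" using that by (simp add: dist_norm norm_minus_commute)
    from ce(3)[OF this] have "evalp P z \<ge> c * norm (z - a) ^ low_deg a P" by simp
    moreover have "c * norm (z - a) ^ low_deg a P > 0" using ce(1) that by simp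
    ultimately show ?thesis by linarith
  qed
  then show ?thesis using ce(2) by blast
qed

section \<open>Transforms in the charts of a blowing-up, and limits along rays\<close>

text \<open>The chart sends (u, t) to a + u (1, t), so the component of degree m + k contributes
  u^(m+k) times its value at (1, t). For the exact multiplicity, \<open>Q\<close> defines the strict
  transform.\<close>

lemma chart1_factor:
  assumes "vanishes a P m"
  shows "\<exists>Q. (\<forall>u t. evalp P (chart1 a (u, t)) = u ^ m * evalp Q (u, t)) \<and>
    (\<forall>t. evalp Q (0, t) = hom_comp m (shift2 a P) (1, t))"
proof -
  obtain K where K: "\<And>v. evalp P (a + v) = (\<Sum>k\<le>K. hom_comp (m + k) (shift2 a P) v)"
    using vanishes_eval[OF assms] by blast
  define H where "H k = (\<Sum>i\<le>k. bcst (hcoef (shift2 a P) i (k - i)) * bY ^ (k - i))" for k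
  have H: "evalp (H k) (u, t) = hom_comp k (shift2 a P) (1, t)" for k u t by (simp add: H_def hom_comp_def)
  define Q where "Q = (\<Sum>k\<le>K. bX ^ k * H (m + k))"
  have Q: "evalp Q (u, t) = (\<Sum>k\<le>K. u ^ k * hom_comp (m + k) (shift2 a P) (1, t))" for u t
    by (simp add: Q_def H)
  have "evalp P (chart1 a (u, t)) = u ^ m * evalp Q (u, t)" for u t
  proof -
    have "chart1 a (u, t) = a + u *\<^sub>R (1, t)" by (simp add: chart1_def prod_eq_iff)
    then show ?thesis unfolding Q by (simp only: K hom_comp_scale sum_distrib_left power_add mult.assoc)
  qed
  moreover have "evalp Q (0, t) = hom_comp m (shift2 a P) (1, t)" for t
    unfolding Q by (subst sum.remove[of _ 0]) (auto simp: power_0_left intro!: sum.neutral)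
  ultimately show ?thesis by blast
qed

lemma chart2_factor:
  assumes "vanishes a P m"
  shows "\<exists>Q. (\<forall>u t. evalp P (chart2 a (t, u)) = u ^ m * evalp Q (t, u)) \<and>
    (\<forall>t. evalp Q (t, 0) = hom_comp m (shift2 a P) (t, 1))"
proof -
  obtain K where K: "\<And>v. evalp P (a + v) = (\<Sum>k\<le>K. hom_comp (m + k) (shift2 a P) v)"
    using vanishes_eval[OF assms] by blast
  define H where "H k = (\<Sum>i\<le>k. bcst (hcoef (shift2 a P) i (k - i)) * bX ^ i)" for k
  have H: "evalp (H k) (t, u) = hom_comp k (shift2 a P) (t, 1)" for k u t by (simp add: H_def hom_comp_def)
  define Q where "Q = (\<Sum>k\<le>K. bY ^ k * H (m + k))"
  have Q: "evalp Q (t, u) = (\<Sum>k\<le>K. u ^ k * hom_comp (m + k) (shift2 a P) (t, 1))" for u t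
    by (simp add: Q_def H)
  have "evalp P (chart2 a (t, u)) = u ^ m * evalp Q (t, u)" for u t
  proof -
    have "chart2 a (t, u) = a + u *\<^sub>R (t, 1)" by (simp add: chart2_def prod_eq_iff)
    then show ?thesis unfolding Q by (simp only: K hom_comp_scale sum_distrib_left power_add mult.assoc)
  qed
  moreover have "evalp Q (t, 0) = hom_comp m (shift2 a P) (t, 1)" for t
    unfolding Q by (subst sum.remove[of _ 0]) (auto simp: power_0_left intro!: sum.neutral)
  ultimately show ?thesis by blast
qed

lemma tendsto_along_ray:
  assumes "v \<noteq> (0 :: real \<times> real)" "(g \<longlongrightarrow> l) (at a)"
  shows "((\<lambda>s. g (a + s *\<^sub>R v)) \<longlongrightarrow> l) (at_right 0)"
proof (rule filterlim_compose[OF assms(2)])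
  have "((\<lambda>s :: real. a + s *\<^sub>R v) \<longlongrightarrow> a + 0 *\<^sub>R v) (at_right 0)" by (intro tendsto_intros)
  then show "filterlim (\<lambda>s :: real. a + s *\<^sub>R v) (at a) (at_right 0)"
    using assms(1) by (auto simp: filterlim_at intro!: eventually_at_rightI[of 0 1])
qed

lemma continuous_along_ray:
  fixes a v :: "real \<times> real" and g :: "real \<times> real \<Rightarrow> real"
  assumes "isCont g a"
  shows "((\<lambda>s. g (a + s *\<^sub>R v)) \<longlongrightarrow> g a) (at_right 0)"
proof -
  have "((\<lambda>s :: real. a + s *\<^sub>R v) \<longlongrightarrow> a + 0 *\<^sub>R v) (at_right 0)" by (intro tendsto_intros)
  then show ?thesis using isCont_tendsto_compose[OF assms] by simp
qed

lemma loc_pos_def_of_pos: "evalp P a > 0 \<Longrightarrow> loc_pos_def a P"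
  by (rule loc_pos_defI[where m = 0 and F = "\<lambda>_. evalp P a"])
    (simp_all add: continuous_along_ray[OF isCont_evalp])

lemma loc_pos_def_nonzero_nearby:
  assumes "loc_pos_def a P"
  shows "eventually (\<lambda>z. evalp P z > 0) (at a)"
  using loc_pos_def_isolated[OF assms] by (auto simp: eventually_at dist_commute)

section \<open>Finiteness of the zeros of a locally positive definite polynomial\<close>

text \<open>Zeros of \<open>\<pi>\<close> are isolated because \<open>q\<close> is positive in
  punctured neighbourhoods. At a zero with nonvanishing y-derivative, \<open>\<pi>\<close> changes
  sign along the vertical line and also along nearby ones, which yields further zeros arbitrarily
  close. So the y-derivative vanishes at every zero, and the Bezout identity leaves finitely many x;
  on each vertical line there are finitely many zeros.\<close>

lemma prime_elem_zeros_finite: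
  fixes \<pi> q :: bipoly
  assumes \<pi>: "prime_elem \<pi>" "\<pi> dvd q" and q: "\<And>a. loc_pos_def a q"
  shows "finite {z. evalp \<pi> z = 0}"
proof -
  have zq: "evalp q z = 0" if "evalp \<pi> z = 0" for z using that \<pi>(2) by (auto elim: dvdE)
  have isolated: "\<exists>e>0. \<forall>w. w \<noteq> z \<longrightarrow> dist z w < e \<longrightarrow> evalp \<pi> w \<noteq> 0" for z
    using loc_pos_def_isolated[OF q, of z] zq by (metis less_irrefl)
  have vert: "finite {y. evalp \<pi> (x, y) = 0}" for x
  proof -
    obtain e where e: "e > 0" "\<And>w. w \<noteq> (x, 0) \<Longrightarrow> dist (x, 0) w < e \<Longrightarrow> evalp \<pi> w \<noteq> 0"
      using isolated by blast
    have "evalp \<pi> (x, e / 2) \<noteq> 0" using e(1) by (intro e(2)) (auto simp: dist_Pair_Pair)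
    then have "map_poly (\<lambda>c. poly c x) \<pi> \<noteq> 0" by (auto simp: evalp_map_poly)
    then show ?thesis unfolding evalp_map_poly by (rule poly_roots_finite)
  qed
  show ?thesis
  proof (cases "degree \<pi> = 0")
    case True
    then obtain c where c: "\<pi> = [:c:]" by (meson degree_eq_zeroE)
    have "evalp \<pi> (x, y) \<noteq> 0" for x y
    proof
      assume "evalp \<pi> (x, y) = 0"
      then have "{y. evalp \<pi> (x, y) = 0} = UNIV" by (auto simp: c)
      then show False using vert[of x] infinite_UNIV_char_0 by metis
    qed
    then have "{z. evalp \<pi> z = 0} = {}" by auto
    then show ?thesis by (simp only: finite.emptyI)
  next
    case False
    have \<pi>0: "\<pi> \<noteq> 0" using \<pi>(1) by auto
    have "\<not> (\<exists>\<rho>. prime_elem \<rho> \<and> degree \<rho> > 0 \<and> \<rho> dvd \<pi> \<and> \<rho> dvd pderiv \<pi>)"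
    proof
      assume "\<exists>\<rho>. prime_elem \<rho> \<and> degree \<rho> > 0 \<and> \<rho> dvd \<pi> \<and> \<rho> dvd pderiv \<pi>"
      then obtain \<rho> where \<rho>: "prime_elem \<rho>" "\<rho>\<^sup>2 dvd \<pi>" using prime_square_dvd by blast
      then obtain k where "\<pi> = \<rho> * (\<rho> * k)" by (auto simp: power2_eq_square mult.assoc elim: dvdE)
      then have "is_unit \<rho> \<or> is_unit (\<rho> * k)"
        using prime_elem_imp_irreducible[OF \<pi>(1)] irreducibleD by blast
      then have "is_unit \<rho>" using is_unit_mult_iff by blast
      then show False using \<rho>(1) by (simp add: prime_elem_def)
    qed
    then obtain A B d where d: "d \<noteq> 0" "A * \<pi> + B * pderiv \<pi> = [:d:]"
      using bezout_or_common_prime[OF \<pi>0, of "pderiv \<pi>"] by blast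
    have "poly d x = 0" if xy: "evalp \<pi> (x, y) = 0" for x y
    proof -
      define p where "p x = map_poly (\<lambda>c. poly c x) \<pi>" for x
      have p: "evalp \<pi> (x, y) = poly (p x) y" for x y by (simp add: p_def evalp_map_poly)
      have p': "evalp (pderiv \<pi>) (x, y) = poly (pderiv (p x)) y" for x y
      proof -
        have "coeff (map_poly (\<lambda>c. poly c x) (pderiv \<pi>)) j = coeff (pderiv (p x)) j" for j
          by (simp add: p_def coeff_map_poly coeff_pderiv)
        then show ?thesis unfolding evalp_map_poly by (metis poly_eqI)
      qed
      have "evalp (pderiv \<pi>) (x, y) = 0"
      proof (rule ccontr)
        assume ne: "evalp (pderiv \<pi>) (x, y) \<noteq> 0"
        obtain e where e: "e > 0" "\<And>w. w \<noteq> (x, y) \<Longrightarrow> dist (x, y) w < e \<Longrightarrow> evalp \<pi> w \<noteq> 0"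
          using isolated by blast
        have "\<exists>y1 y2. y - e / 2 < y1 \<and> y1 < y2 \<and> y2 < y + e / 2 \<and> poly (p x) y1 * poly (p x) y2 < 0"
        proof -
          \<comment> \<open>Normalises the derivative to be positive; in the product of the two
            values the sign cancels.\<close>
          define \<sigma> where "\<sigma> = sgn (poly (pderiv (p x)) y)"
          have \<sigma>: "\<sigma> * \<sigma> = 1" "\<sigma> * poly (pderiv (p x)) y > 0"
            using ne p' by (auto simp: \<sigma>_def sgn_if)
          have D: "((\<lambda>y. \<sigma> * poly (p x) y) has_real_derivative \<sigma> * poly (pderiv (p x)) y) (at y)"
            by (intro DERIV_cmult poly_DERIV)
          obtain d1 where d1: "d1 > 0" "\<And>h. h > 0 \<Longrightarrow> h < d1 \<Longrightarrow> \<sigma> * poly (p x) y < \<sigma> * poly (p x) (y + h)"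
            using DERIV_pos_inc_right[OF D \<sigma>(2)] by blast
          obtain d2 where d2: "d2 > 0" "\<And>h. h > 0 \<Longrightarrow> h < d2 \<Longrightarrow> \<sigma> * poly (p x) (y - h) < \<sigma> * poly (p x) y"
            using DERIV_pos_inc_left[OF D \<sigma>(2)] by blast
          define h where "h = min (min d1 d2) (e / 2) / 2"
          have h: "h > 0" "h < d1" "h < d2" "h < e / 2" using d1(1) d2(1) e(1) by (auto simp: h_def)
          have "\<sigma> * poly (p x) (y + h) > 0" "\<sigma> * poly (p x) (y - h) < 0"
            using d1(2)[OF h(1,2)] d2(2)[OF h(1,3)] xy p by auto
          then have "(\<sigma> * poly (p x) (y - h)) * (\<sigma> * poly (p x) (y + h)) < 0" by (rule mult_neg_pos[rotated])
          moreover have "(\<sigma> * poly (p x) (y - h)) * (\<sigma> * poly (p x) (y + h))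
              = (\<sigma> * \<sigma>) * (poly (p x) (y - h) * poly (p x) (y + h))" by simp
          ultimately have "poly (p x) (y - h) * poly (p x) (y + h) < 0" using \<sigma>(1) by simp
          then show ?thesis using h by (intro exI[of _ "y - h"] exI[of _ "y + h"]) auto
        qed
        then obtain y1 y2 where y12: "y - e / 2 < y1" "y1 < y2" "y2 < y + e / 2"
          "evalp \<pi> (x, y1) * evalp \<pi> (x, y2) < 0" unfolding p by blast
        have "isCont (\<lambda>x. evalp \<pi> (x, y1) * evalp \<pi> (x, y2)) x"
          by (intro continuous_intros isCont_o2[OF _ isCont_evalp])
        then have "((\<lambda>x. evalp \<pi> (x, y1) * evalp \<pi> (x, y2)) \<longlongrightarrow> evalp \<pi> (x, y1) * evalp \<pi> (x, y2)) (at x)"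
          by (simp add: isCont_def)
        from order_tendstoD(2)[OF this y12(4)]
        obtain \<delta> where \<delta>: "\<delta> > 0" "\<And>x'. x' \<noteq> x \<Longrightarrow> dist x' x < \<delta> \<Longrightarrow> evalp \<pi> (x', y1) * evalp \<pi> (x', y2) < 0"
          unfolding eventually_at by blast
        define x' where "x' = x + min \<delta> (e / 2) / 2"
        have x': "x' \<noteq> x" "dist x' x < \<delta>" "\<bar>x' - x\<bar> < e / 2"
          using \<delta>(1) e(1) by (auto simp: x'_def dist_real_def)
        have "poly (p x') y1 * poly (p x') y2 < 0" using \<delta>(2)[OF x'(1,2)] by (simp add: p)
        then obtain y' where y': "y1 < y'" "y' < y2" "poly (p x') y' = 0" using poly_IVT[OF y12(2)] by blast
        have "dist (x, y) (x', y') \<le> \<bar>x - x'\<bar> + \<bar>y - y'\<bar>"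
          using norm_Pair_le[of "x - x'" "y - y'"] by (simp add: dist_norm)
        also have "\<dots> < e" using x'(3) y' y12 by (auto simp: abs_if split: if_splits)
        finally have "evalp \<pi> (x', y') \<noteq> 0" using e(2) x'(1) by blast
        then show False using y'(3) by (simp add: p)
      qed
      then show ?thesis using arg_cong[OF d(2), of "\<lambda>P. evalp P (x, y)"] xy by simp
    qed
    then have "{z. evalp \<pi> z = 0} \<subseteq> Sigma {x. poly d x = 0} (\<lambda>x. {y. evalp \<pi> (x, y) = 0})" by auto
    moreover have "finite (Sigma {x. poly d x = 0} (\<lambda>x. {y. evalp \<pi> (x, y) = 0}))"
      using poly_roots_finite[OF d(1)] vert by (intro finite_SigmaI)
    ultimately show ?thesis by (rule finite_subset)
  qed
qed

lemma loc_pos_def_zeros_finite: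
  assumes "\<And>a. loc_pos_def a q"
  shows "finite {z. evalp q z = 0}"
proof -
  have q0: "q \<noteq> 0" using loc_pos_defD(1)[OF assms] by blast
  let ?M = "prime_factorization q"
  have "q dvd prod_mset ?M"
    using prod_mset_prime_factorization_weak[OF q0] associated_iff_dvd by blast
  moreover have "\<exists>\<pi>\<in>set_mset M. evalp \<pi> z = 0" if "evalp (prod_mset M) z = 0" for M z
    using that by (induction M) auto
  ultimately have "{z. evalp q z = 0} \<subseteq> (\<Union>\<pi>\<in>set_mset ?M. {z. evalp \<pi> z = 0})"
    by (fastforce elim!: dvdE)
  moreover have "finite (\<Union>\<pi>\<in>set_mset ?M. {z. evalp \<pi> z = 0})"
    using prime_elem_zeros_finite[OF _ _ assms]
    by (intro finite_UN_I) (auto simp: in_prime_factors_iff prime_imp_prime_elem)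
  ultimately show ?thesis by (rule finite_subset)
qed

lemma uniform_power_root:
  assumes "finite Z" "\<And>x. poly \<kappa> x \<noteq> 0" "s = (\<Prod>r\<in>Z. [:- r, 1:]) ^ N * \<kappa>" "poly s a = (0 :: real)"
  shows "\<exists>w. s = [:- a, 1:] ^ N * w \<and> poly w a \<noteq> 0"
proof -
  have "a \<in> Z" using assms by (auto simp: poly_prod)
  then have "s = [:- a, 1:] ^ N * ((\<Prod>r\<in>Z - {a}. [:- r, 1:]) ^ N * \<kappa>)"
    using assms(1,3) prod.remove[of Z a "\<lambda>r. [:- r, 1:]"] by (simp only: power_mult_distrib mult.assoc)
  moreover have "poly ((\<Prod>r\<in>Z - {a}. [:- r, 1:]) ^ N * \<kappa>) a \<noteq> 0" using assms(1,2) by (simp add: poly_prod)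
  ultimately show ?thesis by blast
qed

text \<open>Multipliers \<open>S(x)\<close> and \<open>T(y)\<close> with all root multiplicities equal add up to a multiplier whose zeros
  \<open>(a, b)\<close> have lowest component \<open>\<alpha> (x - a)\<^sup>2\<^sup>N + \<beta> (y - b)\<^sup>2\<^sup>N\<close>.\<close>

theorem nonneg_loc_pos_def_multiplier:
  assumes "\<And>z. evalp h z \<ge> 0"
  shows "\<exists>q. is_sos q \<and> is_sos (h * q) \<and> (\<forall>a. loc_pos_def a q)"
proof -
  obtain s where s: "s \<noteq> 0" "is_sos ([:s:]\<^sup>2 * h)" using nonneg_const_square_mult_sos assms by blast
  have "evalp (bswap h) z \<ge> 0" for z using assms by (cases z) simp
  then obtain s' where s': "s' \<noteq> 0" "is_sos ([:s':]\<^sup>2 * bswap h)" using nonneg_const_square_mult_sos by blast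
  obtain Z \<kappa> N0 where Z: "finite Z" "\<forall>x. poly \<kappa> x \<noteq> 0" "\<forall>N\<ge>N0. s dvd (\<Prod>r\<in>Z. [:- r, 1:]) ^ N * \<kappa>"
    using real_poly_dvd_uniform_power[OF s(1)] by blast
  obtain Z' \<kappa>' N0' where Z': "finite Z'" "\<forall>x. poly \<kappa>' x \<noteq> 0" "\<forall>N\<ge>N0'. s' dvd (\<Prod>r\<in>Z'. [:- r, 1:]) ^ N * \<kappa>'"
    using real_poly_dvd_uniform_power[OF s'(1)] by blast
  define N where "N = max N0 N0'"
  define S where "S = (\<Prod>r\<in>Z. [:- r, 1:]) ^ N * \<kappa>"
  define T where "T = (\<Prod>r\<in>Z'. [:- r, 1:]) ^ N * \<kappa>'"
  obtain w w' where w: "S = s * w" "T = s' * w'"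
    using Z(3) Z'(3) unfolding S_def T_def N_def by (metis dvdE max.cobounded1 max.cobounded2)
  \<comment> \<open>\<open>S\<close> contains a denominator of \<open>h\<close> in x and
    \<open>T\<close> one in y, so each of the two terms of \<open>h * q\<close> is a sum of squares
    by itself.\<close>
  define q where "q = [:S:]\<^sup>2 + bswap ([:T:]\<^sup>2)"
  have q: "evalp q (x, y) = (poly S x)\<^sup>2 + (poly T y)\<^sup>2" for x y by (simp add: q_def)
  have "is_sos q" unfolding q_def by (intro is_sos_add is_sos_bswap is_sos_square)
  moreover have "is_sos (h * q)"
  proof -
    have "h * q = [:w:]\<^sup>2 * ([:s:]\<^sup>2 * h) + bswap ([:w':]\<^sup>2 * ([:s':]\<^sup>2 * bswap h))"
      by (rule evalp_eqI) (auto simp: q_def w power_mult_distrib algebra_simps)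
    then show ?thesis using s(2) s'(2) by (auto intro!: is_sos_add is_sos_bswap is_sos_mult is_sos_square)
  qed
  moreover have "loc_pos_def z q" for z
  proof -
    obtain a b where z: "z = (a, b)" by (cases z)
    show ?thesis
    proof (cases "evalp q z = 0")
      case False
      then show ?thesis using q[of a b] by (intro loc_pos_def_of_pos) (simp add: z add_nonneg_nonneg order_less_le)
    next
      case True
      then have 0: "poly S a = 0" "poly T b = 0" using q[of a b] by (auto simp: z add_nonneg_eq_0_iff)
      obtain u where u: "S = [:- a, 1:] ^ N * u" "poly u a \<noteq> 0"
        using uniform_power_root[OF Z(1) _ S_def 0(1)] Z(2) by blast
      obtain t where t: "T = [:- b, 1:] ^ N * t" "poly t b \<noteq> 0"
        using uniform_power_root[OF Z'(1) _ T_def 0(2)] Z'(2) by blast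
      let ?F = "\<lambda>v :: real \<times> real. (fst v ^ N * poly u a)\<^sup>2 + (snd v ^ N * poly t b)\<^sup>2"
      show ?thesis
      proof (rule loc_pos_defI[where m = "2 * N" and F = ?F])
        fix v :: "real \<times> real"
        have "((\<lambda>s :: real. a + s * fst v) \<longlongrightarrow> a + 0 * fst v) (at_right 0)"
          "((\<lambda>s :: real. b + s * snd v) \<longlongrightarrow> b + 0 * snd v) (at_right 0)" by (intro tendsto_intros)+
        then have lims: "((\<lambda>s. poly u (a + s * fst v)) \<longlongrightarrow> poly u a) (at_right 0)"
          "((\<lambda>s. poly t (b + s * snd v)) \<longlongrightarrow> poly t b) (at_right 0)"
          using isCont_tendsto_compose[OF poly_isCont] by simp_all
        have "((\<lambda>s. (fst v ^ N * poly u (a + s * fst v))\<^sup>2 + (snd v ^ N * poly t (b + s * snd v))\<^sup>2) \<longlongrightarrow> ?F v) (at_right 0)"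
          by (intro tendsto_add tendsto_power tendsto_mult tendsto_const lims)
        moreover have "eventually (\<lambda>s. (fst v ^ N * poly u (a + s * fst v))\<^sup>2 + (snd v ^ N * poly t (b + s * snd v))\<^sup>2
            = evalp q (z + s *\<^sub>R v) / s ^ (2 * N)) (at_right 0)"
        proof (rule eventually_at_rightI[of 0 1])
          fix s :: real assume s: "s \<in> {0<..<1}"
          have "z + s *\<^sub>R v = (a + s * fst v, b + s * snd v)" by (simp add: z prod_eq_iff)
          then have "evalp q (z + s *\<^sub>R v)
              = s ^ (2 * N) * ((fst v ^ N * poly u (a + s * fst v))\<^sup>2 + (snd v ^ N * poly t (b + s * snd v))\<^sup>2)"
            by (simp add: q u(1) t(1) power_mult_distrib power_mult[symmetric] mult.commute distrib_left)
          then show "(fst v ^ N * poly u (a + s * fst v))\<^sup>2 + (snd v ^ N * poly t (b + s * snd v))\<^sup>2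
              = evalp q (z + s *\<^sub>R v) / s ^ (2 * N)" using s by simp
        qed simp
        ultimately show "((\<lambda>s. evalp q (z + s *\<^sub>R v) / s ^ (2 * N)) \<longlongrightarrow> ?F v) (at_right 0)"
          by (rule Lim_transform_eventually)
        assume "v \<noteq> 0"
        then have "fst v ^ N * poly u a \<noteq> 0 \<or> snd v ^ N * poly t b \<noteq> 0" using u(2) t(2) by (auto simp: prod_eq_iff)
        then show "?F v > 0" by (simp only: sum_power2_gt_zero_iff)
      qed
    qed
  qed
  ultimately show ?thesis by blast
qed

section \<open>Quotients that become regular after one blowing-up\<close>

lemma reg_at_quotient:
  assumes "evalp Q z \<noteq> 0" "\<And>w. evalp Q w \<noteq> 0 \<Longrightarrow> g w = evalp P w / evalp Q w"
  shows "reg_at g z"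
proof -
  have "open {w. evalp Q w \<noteq> 0}"
    by (intro open_Collect_neq continuous_intros)
  moreover have "z \<in> {w. evalp Q w \<noteq> 0}" using assms(1) by simp
  ultimately obtain e where "e > 0" "ball z e \<subseteq> {w. evalp Q w \<noteq> 0}"
    by (rule openE)
  then show ?thesis unfolding reg_at_def using assms(2) by blast
qed

text \<open>A finite limit makes \<open>r\<close> bounded by a multiple of \<open>D\<close>, hence
  of order |v|^k; comparing limits along rays then gives the proportionality of the
  components.\<close>

lemma quotient_vanishes:
  assumes D: "loc_pos_def a D" and lim: "((\<lambda>z. evalp r z / evalp D z) \<longlongrightarrow> l) (at a)"
  shows "vanishes a r (low_deg a D)" "hom_comp (low_deg a D) (shift2 a r) v = l * hom_comp (low_deg a D) (shift2 a D) v"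
proof -
  let ?k = "low_deg a D"
  have D0: "D \<noteq> 0" using loc_pos_defD(1)[OF D] .
  note Dv = low_deg_properties(1)[OF D0, of a]
  obtain K where Dle: "\<And>v. norm v \<le> 1 \<Longrightarrow> \<bar>evalp D (a + v)\<bar> \<le> K * norm v ^ ?k"
    using vanishes_upper_bound[OF Dv] by blast
  have "((\<lambda>z. evalp r z / evalp D z * evalp D z) \<longlongrightarrow> l * evalp D a) (at a)"
    using lim isCont_evalp[of a D] by (intro tendsto_mult) (auto simp: isCont_def)
  moreover have "eventually (\<lambda>z. evalp r z / evalp D z * evalp D z = evalp r z) (at a)"
    using loc_pos_def_nonzero_nearby[OF D] by eventually_elim simp
  ultimately have "(evalp r \<longlongrightarrow> l * evalp D a) (at a)" by (rule Lim_transform_eventually)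
  then have ra: "evalp r a = l * evalp D a" using isCont_evalp[of a r] tendsto_unique[OF _ _, of "at a"]
    by (simp add: isCont_def trivial_limit_within islimpt_UNIV)
  have "eventually (\<lambda>z. \<bar>evalp r z / evalp D z\<bar> < \<bar>l\<bar> + 1) (at a)"
    using order_tendstoD(2)[OF tendsto_rabs[OF lim], of "\<bar>l\<bar> + 1"] by simp
  then have "eventually (\<lambda>z. \<bar>evalp r z\<bar> \<le> (\<bar>l\<bar> + 1) * \<bar>evalp D z\<bar>) (at a)"
    using loc_pos_def_nonzero_nearby[OF D]
    by eventually_elim (simp add: abs_divide pos_divide_less_eq)
  then obtain e where e: "e > 0" "\<And>z. z \<noteq> a \<Longrightarrow> dist z a < e \<Longrightarrow> \<bar>evalp r z\<bar> \<le> (\<bar>l\<bar> + 1) * \<bar>evalp D z\<bar>"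
    unfolding eventually_at by blast
  have rD: "\<bar>evalp r (a + v)\<bar> \<le> (\<bar>l\<bar> + 1) * \<bar>evalp D (a + v)\<bar>" if "norm v < e" for v
  proof (cases "v = 0")
    case True
    then show ?thesis using ra by (simp add: abs_mult mult_right_mono)
  next
    case False
    then show ?thesis using e(2)[of "a + v"] that by (simp add: dist_norm)
  qed
  show van: "vanishes a r ?k"
  proof (rule vanishes_of_bound[of "min e 1"])
    fix v :: "real \<times> real" assume v: "norm v < min e 1"
    have "\<bar>evalp r (a + v)\<bar> \<le> (\<bar>l\<bar> + 1) * \<bar>evalp D (a + v)\<bar>" using rD v by simp
    also have "\<dots> \<le> (\<bar>l\<bar> + 1) * (K * norm v ^ ?k)" using Dle[of v] v by (intro mult_left_mono) auto
    finally show "\<bar>evalp r (a + v)\<bar> \<le> ((\<bar>l\<bar> + 1) * K) * norm v ^ ?k" by (simp add: mult.assoc)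
  qed (use e in simp)
  show "hom_comp ?k (shift2 a r) v = l * hom_comp ?k (shift2 a D) v"
  proof (cases "v = 0")
    case True
    show ?thesis
    proof (cases "?k = 0")
      case True
      then show ?thesis using \<open>v = 0\<close> vanishes_ray_limit[OF van, of 0] vanishes_ray_limit[OF Dv, of 0] ra
        by (simp add: tendsto_const_iff)
    qed (simp add: True hom_comp_0)
  next
    case False
    have "((\<lambda>s. evalp r (a + s *\<^sub>R v) / evalp D (a + s *\<^sub>R v) * (evalp D (a + s *\<^sub>R v) / s ^ ?k))
        \<longlongrightarrow> l * hom_comp ?k (shift2 a D) v) (at_right 0)"
      by (intro tendsto_mult vanishes_ray_limit[OF Dv] tendsto_along_ray[OF False lim])
    moreover have "eventually (\<lambda>s. evalp D (a + s *\<^sub>R v) > 0) (at_right 0)"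
    proof -
      have "filterlim (\<lambda>s :: real. a + s *\<^sub>R v) (at a) (at_right 0)"
      proof -
        have "((\<lambda>s :: real. a + s *\<^sub>R v) \<longlongrightarrow> a + 0 *\<^sub>R v) (at_right 0)" by (intro tendsto_intros)
        then show ?thesis using False by (auto simp: filterlim_at intro!: eventually_at_rightI[of 0 1])
      qed
      then show ?thesis using loc_pos_def_nonzero_nearby[OF D] by (auto simp: filterlim_iff)
    qed
    then have "eventually (\<lambda>s. evalp r (a + s *\<^sub>R v) / evalp D (a + s *\<^sub>R v) * (evalp D (a + s *\<^sub>R v) / s ^ ?k)
        = evalp r (a + s *\<^sub>R v) / s ^ ?k) (at_right 0)"
      by eventually_elim simp
    ultimately have "((\<lambda>s. evalp r (a + s *\<^sub>R v) / s ^ ?k) \<longlongrightarrow> l * hom_comp ?k (shift2 a D) v) (at_right 0)"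
      by (rule Lim_transform_eventually)
    from tendsto_unique[OF _ vanishes_ray_limit[OF van] this] show ?thesis by simp
  qed
qed

text \<open>In a chart at a zero of \<open>D\<close>, numerator and denominator share the factor
  u^k. The remaining denominator is positive on the exceptional line, and the remaining quotient
  equals \<open>g a\<close> there, which matches the value of \<open>g\<close> after the
  chart.\<close>

lemma quotient_regulous0_1:
  assumes D: "\<And>a. loc_pos_def a D"
    and off: "\<And>z. evalp D z \<noteq> 0 \<Longrightarrow> g z = evalp r z / evalp D z"
    and on: "\<And>z. evalp D z = 0 \<Longrightarrow> ((\<lambda>w. evalp r w / evalp D w) \<longlongrightarrow> g z) (at z)"
  shows "regulous0_1 g"
proof -
  have D0: "D \<noteq> 0" using loc_pos_defD(1)[OF D] by blast
  have lim: "((\<lambda>w. evalp r w / evalp D w) \<longlongrightarrow> g z) (at z)" for z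
  proof (cases "evalp D z = 0")
    case False
    then have "isCont (\<lambda>w. evalp r w / evalp D w) z"
      using isCont_evalp[of z r] isCont_evalp[of z D] by (intro continuous_intros)
    then show ?thesis using off[OF False] by (simp add: isCont_def)
  qed (use on in simp)
  have "isCont g z" for z
  proof -
    have "eventually (\<lambda>w. evalp r w / evalp D w = g w) (at z)"
      using loc_pos_def_nonzero_nearby[OF D[of z]] by eventually_elim (simp add: off)
    then show ?thesis unfolding isCont_def using Lim_transform_eventually[OF lim] by blast
  qed
  then have "regulous0 g" unfolding regulous0_def using D0 off continuous_at_imp_continuous_on by blast
  moreover have "blowup_regular {z. evalp D z = 0} g"
    unfolding blowup_regular_def
  proof (intro conjI allI impI ballI)
    fix z assume "z \<notin> {z. evalp D z = 0}"
    then show "reg_at g z" using off by (intro reg_at_quotient[of D]) auto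
  next
    fix a t assume "a \<in> {z. evalp D z = 0}"
    let ?k = "low_deg a D"
    note van = quotient_vanishes[OF D lim, of a]
    note Dv = low_deg_properties(1)[OF D0, of a]
    have pos: "hom_comp ?k (shift2 a D) v > 0" if "v \<noteq> 0" for v
      using loc_pos_defD(2)[OF D that, of a] by (simp add: low_comp_eq)
    obtain r1 where r1: "\<And>u t. evalp r (chart1 a (u, t)) = u ^ ?k * evalp r1 (u, t)"
      "\<And>t. evalp r1 (0, t) = hom_comp ?k (shift2 a r) (1, t)" using chart1_factor[OF van(1)] by blast
    obtain D1 where D1: "\<And>u t. evalp D (chart1 a (u, t)) = u ^ ?k * evalp D1 (u, t)"
      "\<And>t. evalp D1 (0, t) = hom_comp ?k (shift2 a D) (1, t)" using chart1_factor[OF Dv] by blast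
    have D1pos: "evalp D1 (0, t) > 0" for t unfolding D1(2) by (rule pos) (simp add: zero_prod_def)
    show "reg_at (g \<circ> chart1 a) (0, t)"
    proof (rule reg_at_quotient)
      show "evalp D1 (0, t) \<noteq> 0" using D1pos[of t] by simp
      fix w assume w: "evalp D1 w \<noteq> 0"
      obtain u t where ut: "w = (u, t)" by (cases w)
      show "(g \<circ> chart1 a) w = evalp r1 w / evalp D1 w"
      proof (cases "u = 0")
        case True
        then have "evalp r1 w = g a * evalp D1 w" unfolding ut by (simp add: r1(2) D1(2) van(2))
        moreover have "chart1 a w = a" by (simp add: chart1_def ut True)
        ultimately show ?thesis using w by simp
      next
        case False
        then have "evalp D (chart1 a w) \<noteq> 0" using w by (simp add: ut D1(1))
        then show ?thesis using off False by (simp add: ut r1(1) D1(1))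
      qed
    qed
    obtain r2 where r2: "\<And>u t. evalp r (chart2 a (t, u)) = u ^ ?k * evalp r2 (t, u)"
      "\<And>t. evalp r2 (t, 0) = hom_comp ?k (shift2 a r) (t, 1)" using chart2_factor[OF van(1)] by blast
    obtain D2 where D2: "\<And>u t. evalp D (chart2 a (t, u)) = u ^ ?k * evalp D2 (t, u)"
      "\<And>t. evalp D2 (t, 0) = hom_comp ?k (shift2 a D) (t, 1)" using chart2_factor[OF Dv] by blast
    have D2pos: "evalp D2 (t, 0) > 0" for t unfolding D2(2) by (rule pos) (simp add: zero_prod_def)
    show "reg_at (g \<circ> chart2 a) (t, 0)"
    proof (rule reg_at_quotient)
      show "evalp D2 (t, 0) \<noteq> 0" using D2pos[of t] by simp
      fix w assume w: "evalp D2 w \<noteq> 0"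
      obtain t u where ut: "w = (t, u)" by (cases w)
      show "(g \<circ> chart2 a) w = evalp r2 w / evalp D2 w"
      proof (cases "u = 0")
        case True
        then have "evalp r2 w = g a * evalp D2 w" unfolding ut by (simp add: r2(2) D2(2) van(2))
        moreover have "chart2 a w = a" by (simp add: chart2_def ut True)
        ultimately show ?thesis using w by simp
      next
        case False
        then have "evalp D (chart2 a w) \<noteq> 0" using w by (simp add: ut D2(1))
        then show ?thesis using off False by (simp add: ut r2(1) D2(1))
      qed
    qed
  qed
  ultimately show ?thesis unfolding regulous0_1_def using loc_pos_def_zeros_finite[OF D] by blast
qed

section \<open>Sums of squares with a prescribed denominator\<close>

text \<open>The homogeneous component as a polynomial in the original coordinates; for k the lowest
  degree its values are those of \<open>low_comp\<close>.\<close>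

definition hom_poly :: "real \<times> real \<Rightarrow> nat \<Rightarrow> bipoly \<Rightarrow> bipoly" where
  "hom_poly a k P = (\<Sum>i\<le>k. bcst (hcoef (shift2 a P) i (k - i)) *
     (bX - bcst (fst a)) ^ i * (bY - bcst (snd a)) ^ (k - i))"

lemma evalp_hom_poly: "evalp (hom_poly a k P) (a + v) = hom_comp k (shift2 a P) v"
  by (simp add: hom_poly_def hom_comp_def mult.assoc)

lemma evalp_hom_poly_low_deg: "evalp (hom_poly a (low_deg a P) P) z = low_comp a P z"
  using evalp_hom_poly[of a "low_deg a P" P "z - a"] low_comp_eq[of a P "z - a"] by simp

lemma hom_poly_ray_limit:
  "((\<lambda>s. evalp (hom_poly a k P) (a + s *\<^sub>R v) / s ^ k) \<longlongrightarrow> hom_comp k (shift2 a P) v) (at_right 0)"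
proof (rule Lim_transform_eventually[OF tendsto_const])
  show "eventually (\<lambda>s. hom_comp k (shift2 a P) v = evalp (hom_poly a k P) (a + s *\<^sub>R v) / s ^ k) (at_right 0)"
    by (rule eventually_at_rightI[of 0 1]) (simp_all add: evalp_hom_poly hom_comp_scale)
qed

lemma tendsto_sum_list:
  fixes F :: "'a \<Rightarrow> 'b \<Rightarrow> real"
  shows "(\<And>r. r \<in> set rs \<Longrightarrow> (F r \<longlongrightarrow> L r) A) \<Longrightarrow> ((\<lambda>z. \<Sum>r\<leftarrow>rs. F r z) \<longlongrightarrow> (\<Sum>r\<leftarrow>rs. L r)) A"
  by (induction rs) (auto intro!: tendsto_intros)

lemma sum_list_concat_map:
  "(\<Sum>x\<leftarrow>concat (map (\<lambda>a. map (\<lambda>b. F a b) ys) xs). G x) = (\<Sum>a\<leftarrow>xs. \<Sum>b\<leftarrow>ys. G (F a b))"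
  by (induction xs) (simp_all add: o_def)

lemma lagrange_identity_list:
  fixes f g :: "'a \<Rightarrow> real"
  shows "(\<Sum>x\<leftarrow>xs. (f x)\<^sup>2) * (\<Sum>x\<leftarrow>xs. (g x)\<^sup>2) =
    (\<Sum>x\<leftarrow>xs. f x * g x)\<^sup>2 + (\<Sum>x\<leftarrow>xs. \<Sum>y\<leftarrow>xs. (f x * g y - f y * g x)\<^sup>2) / 2"
proof -
  have prod: "(\<Sum>x\<leftarrow>xs. \<Sum>y\<leftarrow>xs. p x * q y) = (\<Sum>x\<leftarrow>xs. p x) * (\<Sum>y\<leftarrow>xs. q y)" for p q :: "'a \<Rightarrow> real"
    by (simp add: sum_list_const_mult sum_list_mult_const)
  have "(f x * g y - f y * g x)\<^sup>2 = ((f x)\<^sup>2 * (g y)\<^sup>2 + (g x)\<^sup>2 * (f y)\<^sup>2) - 2 * ((f x * g x) * (f y * g y))" for x y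
    by (simp add: power2_eq_square algebra_simps)
  then have "(\<Sum>x\<leftarrow>xs. \<Sum>y\<leftarrow>xs. (f x * g y - f y * g x)\<^sup>2) =
    ((\<Sum>x\<leftarrow>xs. \<Sum>y\<leftarrow>xs. (f x)\<^sup>2 * (g y)\<^sup>2) + (\<Sum>x\<leftarrow>xs. \<Sum>y\<leftarrow>xs. (g x)\<^sup>2 * (f y)\<^sup>2))
     - 2 * (\<Sum>x\<leftarrow>xs. \<Sum>y\<leftarrow>xs. (f x * g x) * (f y * g y))"
    by (simp only: sum_list_addf sum_list_subtractf sum_list_const_mult)
  then show ?thesis unfolding prod by (simp add: power2_eq_square)
qed

text \<open>Each square is at most f D^2 and \<open>f\<close> is bounded near \<open>a\<close>, so
  every summand is bounded by a multiple of \<open>D\<close>.\<close>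

lemma sos_quotient_vanishes:
  assumes D: "loc_pos_def a D" and f: "isCont f a"
    and eq: "\<And>z. (\<Sum>r\<leftarrow>rs. (evalp r z)\<^sup>2) = f z * (evalp D z)\<^sup>2" and r: "r \<in> set rs"
  shows "vanishes a r (low_deg a D)"
proof -
  let ?k = "low_deg a D"
  obtain K where K: "\<And>v. norm v \<le> 1 \<Longrightarrow> \<bar>evalp D (a + v)\<bar> \<le> K * norm v ^ ?k"
    using vanishes_upper_bound[OF low_deg_properties(1)[OF loc_pos_defD(1)[OF D]]] by blast
  define B where "B = \<bar>f a\<bar> + 1"
  have "eventually (\<lambda>z. f z < B) (at a)"
    using f unfolding isCont_def by (rule order_tendstoD) (simp add: B_def)
  then obtain e where e: "e > 0" "\<And>z. z \<noteq> a \<Longrightarrow> dist z a < e \<Longrightarrow> f z < B"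
    unfolding eventually_at by blast
  have fB: "f (a + v) \<le> B" if "norm v < e" for v
  proof (cases "v = 0")
    case False
    then show ?thesis using e(2)[of "a + v"] that by (simp add: dist_norm)
  qed (simp add: B_def)
  show ?thesis
  proof (rule vanishes_of_bound[of "min e 1"])
    fix v :: "real \<times> real" assume v: "norm v < min e 1"
    have "(evalp r (a + v))\<^sup>2 \<le> (\<Sum>r\<leftarrow>rs. (evalp r (a + v))\<^sup>2)"
      using r by (intro member_le_sum_list) auto
    also have "\<dots> \<le> B * (evalp D (a + v))\<^sup>2" unfolding eq using fB v by (intro mult_right_mono) auto
    also have "\<dots> \<le> B\<^sup>2 * (evalp D (a + v))\<^sup>2"
      using mult_left_mono[of 1 B B] by (intro mult_right_mono) (auto simp: B_def power2_eq_square)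
    finally have "\<bar>evalp r (a + v)\<bar> \<le> \<bar>B * evalp D (a + v)\<bar>"
      by (simp add: abs_le_square_iff power_mult_distrib)
    also have "\<dots> = B * \<bar>evalp D (a + v)\<bar>" by (simp add: abs_mult B_def)
    also have "\<dots> \<le> B * (K * norm v ^ ?k)" using K[of v] v by (intro mult_left_mono) (auto simp: B_def)
    finally show "\<bar>evalp r (a + v)\<bar> \<le> (B * K) * norm v ^ ?k" by (simp add: mult.assoc)
  qed (use e in simp)
qed

text \<open>Once the lowest components cancel, r - l D is of order |v|^(k+1), while \<open>D\<close>
  is at least a multiple of |v|^k.\<close>

lemma quotient_limit:
  assumes D: "loc_pos_def a D" and r: "vanishes a r (low_deg a D)"
    and eq: "\<And>v. hom_comp (low_deg a D) (shift2 a r) v = l * hom_comp (low_deg a D) (shift2 a D) v"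
  shows "((\<lambda>z. evalp r z / evalp D z) \<longlongrightarrow> l) (at a)"
proof -
  let ?k = "low_deg a D"
  obtain C1 where C1: "C1 \<ge> 0" "\<And>v. norm v \<le> 1 \<Longrightarrow> \<bar>evalp r (a + v) - hom_comp ?k (shift2 a r) v\<bar> \<le> C1 * norm v ^ Suc ?k"
    using vanishes_expansion[OF r] by blast
  obtain C2 where C2: "C2 \<ge> 0" "\<And>v. norm v \<le> 1 \<Longrightarrow> \<bar>evalp D (a + v) - hom_comp ?k (shift2 a D) v\<bar> \<le> C2 * norm v ^ Suc ?k"
    using vanishes_expansion[OF low_deg_properties(1)[OF loc_pos_defD(1)[OF D]]] by blast
  obtain c e where ce: "c > 0" "e > 0" "\<And>v. norm v < e \<Longrightarrow> evalp D (a + v) \<ge> c * norm v ^ ?k"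
    using loc_pos_def_lower_bound[OF D] by blast
  define K where "K = (C1 + \<bar>l\<bar> * C2) / c"
  have bound: "norm (evalp r z / evalp D z - l) \<le> K * dist z a" if z: "z \<noteq> a" "dist z a < min e 1" for z
  proof -
    define v where "v = z - a"
    have v: "z = a + v" "norm v < e" "norm v \<le> 1" "norm v > 0" using z by (auto simp: v_def dist_norm)
    have "c * norm v ^ ?k > 0" using ce(1) v(4) by simp
    then have Dpos: "evalp D z > 0" "evalp D z \<ge> c * norm v ^ ?k"
      using ce(3)[OF v(2)] unfolding v(1) by linarith+
    have "evalp r z - l * evalp D z = (evalp r z - hom_comp ?k (shift2 a r) v)
        - l * (evalp D z - hom_comp ?k (shift2 a D) v)"
      by (simp add: eq algebra_simps)
    also have "\<bar>\<dots>\<bar> \<le> \<bar>evalp r z - hom_comp ?k (shift2 a r) v\<bar> + \<bar>l\<bar> * \<bar>evalp D z - hom_comp ?k (shift2 a D) v\<bar>"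
      by (metis abs_mult abs_triangle_ineq4)
    also have "\<dots> \<le> C1 * norm v ^ Suc ?k + \<bar>l\<bar> * (C2 * norm v ^ Suc ?k)"
      using C1(2)[OF v(3)] C2(2)[OF v(3)] unfolding v(1) by (intro add_mono mult_left_mono) auto
    also have "\<dots> = K * norm v * (c * norm v ^ ?k)" using ce(1) by (simp add: K_def field_simps)
    also have "\<dots> \<le> K * norm v * evalp D z"
      using Dpos(2) C1(1) C2(1) ce(1) by (intro mult_left_mono) (auto simp: K_def)
    finally have "\<bar>(evalp r z - l * evalp D z) / evalp D z\<bar> \<le> K * norm v"
      using Dpos(1) by (simp add: abs_divide pos_divide_le_eq)
    moreover have "(evalp r z - l * evalp D z) / evalp D z = evalp r z / evalp D z - l"
      using Dpos(1) by (simp add: diff_divide_distrib)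
    ultimately show ?thesis by (simp add: v_def dist_norm)
  qed
  have "((\<lambda>z. K * dist z a) \<longlongrightarrow> K * dist a a) (at a)" by (intro tendsto_intros)
  then have "((\<lambda>z. K * dist z a) \<longlongrightarrow> 0) (at a)" by simp
  moreover have "eventually (\<lambda>z. norm (evalp r z / evalp D z - l) \<le> K * dist z a) (at a)"
    unfolding eventually_at using bound ce(2) by (intro exI[of _ "min e 1"]) auto
  ultimately have "((\<lambda>z. evalp r z / evalp D z - l) \<longlongrightarrow> 0) (at a)"
    by (rule Lim_null_comparison[rotated])
  then show ?thesis by (simp add: LIM_zero_iff)
qed

text \<open>Multiplying by \<open>\<Sum> W\<^sub>r\<^sup>2 = c Q\<^sup>2\<close>, where \<open>W\<^sub>r\<close> are the lowest components of the summands \<open>r\<close> at \<open>a\<close>, and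
  applying Lagrange's identity leaves a single square whose lowest component does not vanish.\<close>

lemma sos_improve_at_point:
  fixes rs :: "bipoly list"
  assumes q: "\<And>b. loc_pos_def b q" and f: "isCont f a" "f a > 0" and D0: "loc_pos_def a D0"
    and deg: "low_deg a D0 = low_deg a q" and \<kappa>: "\<kappa> > 0"
      "\<And>v. hom_comp (low_deg a q) (shift2 a D0) v = \<kappa> * hom_comp (low_deg a q) (shift2 a q) v"
    and eq: "\<And>z. (\<Sum>r\<leftarrow>rs. (evalp r z)\<^sup>2) = f z * (evalp D0 z)\<^sup>2"
  defines "Q \<equiv> hom_poly a (low_deg a q) q"
  shows "\<exists>rs'. (\<forall>z. (\<Sum>r\<leftarrow>rs'. (evalp r z)\<^sup>2) = f z * (evalp (D0 * Q) z)\<^sup>2) \<and>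
    (\<forall>r\<in>set rs'. \<exists>l. ((\<lambda>z. evalp r z / evalp (D0 * Q) z) \<longlongrightarrow> l) (at a)) \<and>
    (\<forall>b. evalp Q b \<noteq> 0 \<longrightarrow> (\<forall>r\<in>set rs. \<exists>l. ((\<lambda>z. evalp r z / evalp D0 z) \<longlongrightarrow> l) (at b)) \<longrightarrow>
      (\<forall>r\<in>set rs'. \<exists>l. ((\<lambda>z. evalp r z / evalp (D0 * Q) z) \<longlongrightarrow> l) (at b)))"
proof -
  let ?m = "low_deg a q"
  let ?hq = "hom_comp ?m (shift2 a q)"
  have van: "vanishes a r ?m" if "r \<in> set rs" for r
    using sos_quotient_vanishes[OF D0 f(1) eq that] deg by simp
  define W where "W r = hom_poly a ?m r" for r
  define hr where "hr r = hom_comp ?m (shift2 a r)" for r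
  have rlim: "((\<lambda>s. evalp r (a + s *\<^sub>R v) / s ^ ?m) \<longlongrightarrow> hr r v) (at_right 0)" if "r \<in> set rs" for r v
    unfolding hr_def by (rule vanishes_ray_limit[OF van[OF that]])
  have Wlim: "((\<lambda>s. evalp (W r) (a + s *\<^sub>R v) / s ^ ?m) \<longlongrightarrow> hr r v) (at_right 0)" for r v
    unfolding hr_def W_def by (rule hom_poly_ray_limit)
  define c where "c = f a * \<kappa>\<^sup>2"
  have c: "c > 0" using f(2) \<kappa>(1) by (simp add: c_def)
  have D0lim: "((\<lambda>s. evalp D0 (a + s *\<^sub>R v) / s ^ ?m) \<longlongrightarrow> \<kappa> * ?hq v) (at_right 0)" for v
    using vanishes_ray_limit[OF low_deg_properties(1)[OF loc_pos_defD(1)[OF D0]], of a v] \<kappa>(2) deg by simp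
  have hsum: "(\<Sum>r\<leftarrow>rs. (hr r v)\<^sup>2) = c * (?hq v)\<^sup>2" for v
  proof -
    have "((\<lambda>s. \<Sum>r\<leftarrow>rs. (evalp r (a + s *\<^sub>R v) / s ^ ?m)\<^sup>2) \<longlongrightarrow> (\<Sum>r\<leftarrow>rs. (hr r v)\<^sup>2)) (at_right 0)"
      by (intro tendsto_sum_list tendsto_power rlim)
    moreover have "(\<Sum>r\<leftarrow>rs. (evalp r (a + s *\<^sub>R v) / s ^ ?m)\<^sup>2)
        = f (a + s *\<^sub>R v) * (evalp D0 (a + s *\<^sub>R v) / s ^ ?m)\<^sup>2" for s
    proof -
      have "(\<Sum>r\<leftarrow>rs. (evalp r (a + s *\<^sub>R v) / s ^ ?m)\<^sup>2) = (\<Sum>r\<leftarrow>rs. (evalp r (a + s *\<^sub>R v))\<^sup>2) * (1 / (s ^ ?m)\<^sup>2)"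
        unfolding sum_list_mult_const[symmetric] by (simp add: power_divide)
      then show ?thesis unfolding eq by (simp add: power_divide)
    qed
    moreover have "((\<lambda>s. f (a + s *\<^sub>R v) * (evalp D0 (a + s *\<^sub>R v) / s ^ ?m)\<^sup>2) \<longlongrightarrow> f a * (\<kappa> * ?hq v)\<^sup>2) (at_right 0)"
      by (intro tendsto_mult tendsto_power D0lim continuous_along_ray f(1))
    ultimately have "(\<Sum>r\<leftarrow>rs. (hr r v)\<^sup>2) = f a * (\<kappa> * ?hq v)\<^sup>2"
      by (intro tendsto_unique[of "at_right (0 :: real)"]) auto
    then show ?thesis by (simp add: c_def power_mult_distrib)
  qed
  have Q: "evalp Q (a + v) = ?hq v" for v unfolding Q_def by (rule evalp_hom_poly)
  have Wsum: "(\<Sum>r\<leftarrow>rs. (evalp (W r) z)\<^sup>2) = c * (evalp Q z)\<^sup>2" for z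
    using hsum[of "z - a"] Q[of "z - a"] evalp_hom_poly[of a ?m _ "z - a"] by (simp add: W_def hr_def)
  \<comment> \<open>Turns the sum of the squares of the W_r from c Q^2 into Q^2.\<close>
  define \<mu> where "\<mu> = 1 / sqrt c"
  have \<mu>: "\<mu>\<^sup>2 * c = 1" using c by (simp add: \<mu>_def power_divide)
  define r1 where "r1 = bcst \<mu> * (\<Sum>r\<leftarrow>rs. r * W r)"
  \<comment> \<open>The factor 1 / sqrt 2 accounts for Lagrange's identity over ordered pairs, in
    which each difference occurs twice.\<close>
  define rr where "rr r r' = bcst (\<mu> / sqrt 2) * (r * W r' - r' * W r)" for r r'
  define rs' where "rs' = r1 # concat (map (\<lambda>r. map (\<lambda>r'. rr r r') rs) rs)"
  let ?D = "D0 * Q"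
  have sum': "(\<Sum>r\<leftarrow>rs'. (evalp r z)\<^sup>2) = f z * (evalp ?D z)\<^sup>2" for z
  proof -
    let ?f = "\<lambda>r. evalp r z" and ?g = "\<lambda>r. evalp (W r) z"
    have "(\<Sum>r\<leftarrow>rs'. (evalp r z)\<^sup>2) = (evalp r1 z)\<^sup>2 + (\<Sum>r\<leftarrow>rs. \<Sum>r'\<leftarrow>rs. (evalp (rr r r') z)\<^sup>2)"
      unfolding rs'_def by (simp add: sum_list_concat_map)
    also have "(evalp r1 z)\<^sup>2 = \<mu>\<^sup>2 * (\<Sum>r\<leftarrow>rs. ?f r * ?g r)\<^sup>2"
      by (simp add: r1_def power_mult_distrib o_def)
    also have "(\<Sum>r\<leftarrow>rs. \<Sum>r'\<leftarrow>rs. (evalp (rr r r') z)\<^sup>2)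
        = (\<Sum>r\<leftarrow>rs. \<Sum>r'\<leftarrow>rs. \<mu>\<^sup>2 / 2 * (?f r * ?g r' - ?f r' * ?g r)\<^sup>2)"
      by (simp add: rr_def power_mult_distrib power_divide)
    also have "\<dots> = \<mu>\<^sup>2 * ((\<Sum>r\<leftarrow>rs. \<Sum>r'\<leftarrow>rs. (?f r * ?g r' - ?f r' * ?g r)\<^sup>2) / 2)"
      by (simp only: sum_list_const_mult)
    also have "\<mu>\<^sup>2 * (\<Sum>r\<leftarrow>rs. ?f r * ?g r)\<^sup>2 + \<dots> = \<mu>\<^sup>2 * ((\<Sum>r\<leftarrow>rs. (?f r)\<^sup>2) * (\<Sum>r\<leftarrow>rs. (?g r)\<^sup>2))"
      unfolding lagrange_identity_list by (simp only: distrib_left)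
    also have "\<dots> = (\<mu>\<^sup>2 * c) * (f z * (evalp ?D z)\<^sup>2)" unfolding eq Wsum by (simp add: power_mult_distrib)
    finally show ?thesis by (simp add: \<mu>)
  qed
  have Dlim: "((\<lambda>s. evalp ?D (a + s *\<^sub>R v) / s ^ (2 * ?m)) \<longlongrightarrow> (\<kappa> * ?hq v) * ?hq v) (at_right 0)" for v
  proof -
    have "((\<lambda>s. (evalp D0 (a + s *\<^sub>R v) / s ^ ?m) * (evalp Q (a + s *\<^sub>R v) / s ^ ?m))
        \<longlongrightarrow> (\<kappa> * ?hq v) * ?hq v) (at_right 0)"
      unfolding Q_def by (intro tendsto_mult D0lim hom_poly_ray_limit)
    then show ?thesis by (simp add: mult_2 power_add)
  qed
  have hqpos: "?hq v > 0" if "v \<noteq> 0" for v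
    using loc_pos_defD(2)[OF q that, of a] by (simp add: low_comp_eq)
  have lpD: "loc_pos_def a ?D"
    by (rule loc_pos_defI[OF Dlim]) (use hqpos \<kappa>(1) in simp)
  have "(\<kappa> * ?hq (1, 0)) * ?hq (1, 0) \<noteq> 0" using hqpos[of "(1, 0)"] \<kappa>(1) by (simp add: zero_prod_def)
  note lowD = low_comp_eqI[OF Dlim this]
  have hD: "hom_comp (2 * ?m) (shift2 a ?D) v = (\<kappa> * ?hq v) * ?hq v" for v
    using lowD(2)[of v] by (simp add: low_comp_eq lowD(1))
  have van': "vanishes a r (2 * ?m)" if "r \<in> set rs'" for r
    using sos_quotient_vanishes[OF lpD f(1) sum' that] by (simp add: lowD(1))
  have lim_a: "\<exists>l. ((\<lambda>z. evalp r z / evalp ?D z) \<longlongrightarrow> l) (at a)"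
    if r: "r \<in> set rs'" and lim: "\<And>v. ((\<lambda>s. evalp r (a + s *\<^sub>R v) / s ^ (2 * ?m)) \<longlongrightarrow> l * ((\<kappa> * ?hq v) * ?hq v)) (at_right 0)"
    for r l
  proof -
    have "hom_comp (2 * ?m) (shift2 a r) v = l * hom_comp (2 * ?m) (shift2 a ?D) v" for v
      using tendsto_unique[OF _ vanishes_ray_limit[OF van'[OF r]] lim[of v]] by (simp add: hD)
    then show ?thesis using quotient_limit[OF lpD, of r l] van'[OF r] by (auto simp: lowD(1))
  qed
  have split: "evalp (bcst t) z * (x * y) / s ^ (2 * ?m) = t * ((x / s ^ ?m) * (y / s ^ ?m))" for t x y s z
    by (simp add: mult_2 power_add)
  have at_a: "\<exists>l. ((\<lambda>z. evalp r z / evalp ?D z) \<longlongrightarrow> l) (at a)" if r: "r \<in> set rs'" for r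
  proof -
    consider "r = r1" | x y where "x \<in> set rs" "y \<in> set rs" "r = rr x y"
      using r by (auto simp: rs'_def)
    then show ?thesis
    proof cases
      case 1
      show ?thesis
      \<comment> \<open>At lowest order the sum of r W_r is the sum of the W_r^2, that is c Q^2,
        while the denominator has lowest component \<kappa> Q^2.\<close>
      proof (rule lim_a[OF r, of "\<mu> * c / \<kappa>"])
        fix v
        have "((\<lambda>s. \<mu> * (\<Sum>x\<leftarrow>rs. (evalp x (a + s *\<^sub>R v) / s ^ ?m) * (evalp (W x) (a + s *\<^sub>R v) / s ^ ?m)))
           \<longlongrightarrow> \<mu> * (\<Sum>x\<leftarrow>rs. hr x v * hr x v)) (at_right 0)"
          by (intro tendsto_mult tendsto_const tendsto_sum_list rlim Wlim)
        moreover have "\<mu> * (\<Sum>x\<leftarrow>rs. hr x v * hr x v) = \<mu> * c / \<kappa> * ((\<kappa> * ?hq v) * ?hq v)"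
          using hsum[of v] \<kappa>(1) by (simp add: power2_eq_square)
        moreover have "\<mu> * (\<Sum>x\<leftarrow>rs. (evalp x (a + s *\<^sub>R v) / s ^ ?m) * (evalp (W x) (a + s *\<^sub>R v) / s ^ ?m))
            = evalp r (a + s *\<^sub>R v) / s ^ (2 * ?m)" for s
        proof -
          have "(\<Sum>x\<leftarrow>rs. (evalp x (a + s *\<^sub>R v) / s ^ ?m) * (evalp (W x) (a + s *\<^sub>R v) / s ^ ?m))
              = (\<Sum>x\<leftarrow>rs. evalp x (a + s *\<^sub>R v) * evalp (W x) (a + s *\<^sub>R v)) * (1 / s ^ (2 * ?m))"
            unfolding sum_list_mult_const[symmetric] by (simp add: mult_2 power_add)
          then show ?thesis by (simp add: 1 r1_def o_def)
        qed
        ultimately show "((\<lambda>s. evalp r (a + s *\<^sub>R v) / s ^ (2 * ?m)) \<longlongrightarrow> \<mu> * c / \<kappa> * ((\<kappa> * ?hq v) * ?hq v)) (at_right 0)"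
          by simp
      qed
    next
      case (2 x y)
      show ?thesis
      \<comment> \<open>Since r and W_r have the same lowest component, the antisymmetric difference
        cancels at lowest order.\<close>
      proof (rule lim_a[OF r, of 0])
        fix v
        let ?X = "\<lambda>P s. evalp P (a + s *\<^sub>R v) / s ^ ?m"
        have "((\<lambda>s. \<mu> / sqrt 2 * (?X x s * ?X (W y) s - ?X y s * ?X (W x) s))
           \<longlongrightarrow> \<mu> / sqrt 2 * (hr x v * hr y v - hr y v * hr x v)) (at_right 0)"
          by (intro tendsto_mult tendsto_const tendsto_diff rlim Wlim 2)
        moreover have "\<mu> / sqrt 2 * (?X x s * ?X (W y) s - ?X y s * ?X (W x) s) = evalp r (a + s *\<^sub>R v) / s ^ (2 * ?m)" for s
          unfolding 2(3) rr_def by (simp add: mult_2 power_add diff_divide_distrib right_diff_distrib)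
        ultimately show "((\<lambda>s. evalp r (a + s *\<^sub>R v) / s ^ (2 * ?m)) \<longlongrightarrow> 0 * ((\<kappa> * ?hq v) * ?hq v)) (at_right 0)"
          by simp
      qed
    qed
  qed
  \<comment> \<open>Where Q does not vanish, the quotients W_r / Q are continuous, so limits
    obtained earlier survive the step.\<close>
  have at_b: "\<exists>l. ((\<lambda>z. evalp r z / evalp ?D z) \<longlongrightarrow> l) (at b)"
    if Qb: "evalp Q b \<noteq> 0" and old: "\<forall>r\<in>set rs. \<exists>l. ((\<lambda>z. evalp r z / evalp D0 z) \<longlongrightarrow> l) (at b)"
      and r: "r \<in> set rs'" for b r
  proof -
    obtain l where l: "\<And>r. r \<in> set rs \<Longrightarrow> ((\<lambda>z. evalp r z / evalp D0 z) \<longlongrightarrow> l r) (at b)" using old by metis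
    have w: "((\<lambda>z. evalp (W x) z / evalp Q z) \<longlongrightarrow> evalp (W x) b / evalp Q b) (at b)" for x
      using isCont_evalp[of b "W x"] isCont_evalp[of b Q] Qb unfolding isCont_def by (intro tendsto_divide)
    let ?X = "\<lambda>P z. evalp P z / evalp D0 z" and ?Y = "\<lambda>P z. evalp (W P) z / evalp Q z"
    consider "r = r1" | x y where "x \<in> set rs" "y \<in> set rs" "r = rr x y"
      using r by (auto simp: rs'_def)
    then show ?thesis
    proof cases
      case 1
      have "((\<lambda>z. \<mu> * (\<Sum>x\<leftarrow>rs. ?X x z * ?Y x z)) \<longlongrightarrow> \<mu> * (\<Sum>x\<leftarrow>rs. l x * (evalp (W x) b / evalp Q b))) (at b)"
        by (intro tendsto_mult tendsto_const tendsto_sum_list l w)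
      moreover have "\<mu> * (\<Sum>x\<leftarrow>rs. ?X x z * ?Y x z) = evalp r z / evalp ?D z" for z
      proof -
        have "(\<Sum>x\<leftarrow>rs. ?X x z * ?Y x z) = (\<Sum>x\<leftarrow>rs. evalp x z * evalp (W x) z) * (1 / evalp ?D z)"
          unfolding sum_list_mult_const[symmetric] by simp
        then show ?thesis by (simp add: 1 r1_def o_def)
      qed
      ultimately show ?thesis by auto
    next
      case (2 x y)
      have "((\<lambda>z. \<mu> / sqrt 2 * (?X x z * ?Y y z - ?X y z * ?Y x z)) \<longlongrightarrow>
         \<mu> / sqrt 2 * (l x * (evalp (W y) b / evalp Q b) - l y * (evalp (W x) b / evalp Q b))) (at b)"
        by (intro tendsto_mult tendsto_const tendsto_diff l w 2)
      moreover have "\<mu> / sqrt 2 * (?X x z * ?Y y z - ?X y z * ?Y x z) = evalp r z / evalp ?D z" for z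
        unfolding 2(3) rr_def by (simp add: diff_divide_distrib right_diff_distrib)
      ultimately show ?thesis by auto
    qed
  qed
  show ?thesis using sum' at_a at_b by blast
qed

text \<open>The points of the product are treated one at a time; each contributes one factor to the
  denominator and preserves the limits already obtained at the others. Once all quotients have
  limits at the zeros of \<open>D\<close>, these limits extend them to continuous functions.\<close>

theorem sos_quotient_decomposition:
  assumes f: "continuous_on UNIV f" "\<And>z. f z \<ge> 0" and p: "is_sos p" and q: "is_sos q" "\<And>a. loc_pos_def a q"
    and fq: "\<And>z. f z * evalp q z = evalp p z"
  defines "D \<equiv> q * (\<Prod>a\<in>{a. evalp q a = 0 \<and> f a \<noteq> 0}. hom_poly a (low_deg a q) q)"
  shows "\<exists>fs rs. length fs = length rs \<and> (\<forall>g\<in>set fs. regulous0_1 g) \<and> (\<forall>z. f z = (\<Sum>g\<leftarrow>fs. (g z)\<^sup>2)) \<and>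
    (\<forall>i<length fs. \<forall>z. evalp D z \<noteq> 0 \<longrightarrow> (fs ! i) z = evalp (rs ! i) z / evalp D z)"
proof -
  let ?Z = "{a. evalp q a = 0 \<and> f a \<noteq> 0}"
  let ?Q = "\<lambda>a. hom_poly a (low_deg a q) q"
  have finZ: "finite ?Z" using loc_pos_def_zeros_finite[OF q(2)] by (rule rev_finite_subset) auto
  have fcont: "isCont f a" for a using f(1) continuous_on_eq_continuous_at[of UNIV f] by blast
  have Qpos: "evalp (?Q a) z > 0" if "z \<noteq> a" for a z
    using loc_pos_defD(2)[OF q(2), of "z - a" a] that by (simp add: evalp_hom_poly_low_deg)
  define E where "E A = q * (\<Prod>a\<in>A. ?Q a)" for A
  have Elim: "((\<lambda>s. evalp (E A) (a + s *\<^sub>R v) / s ^ low_deg a q)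
      \<longlongrightarrow> (\<Prod>b\<in>A. evalp (?Q b) a) * hom_comp (low_deg a q) (shift2 a q) v) (at_right 0)" for A a v
  proof -
    have "((\<lambda>s. evalp (\<Prod>b\<in>A. ?Q b) (a + s *\<^sub>R v) * (evalp q (a + s *\<^sub>R v) / s ^ low_deg a q))
        \<longlongrightarrow> evalp (\<Prod>b\<in>A. ?Q b) a * hom_comp (low_deg a q) (shift2 a q) v) (at_right 0)"
      by (intro tendsto_mult continuous_along_ray isCont_evalp vanishes_ray_limit
          low_deg_properties(1) loc_pos_defD(1)[OF q(2)])
    then show ?thesis by (simp add: E_def mult.commute)
  qed
  have hqpos: "hom_comp (low_deg a q) (shift2 a q) v > 0" if "v \<noteq> 0" for a v
    using loc_pos_defD(2)[OF q(2) that, of a] by (simp add: low_comp_eq)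
  have "\<exists>rs. (\<forall>z. (\<Sum>r\<leftarrow>rs. (evalp r z)\<^sup>2) = f z * (evalp (E A) z)\<^sup>2) \<and>
      (\<forall>b\<in>A. \<forall>r\<in>set rs. \<exists>l. ((\<lambda>z. evalp r z / evalp (E A) z) \<longlongrightarrow> l) (at b))"
    if "finite A" "A \<subseteq> ?Z" for A
    using that
  proof (induction A rule: finite_induct)
    case empty
    \<comment> \<open>As f q = p, the product p q is f q^2, a first representation with denominator
      q.\<close>
    obtain rs where rs: "p * q = (\<Sum>r\<leftarrow>rs. r\<^sup>2)" using is_sos_mult[OF p q(1)] by (auto simp: is_sos_def)
    have "(\<Sum>r\<leftarrow>rs. (evalp r z)\<^sup>2) = f z * (evalp (E {}) z)\<^sup>2" for z
      using arg_cong[OF rs, of "\<lambda>P. evalp P z"] fq[of z, symmetric]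
      by (simp add: E_def o_def power2_eq_square)
    then show ?case by blast
  next
    case (insert a A)
    then obtain rs where rs: "\<And>z. (\<Sum>r\<leftarrow>rs. (evalp r z)\<^sup>2) = f z * (evalp (E A) z)\<^sup>2"
      "\<forall>b\<in>A. \<forall>r\<in>set rs. \<exists>l. ((\<lambda>z. evalp r z / evalp (E A) z) \<longlongrightarrow> l) (at b)" by blast
    \<comment> \<open>The factors belonging to the points already treated are positive at
      \<open>a\<close>; they only scale the lowest component of \<open>q\<close> there.\<close>
    define \<kappa> where "\<kappa> = (\<Prod>b\<in>A. evalp (?Q b) a)"
    have \<kappa>: "\<kappa> > 0" unfolding \<kappa>_def using insert.hyps by (intro prod_pos Qpos) auto
    have "loc_pos_def a (E A)"
      by (rule loc_pos_defI[OF Elim]) (use hqpos \<kappa> in \<open>simp add: \<kappa>_def[symmetric]\<close>)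
    moreover have "\<kappa> * hom_comp (low_deg a q) (shift2 a q) (1, 0) \<noteq> 0"
      using hqpos[of "(1, 0)" a] \<kappa> by (simp add: zero_prod_def)
    note low = low_comp_eqI[OF Elim[of A a, folded \<kappa>_def] this]
    moreover have "hom_comp (low_deg a q) (shift2 a (E A)) v = \<kappa> * hom_comp (low_deg a q) (shift2 a q) v" for v
      using low(2)[of v] by (simp add: low_comp_eq low(1))
    moreover have "f a > 0" using insert.prems f(2)[of a] by (auto simp: order_less_le)
    ultimately obtain rs' where rs': "\<forall>z. (\<Sum>r\<leftarrow>rs'. (evalp r z)\<^sup>2) = f z * (evalp (E A * ?Q a) z)\<^sup>2"
      "\<forall>r\<in>set rs'. \<exists>l. ((\<lambda>z. evalp r z / evalp (E A * ?Q a) z) \<longlongrightarrow> l) (at a)"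
      "\<forall>b. evalp (?Q a) b \<noteq> 0 \<longrightarrow> (\<forall>r\<in>set rs. \<exists>l. ((\<lambda>z. evalp r z / evalp (E A) z) \<longlongrightarrow> l) (at b)) \<longrightarrow>
        (\<forall>r\<in>set rs'. \<exists>l. ((\<lambda>z. evalp r z / evalp (E A * ?Q a) z) \<longlongrightarrow> l) (at b))"
      using sos_improve_at_point[OF q(2) fcont _ _ _ \<kappa> _ rs(1)] by blast
    have "E (insert a A) = E A * ?Q a" using insert.hyps by (simp add: E_def mult_ac)
    moreover have "evalp (?Q a) b \<noteq> 0" if "b \<in> A" for b
      using Qpos[of b a] that insert.hyps by fastforce
    ultimately show ?case using rs' rs(2) by (intro exI[of _ rs']) auto
  qed
  from this[OF finZ order_refl] obtain rs where rs: "\<And>z. (\<Sum>r\<leftarrow>rs. (evalp r z)\<^sup>2) = f z * (evalp D z)\<^sup>2"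
    "\<And>b r. b \<in> ?Z \<Longrightarrow> r \<in> set rs \<Longrightarrow> \<exists>l. ((\<lambda>z. evalp r z / evalp D z) \<longlongrightarrow> l) (at b)"
    unfolding E_def D_def[symmetric] by blast
  have lpD: "loc_pos_def a D" for a
  proof -
    have "loc_pos_def a (?Q b)" for b
    proof (cases "a = b")
      case True
      show ?thesis unfolding True by (rule loc_pos_defI[OF hom_poly_ray_limit hqpos])
    qed (use Qpos loc_pos_def_of_pos in blast)
    then have "loc_pos_def a (\<Prod>b\<in>A. ?Q b)" for A
      by (induction A rule: infinite_finite_induct) (auto intro: loc_pos_def_mult loc_pos_def_of_pos)
    then show ?thesis unfolding D_def by (intro loc_pos_def_mult q(2))
  qed
  have Dq: "evalp q b = 0" if "evalp D b = 0" for b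
  proof (rule ccontr)
    assume ne: "evalp q b \<noteq> 0"
    then have "evalp (?Q a) b > 0" if "a \<in> ?Z" for a using that by (intro Qpos) auto
    then have "(\<Prod>a\<in>?Z. evalp (?Q a) b) > 0" by (intro prod_pos) blast
    then show False using that ne unfolding D_def by simp
  qed
  have sq: "(\<Sum>r\<leftarrow>rs. (evalp r z / evalp D z)\<^sup>2) = f z" if "evalp D z \<noteq> 0" for z
  proof -
    have "(\<Sum>r\<leftarrow>rs. (evalp r z / evalp D z)\<^sup>2) = (\<Sum>r\<leftarrow>rs. (evalp r z)\<^sup>2) * (1 / (evalp D z)\<^sup>2)"
      unfolding sum_list_mult_const[symmetric] by (simp add: power_divide)
    then show ?thesis using that by (simp add: rs(1))
  qed
  have Dne: "eventually (\<lambda>z. evalp D z \<noteq> 0) (at b)" for b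
    using loc_pos_def_nonzero_nearby[OF lpD[of b]] by eventually_elim simp
  have lim_ex: "\<exists>l. ((\<lambda>z. evalp r z / evalp D z) \<longlongrightarrow> l) (at b)" if b: "evalp D b = 0" and r: "r \<in> set rs" for b r
  proof (cases "f b = 0")
    case False
    then show ?thesis using rs(2)[OF _ r, of b] Dq[OF b] by simp
  next
    case True
    \<comment> \<open>Where \<open>f\<close> vanishes, each square is at most \<open>f\<close>, so
      all quotients tend to 0. For this reason only zeros of \<open>q\<close> with \<open>f\<close>
      nonzero contribute a factor to \<open>D\<close>.\<close>
    have "(f \<longlongrightarrow> 0) (at b)" using fcont[of b] True by (simp add: isCont_def)
    then have "((\<lambda>z. sqrt (f z)) \<longlongrightarrow> 0) (at b)" using tendsto_real_sqrt by fastforce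
    moreover have "eventually (\<lambda>z. norm (evalp r z / evalp D z) \<le> sqrt (f z)) (at b)"
      using Dne
    proof eventually_elim
      case (elim z)
      have "(evalp r z / evalp D z)\<^sup>2 \<le> (\<Sum>r\<leftarrow>rs. (evalp r z / evalp D z)\<^sup>2)"
        using r by (intro member_le_sum_list) auto
      then show ?case unfolding sq[OF elim] by (intro real_le_rsqrt) (simp only: real_norm_def power2_abs)
    qed
    ultimately have "((\<lambda>z. evalp r z / evalp D z) \<longlongrightarrow> 0) (at b)"
      by (rule Lim_null_comparison[rotated])
    then show ?thesis by blast
  qed
  define L where "L r b = (SOME l. ((\<lambda>z. evalp r z / evalp D z) \<longlongrightarrow> l) (at b))" for r b
  have L: "((\<lambda>z. evalp r z / evalp D z) \<longlongrightarrow> L r b) (at b)" if "evalp D b = 0" "r \<in> set rs" for r b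
    unfolding L_def by (rule someI_ex[OF lim_ex[OF that]])
  define g where "g r z = (if evalp D z = 0 then L r z else evalp r z / evalp D z)" for r z
  have "regulous0_1 (g r)" if "r \<in> set rs" for r
    by (rule quotient_regulous0_1[OF lpD]) (use L that in \<open>auto simp: g_def\<close>)
  moreover have "f z = (\<Sum>r\<leftarrow>rs. (g r z)\<^sup>2)" for z
  proof (cases "evalp D z = 0")
    case False
    then show ?thesis using sq[of z] by (simp add: g_def)
  next
    case True
    have "((\<lambda>w. \<Sum>r\<leftarrow>rs. (evalp r w / evalp D w)\<^sup>2) \<longlongrightarrow> (\<Sum>r\<leftarrow>rs. (L r z)\<^sup>2)) (at z)"
      by (intro tendsto_sum_list tendsto_power L True)
    moreover have "eventually (\<lambda>w. (\<Sum>r\<leftarrow>rs. (evalp r w / evalp D w)\<^sup>2) = f w) (at z)"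
      using Dne by eventually_elim (rule sq)
    ultimately have "(f \<longlongrightarrow> (\<Sum>r\<leftarrow>rs. (L r z)\<^sup>2)) (at z)" by (rule Lim_transform_eventually)
    then have "f z = (\<Sum>r\<leftarrow>rs. (L r z)\<^sup>2)"
      using fcont[of z] LIM_unique unfolding isCont_def by blast
    then show ?thesis using True by (simp add: g_def)
  qed
  ultimately show ?thesis
    by (intro exI[of _ "map g rs"] exI[of _ rs]) (auto simp: o_def g_def)
qed

section \<open>Denominators of functions regular after one blowing-up\<close>

lemma reg_at_bsubst:
  assumes f: "reg_at f (evalp S w, evalp T w)" and g: "\<And>w. g w = f (evalp S w, evalp T w)"
  shows "reg_at g w"
proof -
  obtain P Q e where e: "e > 0" "\<forall>z\<in>ball (evalp S w, evalp T w) e. evalp Q z \<noteq> 0 \<and> f z = evalp P z / evalp Q z"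
    using f unfolding reg_at_def by blast
  have "isCont (\<lambda>w. (evalp S w, evalp T w)) w"
    by (intro continuous_intros isCont_evalp)
  then obtain d where d: "d > 0" "\<And>w'. dist w' w < d \<Longrightarrow> dist (evalp S w', evalp T w') (evalp S w, evalp T w) < e"
    using e(1) unfolding continuous_at_eps_delta by blast
  have "evalp (bsubst Q S T) w' \<noteq> 0 \<and> g w' = evalp (bsubst P S T) w' / evalp (bsubst Q S T) w'"
    if "w' \<in> ball w d" for w'
    using bspec[OF e(2), of "(evalp S w', evalp T w')"] d(2)[of w'] that by (simp add: g dist_commute)
  then show ?thesis unfolding reg_at_def using d(1) by blast
qed

text \<open>At a point outside \<open>C\<close> the function itself is regular, and the charts are
  polynomial maps that contract the exceptional line to the point. So regularity in charts holds at
  every point of the plane, and \<open>C\<close> can be forgotten.\<close>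

lemma reg_at_charts:
  assumes "\<forall>z. z \<notin> C \<longrightarrow> reg_at f z" "\<forall>a\<in>C. \<forall>t. reg_at (f \<circ> chart1 a) (0, t) \<and> reg_at (f \<circ> chart2 a) (t, 0)"
  shows "reg_at (f \<circ> chart1 a) (0, t)" "reg_at (f \<circ> chart2 a) (t, 0)"
proof -
  have c1: "chart1 a w = (evalp (bcst (fst a) + bX) w, evalp (bcst (snd a) + bX * bY) w)" for w
    by (cases w) (simp add: chart1_def)
  have c2: "chart2 a w = (evalp (bcst (fst a) + bX * bY) w, evalp (bcst (snd a) + bY) w)" for w
    by (cases w) (simp add: chart2_def)
  have "reg_at (f \<circ> chart1 a) (0, t) \<and> reg_at (f \<circ> chart2 a) (t, 0)"
  proof (cases "a \<in> C")
    case False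
    then have reg: "reg_at f a" using assms(1) by blast
    have "chart1 a (0, t) = a" "chart2 a (t, 0) = a" by (simp_all add: chart1_def chart2_def)
    then show ?thesis
      using reg_at_bsubst[of f "bcst (fst a) + bX" "(0, t)" "bcst (snd a) + bX * bY" "f \<circ> chart1 a"]
        reg_at_bsubst[of f "bcst (fst a) + bX * bY" "(t, 0)" "bcst (snd a) + bY" "f \<circ> chart2 a"] reg
      unfolding c1[symmetric] c2[symmetric] by simp
  qed (use assms(2) in blast)
  then show "reg_at (f \<circ> chart1 a) (0, t)" "reg_at (f \<circ> chart2 a) (t, 0)" by auto
qed

lemma bX_dvd_iff: "bX dvd R \<longleftrightarrow> (\<forall>t. evalp R (0, t) = 0)"
proof
  assume zero: "\<forall>t. evalp R (0, t) = 0"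
  then have "map_poly (\<lambda>c. poly c 0) R = 0" by (simp add: evalp_map_poly poly_all_0_iff_0)
  then have "poly (coeff R j) 0 = 0" for j by (metis coeff_0 coeff_map_poly poly_0)
  then have "[:0, 1:] dvd coeff R j" for j using poly_eq_0_iff_dvd[of "coeff R j" 0] by simp
  then show "bX dvd R" by (simp add: const_poly_dvd_iff)
qed (auto elim!: dvdE)

text \<open>Restriction to x = 0 turns the right-hand side into a zero product whose first factor is
  a nonzero polynomial, so x divides \<open>X\<close>; one power of x is cancelled on both
  sides.\<close>

lemma bX_power_cancel:
  assumes "\<not> bX dvd Q" "bX ^ j * Y = Q * X"
  shows "Q dvd Y"
  using assms(2)
proof (induction j arbitrary: X)
  case (Suc j)
  have "map_poly (\<lambda>c. poly c 0) Q * map_poly (\<lambda>c. poly c 0) X = 0"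
  proof (rule poly_ext)
    fix t
    have "evalp (Q * X) (0, t) = 0" unfolding Suc.prems[symmetric] by simp
    then show "poly (map_poly (\<lambda>c. poly c 0) Q * map_poly (\<lambda>c. poly c 0) X) t = poly 0 t"
      by (simp add: evalp_map_poly[symmetric])
  qed
  moreover have "map_poly (\<lambda>c. poly c 0) Q \<noteq> 0" using assms(1) by (auto simp: bX_dvd_iff evalp_map_poly)
  ultimately have "map_poly (\<lambda>c. poly c 0) X = 0" by simp
  then have "bX dvd X" by (simp add: bX_dvd_iff evalp_map_poly)
  then obtain X' where X': "X = bX * X'" by (rule dvdE)
  have "bX * (bX ^ j * Y) = bX * (Q * X')" using Suc.prems by (simp only: X' power_Suc mult_ac)
  then have "bX ^ j * Y = Q * X'" by (metis mult_cancel_left pCons_eq_0_iff zero_neq_one)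
  then show ?case by (rule Suc.IH)
qed simp

lemma hom_comp_1_eq_0D:
  assumes "\<And>t. hom_comp k R (1, t) = 0"
  shows "hom_comp k R v = 0"
proof -
  define p where "p = (\<Sum>i\<le>k. monom (hcoef R i (k - i)) (k - i))"
  have "poly p t = hom_comp k R (1, t)" for t by (simp add: p_def poly_sum poly_monom hom_comp_def)
  then have p0: "p = 0" using assms by (simp add: poly_all_0_iff_0[symmetric])
  have "hcoef R i (k - i) = 0" if "i \<le> k" for i
  proof -
    have "coeff p (k - i) = (\<Sum>i'\<le>k. if i' = i then hcoef R i' (k - i') else 0)"
      unfolding p_def coeff_sum by (rule sum.cong) (use that in auto)
    then show ?thesis using p0 that by simp
  qed
  then show ?thesis by (simp add: hom_comp_def)
qed

text \<open>On the chart \<open>(u, t) \<mapsto> (a\<^sub>1 + u, a\<^sub>2 + u t)\<close> write \<open>Q = u\<^sup>m Q'\<close> and \<open>f = P\<^sub>1 / Q\<^sub>1\<close>. Since \<open>P\<close> and \<open>Q\<close>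
  are coprime, \<open>Q'\<close> divides a power of \<open>u\<close> times \<open>d\<^sub>1(u) Q\<^sub>1\<close> with \<open>d\<^sub>1(0) \<noteq> 0\<close>, hence \<open>Q'(0, t) \<noteq> 0\<close>.\<close>

lemma chart1_regular_lowest_nonzero:
  assumes bez: "A * P + B * Q = [:d:]" "d \<noteq> 0" and Q: "Q \<noteq> 0"
    and fQ: "\<And>z. f z * evalp Q z = evalp P z" and reg: "reg_at (f \<circ> chart1 a) (0, t)"
  shows "hom_comp (low_deg a Q) (shift2 a Q) (1, t) \<noteq> 0"
proof
  let ?m = "low_deg a Q"
  assume zero: "hom_comp ?m (shift2 a Q) (1, t) = 0"
  define \<phi> where "\<phi> R = bsubst R (bcst (fst a) + bX) (bcst (snd a) + bX * bY)" for R
  have \<phi>: "evalp (\<phi> R) w = evalp R (chart1 a w)" for R w by (cases w) (simp add: \<phi>_def chart1_def mult.commute)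
  obtain P1 Q1 e where e: "e > 0"
    "\<forall>w\<in>ball (0, t) e. evalp Q1 w \<noteq> 0 \<and> f (chart1 a w) = evalp P1 w / evalp Q1 w"
    using reg unfolding reg_at_def o_def by blast
  have "\<phi> P * Q1 - P1 * \<phi> Q = 0"
  proof (rule evalp_eq_0_open[of "ball (0, t) e"])
    fix w :: "real \<times> real" assume "w \<in> ball (0, t) e"
    then have "evalp Q1 w \<noteq> 0" "f (chart1 a w) = evalp P1 w / evalp Q1 w" using e(2) by auto
    then have "evalp P1 w = f (chart1 a w) * evalp Q1 w" by simp
    then show "evalp (\<phi> P * Q1 - P1 * \<phi> Q) w = 0"
      by (simp add: \<phi> fQ[of "chart1 a w", symmetric] mult_ac)
  qed (use e in auto)
  then have PQ: "\<phi> P * Q1 = P1 * \<phi> Q" by simp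
  obtain Q' where Q': "\<And>u t. evalp Q (chart1 a (u, t)) = u ^ ?m * evalp Q' (u, t)"
    "\<And>t. evalp Q' (0, t) = hom_comp ?m (shift2 a Q) (1, t)"
    using chart1_factor[OF low_deg_properties(1)[OF Q]] by blast
  have \<phi>Q: "\<phi> Q = bX ^ ?m * Q'" by (rule evalp_eqI) (force simp: \<phi> Q'(1))
  have ndvd: "\<not> bX dvd Q'"
    using low_deg_properties(2)[OF Q, of a] hom_comp_1_eq_0D unfolding bX_dvd_iff Q'(2) by blast
  define c where "c = pcompose d [:fst a, 1:]"
  have c0: "c \<noteq> 0" using bez(2) pcompose_linear_eq_0_iff by (simp add: c_def)
  obtain c1 where c1: "c = [:- 0, 1:] ^ order 0 c * c1" "\<not> [:- 0, 1:] dvd c1"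
    using order_decomp[OF c0] by blast
  have c10: "poly c1 0 \<noteq> 0" using c1(2) poly_eq_0_iff_dvd by blast
  \<comment> \<open>The cofactor obtained by pulling the Bezout identity back to the chart,
    multiplying it by Q1 and replacing \<phi> P Q1 by P1 \<phi> Q.\<close>
  define X where "X = \<phi> A * P1 + \<phi> B * Q1"
  have "\<phi> A * \<phi> P + \<phi> B * \<phi> Q = [:c:]"
  proof (rule evalp_eqI)
    fix w
    show "evalp (\<phi> A * \<phi> P + \<phi> B * \<phi> Q) w = evalp [:c:] w"
      using arg_cong[OF bez(1), of "\<lambda>R. evalp R (chart1 a w)"]
      by (simp add: \<phi> c_def poly_pcompose) (simp add: chart1_def)
  qed
  then have "[:c:] * Q1 = \<phi> A * (\<phi> P * Q1) + \<phi> B * \<phi> Q * Q1" by (metis distrib_right mult.assoc)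
  also have "\<dots> = \<phi> Q * X" unfolding PQ X_def by (simp only: algebra_simps)
  finally have eq: "bX ^ order 0 c * ([:c1:] * Q1) = Q' * (bX ^ ?m * X)"
  proof -
    assume "[:c:] * Q1 = \<phi> Q * X"
    moreover have "[:c:] = bX ^ order 0 c * [:c1:]" by (rule evalp_eqI, subst c1(1)) simp
    ultimately show ?thesis unfolding \<phi>Q by (simp only: mult_ac)
  qed
  obtain Y where "[:c1:] * Q1 = Q' * Y" using bX_power_cancel[OF ndvd eq] by (rule dvdE)
  then have "poly c1 0 * evalp Q1 (0, t) = evalp Q' (0, t) * evalp Y (0, t)"
    by (metis evalp_const_poly evalp_mult fst_conv)
  then show False using c10 bspec[OF e(2), of "(0, t)"] e(1) zero by (simp add: Q'(2))
qed

lemma bswap_low_comp: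
  assumes "Q \<noteq> 0"
  shows "hom_comp (low_deg (b, a) (bswap Q)) (shift2 (b, a) (bswap Q)) (y, x) = hom_comp (low_deg (a, b) Q) (shift2 (a, b) Q) (x, y)"
proof -
  let ?F = "\<lambda>v. hom_comp (low_deg (a, b) Q) (shift2 (a, b) Q) (snd v, fst v)"
  have lim: "((\<lambda>s. evalp (bswap Q) ((b, a) + s *\<^sub>R v) / s ^ low_deg (a, b) Q) \<longlongrightarrow> ?F v) (at_right 0)" for v
    using vanishes_ray_limit[OF low_deg_properties(1)[OF assms], of "(a, b)" "(snd v, fst v)"]
    by (cases v) simp
  obtain v0 where "hom_comp (low_deg (a, b) Q) (shift2 (a, b) Q) v0 \<noteq> 0"
    using low_deg_properties(2)[OF assms] by blast
  then have "?F (snd v0, fst v0) \<noteq> 0" by simp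
  from low_comp_eqI(2)[OF lim this, of "(y, x)", unfolded low_comp_eq] show ?thesis by simp
qed

lemma coprime_bswap:
  assumes "coprime P Q"
  shows "coprime (bswap P) (bswap Q)"
proof (rule coprimeI)
  have dvd: "bswap R dvd bswap S" if "R dvd S" for R S
  proof -
    obtain T where "S = R * T" using \<open>R dvd S\<close> by (elim dvdE) blast
    then have "bswap S = bswap R * bswap T" by (intro evalp_eqI) force
    then show ?thesis by simp
  qed
  fix R assume "R dvd bswap P" "R dvd bswap Q"
  then have "bswap R dvd P" "bswap R dvd Q" using dvd[of R "bswap P"] dvd[of R "bswap Q"] by simp_all
  then have "bswap R dvd 1" using assms coprime_common_divisor by blast
  then have "R dvd bswap 1" using dvd[of "bswap R" 1] by simp
  moreover have "bswap 1 = 1" by (rule evalp_eqI) force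
  ultimately show "is_unit R" by simp
qed

lemma coprime_bezout:
  fixes P Q :: bipoly
  assumes "coprime P Q" "Q \<noteq> 0"
  shows "\<exists>A B d. d \<noteq> 0 \<and> A * P + B * Q = [:d:]"
proof -
  have "\<not> (\<exists>\<pi>. prime_elem \<pi> \<and> degree \<pi> > 0 \<and> \<pi> dvd Q \<and> \<pi> dvd P)"
    using assms(1) coprime_common_divisor prime_elem_not_unit by blast
  then show ?thesis using bezout_or_common_prime[OF assms(2), of P] by (metis add.commute)
qed

text \<open>By homogeneity a direction with nonzero first coordinate is some (1, t) of the first
  chart. The vertical direction is the origin of the second chart, which the exchange of the
  variables turns into that of the first.\<close>

lemma blowup_regular_lowest_nonzero:
  assumes reg: "\<And>a t. reg_at (f \<circ> chart1 a) (0, t)" "\<And>a t. reg_at (f \<circ> chart2 a) (t, 0)"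
    and PQ: "coprime P Q" "Q \<noteq> 0" and fQ: "\<And>z. f z * evalp Q z = evalp P z" and "v \<noteq> 0"
  shows "hom_comp (low_deg a Q) (shift2 a Q) v \<noteq> 0"
proof (cases "fst v = 0")
  case False
  obtain A B d where "d \<noteq> 0" "A * P + B * Q = [:d:]" using coprime_bezout[OF PQ] by blast
  then have "hom_comp (low_deg a Q) (shift2 a Q) (1, snd v / fst v) \<noteq> 0"
    using chart1_regular_lowest_nonzero PQ(2) fQ reg(1) by blast
  moreover have "v = fst v *\<^sub>R (1, snd v / fst v)" using False by (simp add: prod_eq_iff)
  ultimately show ?thesis using False hom_comp_scale by (metis mult_eq_0_iff power_not_zero)
next
  case True
  then have v: "v = snd v *\<^sub>R (0, 1)" "snd v \<noteq> 0" using \<open>v \<noteq> 0\<close> by (auto simp: prod_eq_iff)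
  obtain a1 a2 where a: "a = (a1, a2)" by (cases a)
  have sQ: "bswap Q \<noteq> 0" using PQ(2) by simp
  obtain A B d where bez: "d \<noteq> 0" "A * bswap P + B * bswap Q = [:d:]"
    using coprime_bezout[OF coprime_bswap[OF PQ(1)] sQ] by blast
  define g where "g z = f (snd z, fst z)" for z
  have "reg_at (g \<circ> chart1 (a2, a1)) (0, 0)"
  proof (rule reg_at_bsubst[where S = bY and T = bX])
    show "reg_at (f \<circ> chart2 a) (evalp bY (0, 0), evalp bX (0, 0))" using reg(2)[of a 0] by simp
    show "(g \<circ> chart1 (a2, a1)) w = (f \<circ> chart2 a) (evalp bY w, evalp bX w)" for w
      by (cases w) (simp add: g_def chart1_def chart2_def a mult.commute)
  qed
  moreover have "g z * evalp (bswap Q) z = evalp (bswap P) z" for z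
    using fQ by (cases z) (simp add: g_def)
  ultimately have "hom_comp (low_deg (a2, a1) (bswap Q)) (shift2 (a2, a1) (bswap Q)) (1, 0) \<noteq> 0"
    using chart1_regular_lowest_nonzero[OF bez(2,1) sQ] by blast
  then have "hom_comp (low_deg a Q) (shift2 a Q) (0, 1) \<noteq> 0" using bswap_low_comp[OF PQ(2)] by (simp add: a)
  then show ?thesis using v hom_comp_scale by (metis mult_eq_0_iff power_not_zero)
qed

text \<open>With f = P / Q in lowest terms, P Q = f Q^2 is nonnegative. A multiplier
  \<open>s\<close> for it gives numerator P Q s and denominator Q^2 s, both sums of squares.\<close>

theorem regulous0_1_sos_representation:
  assumes "regulous0_1 f" "\<And>z. f z \<ge> 0"
  shows "\<exists>p q. is_sos p \<and> is_sos q \<and> (\<forall>a. loc_pos_def a q) \<and> (\<forall>z. f z * evalp q z = evalp p z)"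
proof -
  obtain C where cont: "continuous_on UNIV f" and reg: "blowup_regular C f"
    using assms(1) by (auto simp: regulous0_1_def regulous0_def)
  obtain P0 Q0 H where H: "H \<noteq> 0" "\<forall>z. evalp H z \<noteq> 0 \<longrightarrow> evalp Q0 z \<noteq> 0 \<and> f z = evalp P0 z / evalp Q0 z"
    using assms(1) unfolding regulous0_1_def regulous0_def by blast
  note H' = mp[OF spec[OF H(2)]]
  obtain z0 where "evalp H z0 \<noteq> 0" using H(1) evalp_eq_0_iff by blast
  then have "evalp Q0 z0 \<noteq> 0" using H' by blast
  then have "Q0 \<noteq> 0" by auto
  then have "gcd P0 Q0 \<noteq> 0" by simp
  from gcd_coprime_exists[OF this] obtain P Q where
    PQ: "P0 = P * gcd P0 Q0" "Q0 = Q * gcd P0 Q0" "coprime P Q" by blast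
  have Q: "Q \<noteq> 0" using PQ(2) \<open>Q0 \<noteq> 0\<close> by auto
  have fQ_H: "f z * evalp Q z = evalp P z" if "evalp H z \<noteq> 0" for z
  proof -
    have "evalp Q0 z = evalp Q z * evalp (gcd P0 Q0) z" "evalp P0 z = evalp P z * evalp (gcd P0 Q0) z"
      using PQ(1,2) by (metis evalp_mult)+
    then show ?thesis using H'[OF that] by auto
  qed
  have fQ: "f z * evalp Q z = evalp P z" for z
  proof (rule continuous_eq_dense[OF H(1) _ _ fQ_H])
    show "continuous_on UNIV (\<lambda>z. f z * evalp Q z)" "continuous_on UNIV (evalp P)"
      using continuous_on_evalp[OF continuous_on_id] by (auto intro!: continuous_on_mult cont)
  qed
  note charts = reg_at_charts[of C f, OF reg[unfolded blowup_regular_def, THEN conjunct1] reg[unfolded blowup_regular_def, THEN conjunct2]]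
  have low: "hom_comp (low_deg a Q) (shift2 a Q) v \<noteq> 0" if "v \<noteq> 0" for a v
    by (rule blowup_regular_lowest_nonzero[OF charts PQ(3) Q fQ that])
  have lpQ: "loc_pos_def a (Q\<^sup>2)" for a
  proof (rule loc_pos_defI[where m = "2 * low_deg a Q" and F = "\<lambda>v. (hom_comp (low_deg a Q) (shift2 a Q) v)\<^sup>2"])
    fix v
    have "((\<lambda>s. (evalp Q (a + s *\<^sub>R v) / s ^ low_deg a Q)\<^sup>2) \<longlongrightarrow> (hom_comp (low_deg a Q) (shift2 a Q) v)\<^sup>2) (at_right 0)"
      by (intro tendsto_power vanishes_ray_limit low_deg_properties(1)[OF Q])
    then show "((\<lambda>s. evalp (Q\<^sup>2) (a + s *\<^sub>R v) / s ^ (2 * low_deg a Q)) \<longlongrightarrow> (hom_comp (low_deg a Q) (shift2 a Q) v)\<^sup>2) (at_right 0)"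
      by (simp add: power_divide power_mult[symmetric] mult.commute)
  qed (use low in simp)
  have fPQ: "f z * (evalp Q z)\<^sup>2 = evalp (P * Q) z" for z using fQ[of z, symmetric] by (simp add: power2_eq_square)
  have "evalp (P * Q) z \<ge> 0" for z unfolding fPQ[symmetric] using assms(2) by simp
  then obtain s where s: "is_sos s" "is_sos (P * Q * s)" "\<forall>a. loc_pos_def a s"
    using nonneg_loc_pos_def_multiplier by blast
  have "is_sos (Q\<^sup>2 * s)" using s(1) by (intro is_sos_mult is_sos_square)
  moreover have "loc_pos_def a (Q\<^sup>2 * s)" for a using lpQ s(3) loc_pos_def_mult by blast
  moreover have "f z * evalp (Q\<^sup>2 * s) z = evalp (P * Q * s) z" for z
    using fPQ[of z] by (simp add: mult.assoc[symmetric])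
  ultimately show ?thesis using s(2) by blast
qed

text \<open>Off the zeros of \<open>H * q\<close> the point lies in the domain and the quotient is
  defined; this set is dense, and the identity without division is continuous.\<close>

lemma regulous0_1_quotient_everywhere:
  assumes "regulous0_1 f" "q \<noteq> 0" "\<forall>z\<in>rdom f. evalp q z \<noteq> 0 \<longrightarrow> f z = evalp p z / evalp q z"
  shows "f z * evalp q z = evalp p z"
proof -
  have cont: "continuous_on UNIV f" using assms(1) by (simp add: regulous0_1_def regulous0_def)
  obtain P Q H where H: "H \<noteq> 0" "\<forall>z. evalp H z \<noteq> 0 \<longrightarrow> evalp Q z \<noteq> 0 \<and> f z = evalp P z / evalp Q z"
    using assms(1) unfolding regulous0_1_def regulous0_def by blast
  have "H * q \<noteq> 0" using H(1) assms(2) by simp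
  then show ?thesis
  proof (rule continuous_eq_dense)
    show "continuous_on UNIV (\<lambda>z. f z * evalp q z)" "continuous_on UNIV (evalp p)"
      using continuous_on_evalp[OF continuous_on_id] by (auto intro!: continuous_on_mult cont)
    fix w assume "evalp (H * q) w \<noteq> 0"
    then have w: "evalp H w \<noteq> 0" "evalp q w \<noteq> 0" by auto
    then have "w \<in> rdom f" using H unfolding rdom_def by blast
    then show "f w * evalp q w = evalp p w" using assms(3) w(2) by simp
  qed
qed

theorem theorem6p9:
  shows "(\<forall>f. regulous0_1 f \<and> (\<forall>z. f z \<ge> 0) \<longrightarrow>
            (\<exists>fs. (\<forall>g\<in>set fs. regulous0_1 g) \<and> (\<forall>z. f z = (\<Sum>g\<leftarrow>fs. (g z)\<^sup>2))))
       \<and> (\<forall>f p q. regulous0_1 f \<and> (\<forall>z. f z \<ge> 0) \<and> is_sos p \<and> is_sos q \<and>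
            (\<forall>a. loc_pos_def a q) \<and>
            (\<forall>z\<in>rdom f. evalp q z \<noteq> 0 \<longrightarrow> f z = evalp p z / evalp q z) \<longrightarrow>
            (let D = (\<lambda>z. evalp q z *
                        (\<Prod>a\<in>{a. evalp q a = 0 \<and> f a \<noteq> 0}. low_comp a q z))
             in \<exists>fs rs. length fs = length rs \<and>
                  (\<forall>g\<in>set fs. regulous0_1 g) \<and>
                  (\<forall>z. f z = (\<Sum>g\<leftarrow>fs. (g z)\<^sup>2)) \<and>
                  (\<forall>i<length fs. \<forall>z. D z \<noteq> 0 \<longrightarrow> (fs ! i) z = evalp (rs ! i) z / D z)))"
proof (intro conjI allI impI)
  fix f assume "regulous0_1 f \<and> (\<forall>z. f z \<ge> 0)"
  then have f: "regulous0_1 f" "\<And>z. f z \<ge> 0" by auto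
  then have cont: "continuous_on UNIV f" by (simp add: regulous0_1_def regulous0_def)
  obtain p q where "is_sos p" "is_sos q" "\<And>a. loc_pos_def a q" "\<And>z. f z * evalp q z = evalp p z"
    using regulous0_1_sos_representation[OF f] by blast
  from sos_quotient_decomposition[OF cont f(2) this]
  show "\<exists>fs. (\<forall>g\<in>set fs. regulous0_1 g) \<and> (\<forall>z. f z = (\<Sum>g\<leftarrow>fs. (g z)\<^sup>2))" by blast
next
  fix f p q
  assume "regulous0_1 f \<and> (\<forall>z. f z \<ge> 0) \<and> is_sos p \<and> is_sos q \<and> (\<forall>a. loc_pos_def a q) \<and>
    (\<forall>z\<in>rdom f. evalp q z \<noteq> 0 \<longrightarrow> f z = evalp p z / evalp q z)"
  then have f: "regulous0_1 f" "\<And>z. f z \<ge> 0" and p: "is_sos p" and q: "is_sos q" "\<And>a. loc_pos_def a q"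
    and pq: "\<forall>z\<in>rdom f. evalp q z \<noteq> 0 \<longrightarrow> f z = evalp p z / evalp q z" by blast+
  have cont: "continuous_on UNIV f" using f(1) by (simp add: regulous0_1_def regulous0_def)
  have "f z * evalp q z = evalp p z" for z
    by (rule regulous0_1_quotient_everywhere[OF f(1) loc_pos_defD(1)[OF q(2)] pq])
  from sos_quotient_decomposition[OF cont f(2) p q this]
  show "let D = (\<lambda>z. evalp q z * (\<Prod>a\<in>{a. evalp q a = 0 \<and> f a \<noteq> 0}. low_comp a q z))
    in \<exists>fs rs. length fs = length rs \<and> (\<forall>g\<in>set fs. regulous0_1 g) \<and>
      (\<forall>z. f z = (\<Sum>g\<leftarrow>fs. (g z)\<^sup>2)) \<and>
      (\<forall>i<length fs. \<forall>z. D z \<noteq> 0 \<longrightarrow> (fs ! i) z = evalp (rs ! i) z / D z)"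
    \<comment> \<open>Evaluating the polynomial denominator turns its factors into the functions
      \<open>low_comp a q\<close>.\<close>
    unfolding Let_def evalp_mult evalp_prod evalp_hom_poly_low_deg .
qed

end
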